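(* Let $E$ be a rearrangement invariant space on $[0,1]$. If the natural embedding $E\subset L_1([0,1])$ is not strictly singular, then $G_1$ embeds into $E$ continuously (i.e. $G_1\subset E$ and the inclusion map $G_1\to E$ is bounded).
   Context: All function spaces consist of (equivalence classes modulo a.e. equality of) real measurable functions on $[0,1]$ with Lebesgue measure. For a measurable function $x$, $x^*$ denotes the non-increasing rearrangement of $|x|$. A rearrangement invariant (r.i.) space $E$ on $[0,1]$ (in the sense of Lindenstrauss–Tzafriri) is a Banach space of such functions with the following properties. If $y\in E$ and $|x|\le |y|$ a.e., then $x\in E$ and $\|x\|_E\le\|y\|_E$. If $y\in E$ and $x^*=y^*$, then $x\in E$ and $\|x\|_E=\|y\|_E$. One has $L_\infty([0,1])\subset E\subset L_1([0,1])$ with both inclusions of norm one. Finally, let $E'$ be the space of measurable $y$ with $\|y\|_{E'}=\sup\{\int_0^1 xy\,dt : \|x\|_E\le 1\}<\infty$, and let $E''=(E')'$. Then $\|x\|_E=\|x\|_{E''}$ for $x\in E$, and $E$ is either equal to $E''$ or equal to the closure of the simple functions in $E''$. A bounded linear map between normed spaces is strictly singular if there is no infinite-dimensional subspace of the domain on which the map is an isomorphism onto its image. If $\varphi:[0,1]\to[0,1]$ is increasing and concave with $\varphi(0)=0$ and $\varphi(1)=1$, the Lorentz space $\Lambda(\varphi)$ consists of all $x$ for which the norm $\|x\|_{\Lambda(\varphi)}=\int_0^1 x^*(t)\,d\varphi(t)$ is finite. $G_1$ denotes the Lorentz space $\Lambda(\varphi)$ with $\varphi(t)=\dfrac{2}{\sqrt{\log(e^4/t)}}$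 for $0<t\le1$ and $\varphi(0)=0$. *)

theory Defs
  imports "HOL-Analysis.Analysis" "HOL-Probability.Essential_Supremum"
begin

text \<open>
  A space of functions on \<open>[0,1]\<close> modulo equality almost everywhere is given by a set of
  measurable representatives and a real-valued norm function, which is only meaningful on that
  set. The values of representatives outside \<open>[0,1]\<close> play no role.
\<close>

abbreviation unit_leb :: "real measure" where
  "unit_leb \<equiv> lebesgue_on {0..1}"

type_synonym rfun = "real \<Rightarrow> real"

subsection \<open>Normed spaces of functions modulo null sets\<close>

definition fun_subspace :: "rfun set \<Rightarrow> bool" where
  "fun_subspace V \<longleftrightarrow>
     V \<subseteq> borel_measurable unit_leb \<and> (\<lambda>_. 0) \<in> V \<and>
     (\<forall>x\<in>V. \<forall>y\<in>V. (\<lambda>t. x t + y t) \<in> V) \<and>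
     (\<forall>c. \<forall>x\<in>V. (\<lambda>t. c * x t) \<in> V)"

definition normed_fun_space :: "rfun set \<Rightarrow> (rfun \<Rightarrow> real) \<Rightarrow> bool" where
  "normed_fun_space E N \<longleftrightarrow>
     fun_subspace E \<and>
     (\<forall>x\<in>E. \<forall>y\<in>borel_measurable unit_leb.
        (AE t in unit_leb. x t = y t) \<longrightarrow> y \<in> E \<and> N y = N x) \<and>
     (\<forall>x\<in>E. 0 \<le> N x) \<and>
     (\<forall>x\<in>E. N x = 0 \<longleftrightarrow> (AE t in unit_leb. x t = 0)) \<and>
     (\<forall>c. \<forall>x\<in>E. N (\<lambda>t. c * x t) = \<bar>c\<bar> * N x) \<and>
     (\<forall>x\<in>E. \<forall>y\<in>E. N (\<lambda>t. x t + y t) \<le> N x + N y)"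

definition banach_fun_space :: "rfun set \<Rightarrow> (rfun \<Rightarrow> real) \<Rightarrow> bool" where
  "banach_fun_space E N \<longleftrightarrow>
     normed_fun_space E N \<and>
     (\<forall>X :: nat \<Rightarrow> rfun. range X \<subseteq> E \<longrightarrow>
        (\<forall>e>0. \<exists>K. \<forall>m\<ge>K. \<forall>n\<ge>K. N (\<lambda>t. X m t - X n t) < e) \<longrightarrow>
        (\<exists>x\<in>E. (\<lambda>n. N (\<lambda>t. X n t - x t)) \<longlonglongrightarrow> 0))"

definition inclusion_bounded ::
    "rfun set \<Rightarrow> (rfun \<Rightarrow> real) \<Rightarrow> rfun set \<Rightarrow> (rfun \<Rightarrow> real) \<Rightarrow> bool" where
  "inclusion_bounded E N F K \<longleftrightarrow> E \<subseteq> F \<and> (\<exists>C. \<forall>x\<in>E. K x \<le> C * N x)"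

text \<open>The operator norm of the inclusion is the least admissible constant; it equals 1.\<close>

definition inclusion_norm_one ::
    "rfun set \<Rightarrow> (rfun \<Rightarrow> real) \<Rightarrow> rfun set \<Rightarrow> (rfun \<Rightarrow> real) \<Rightarrow> bool" where
  "inclusion_norm_one E N F K \<longleftrightarrow>
     E \<subseteq> F \<and> (\<forall>x\<in>E. K x \<le> N x) \<and>
     (\<forall>C\<ge>0. (\<forall>x\<in>E. K x \<le> C * N x) \<longrightarrow> 1 \<le> C)"

text \<open>Dimension is taken modulo equality almost everywhere.\<close>

definition infinite_dim :: "rfun set \<Rightarrow> bool" where
  "infinite_dim V \<longleftrightarrow>
     \<not> (\<exists>B. finite B \<and> B \<subseteq> V \<and>
          (\<forall>x\<in>V. \<exists>c :: rfun \<Rightarrow> real. AE t in unit_leb. x t = (\<Sum>b\<in>B. c b * b t)))"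

definition isomorphism_onto_image ::
    "rfun set \<Rightarrow> (rfun \<Rightarrow> real) \<Rightarrow> (rfun \<Rightarrow> real) \<Rightarrow> (rfun \<Rightarrow> rfun) \<Rightarrow> bool" where
  "isomorphism_onto_image V N K T \<longleftrightarrow>
     (\<exists>c>0. \<exists>C. \<forall>x\<in>V. c * N x \<le> K (T x) \<and> K (T x) \<le> C * N x)"

text \<open>
  Intended for bounded linear maps \<open>T\<close> from \<open>E\<close> (with norm \<open>N\<close>) to a space with norm \<open>K\<close>.
\<close>

definition strictly_singular ::
    "rfun set \<Rightarrow> (rfun \<Rightarrow> real) \<Rightarrow> (rfun \<Rightarrow> real) \<Rightarrow> (rfun \<Rightarrow> rfun) \<Rightarrow> bool" where
  "strictly_singular E N K T \<longleftrightarrow>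
     \<not> (\<exists>V. V \<subseteq> E \<and> fun_subspace V \<and> infinite_dim V \<and> isomorphism_onto_image V N K T)"

subsection \<open>The end point spaces\<close>

definition L1 :: "rfun set" where
  "L1 = {x. integrable unit_leb x}"

definition L1_norm :: "rfun \<Rightarrow> real" where
  "L1_norm x = (LINT t|unit_leb. \<bar>x t\<bar>)"

definition Linf :: "rfun set" where
  "Linf = {x \<in> borel_measurable unit_leb. esssup unit_leb (\<lambda>t. ennreal \<bar>x t\<bar>) < \<infinity>}"

definition Linf_norm :: "rfun \<Rightarrow> real" where
  "Linf_norm x = enn2real (esssup unit_leb (\<lambda>t. ennreal \<bar>x t\<bar>))"

subsection \<open>Rearrangement invariant spaces\<close>

text \<open>
  The right-continuous version of the rearrangement; its value at \<open>0\<close> is the essential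
  supremum of \<open>\<bar>x\<bar>\<close>, possibly infinite.
\<close>

definition rearrangement :: "rfun \<Rightarrow> real \<Rightarrow> ennreal" where
  "rearrangement x t =
     Inf {s. emeasure unit_leb {u \<in> space unit_leb. s < ennreal \<bar>x u\<bar>} \<le> ennreal t}"

text \<open>
  The requirement that the products \<open>x y\<close> be integrable makes the integrals in the supremum
  meaningful (the Bochner integral of a non-integrable function is \<open>0\<close>).
\<close>

definition assoc_space :: "rfun set \<Rightarrow> (rfun \<Rightarrow> real) \<Rightarrow> rfun set" where
  "assoc_space E N =
     {y \<in> borel_measurable unit_leb.
        (\<forall>x\<in>E. N x \<le> 1 \<longrightarrow> integrable unit_leb (\<lambda>t. x t * y t)) \<and>
        bdd_above ((\<lambda>x. LINT t|unit_leb. x t * y t) ` {x \<in> E. N x \<le> 1})}"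

definition assoc_norm :: "rfun set \<Rightarrow> (rfun \<Rightarrow> real) \<Rightarrow> rfun \<Rightarrow> real" where
  "assoc_norm E N y = (SUP x\<in>{x \<in> E. N x \<le> 1}. LINT t|unit_leb. x t * y t)"

definition biassoc_space :: "rfun set \<Rightarrow> (rfun \<Rightarrow> real) \<Rightarrow> rfun set" where
  "biassoc_space E N = assoc_space (assoc_space E N) (assoc_norm E N)"

definition biassoc_norm :: "rfun set \<Rightarrow> (rfun \<Rightarrow> real) \<Rightarrow> rfun \<Rightarrow> real" where
  "biassoc_norm E N = assoc_norm (assoc_space E N) (assoc_norm E N)"

definition simple_closure :: "rfun set \<Rightarrow> (rfun \<Rightarrow> real) \<Rightarrow> rfun set" where
  "simple_closure F K =
     {x \<in> F. \<forall>e>0. \<exists>s\<in>F. simple_function unit_leb s \<and> K (\<lambda>t. x t - s t) < e}"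

definition ri_space :: "rfun set \<Rightarrow> (rfun \<Rightarrow> real) \<Rightarrow> bool" where
  "ri_space E N \<longleftrightarrow>
     banach_fun_space E N \<and>
     (\<forall>y\<in>E. \<forall>x\<in>borel_measurable unit_leb.
        (AE t in unit_leb. \<bar>x t\<bar> \<le> \<bar>y t\<bar>) \<longrightarrow> x \<in> E \<and> N x \<le> N y) \<and>
     (\<forall>y\<in>E. \<forall>x\<in>borel_measurable unit_leb.
        (\<forall>t\<in>{0..1}. rearrangement x t = rearrangement y t) \<longrightarrow> x \<in> E \<and> N x = N y) \<and>
     inclusion_norm_one Linf Linf_norm E N \<and>
     inclusion_norm_one E N L1 L1_norm \<and>
     (\<forall>x\<in>E. N x = biassoc_norm E N x) \<and>
     (E = biassoc_space E N \<or> E = simple_closure (biassoc_space E N) (biassoc_norm E N))"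

subsection \<open>Lorentz spaces\<close>

text \<open>
  For increasing concave \<open>\<phi>\<close> on \<open>[0,1]\<close> with \<open>\<phi> 0 = 0\<close>, this is the Stieltjes measure of
  \<open>\<phi>\<close>. As \<open>interval_measure\<close> expects a right-continuous function on the real line, \<open>\<phi>\<close> is
  replaced by its right limits and extended by constants; a jump of \<open>\<phi>\<close> at \<open>0\<close> becomes an
  atom at \<open>0\<close>.
\<close>

definition stieltjes_measure :: "(real \<Rightarrow> real) \<Rightarrow> real measure" where
  "stieltjes_measure \<phi> =
     interval_measure (\<lambda>t. if t < 0 then 0 else if t < 1 then (INF s\<in>{t<..1}. \<phi> s) else \<phi> 1)"

definition lorentz_ennnorm :: "(real \<Rightarrow> real) \<Rightarrow> rfun \<Rightarrow> ennreal" where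
  "lorentz_ennnorm \<phi> x = (\<integral>\<^sup>+t\<in>{0..1}. rearrangement x t \<partial>stieltjes_measure \<phi>)"

definition lorentz_space :: "(real \<Rightarrow> real) \<Rightarrow> rfun set" where
  "lorentz_space \<phi> = {x \<in> borel_measurable unit_leb. lorentz_ennnorm \<phi> x < \<infinity>}"

definition lorentz_norm :: "(real \<Rightarrow> real) \<Rightarrow> rfun \<Rightarrow> real" where
  "lorentz_norm \<phi> x = enn2real (lorentz_ennnorm \<phi> x)"

definition \<phi>1 :: "real \<Rightarrow> real" where
  "\<phi>1 t = (if t = 0 then 0 else 2 / sqrt (ln (exp 4 / t)))"

definition G1 :: "rfun set" where
  "G1 = lorentz_space \<phi>1"

definition G1_norm :: "rfun \<Rightarrow> real" where
  "G1_norm = lorentz_norm \<phi>1"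

end

theory Submission
  imports Defs "HOL-Probability.Probability_Measure" "HOL-Real_Asymp.Real_Asymp"
begin

text \<open>
  Let \<open>f\<close> be the fundamental function of \<open>E\<close>, that is, \<open>f a\<close> is the norm of the indicator of
  \<open>[0, a]\<close>. A Lorentz space is the smallest r.i. space with its fundamental function, so it
  suffices to show that \<open>f \<le> K \<phi>1\<close>, i.e. \<open>f (c / 10\<^sup>k) = O(1 / \<surd>k)\<close>.

  Let \<open>V\<close> be an infinite-dimensional subspace of \<open>E\<close> on which the norm is equivalent to the \<open>L\<^sub>1\<close>
  norm. If the unit ball of \<open>V\<close> is not uniformly integrable, averaging its members over small sets
  gives \<open>f a \<le> K a\<close>. Otherwise \<open>V\<close> contains \<open>h\<^sub>1, \<dots>, h\<^sub>n\<close> of norm between 1 and 2 which up to small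
  \<open>L\<^sub>1\<close> errors are bounded and almost orthogonal. Let \<open>F = (\<Sum> h\<^sub>i\<^sup>2)\<^bsup>1/2\<^esup>\<close> and let \<open>m\<close> be its integral. A
  random combination \<open>x\<close> of the \<open>h\<^sub>i\<close>, whose coefficients are normalised sums of \<open>k\<close> independent
  signs, satisfies \<open>\<parallel>x\<parallel>\<^sub>1 \<le> 2 m\<close> with probability arbitrarily close to 1, because the quadratic
  form \<open>\<integral> x\<^sup>2 / F\<close> has mean \<open>m\<close> and a small variance. On the other hand, at each point
  \<open>x \<ge> \<surd>k F / 2\<close> with probability at least \<open>10\<^sup>-\<^sup>k\<close>, and \<open>F\<close> is comparable to \<open>m\<close> on a set of measure
  bounded below. So some \<open>x \<in> V\<close> with \<open>\<parallel>x\<parallel>\<^sub>1 \<le> 2 m\<close> exceeds \<open>c \<surd>k m\<close> on a set of measure \<open>c / 10\<^sup>k\<close>.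
\<close>

section \<open>Random signs\<close>

text \<open>The scale is dictated by \<open>\<phi>1\<close>: at \<open>c / 10^k\<close> it is of
  order \<open>1 / sqrt k\<close>, so some member of \<open>V\<close> must exceed a multiple of
  \<open>sqrt k\<close> times its norm on a set of measure exponentially small in \<open>k\<close>,
  as a Gaussian variable would. One sum of signs reaches a multiple of \<open>F\<close> with
  probability 1/10; \<open>k\<close> independent blocks divided by \<open>sqrt k\<close> give the
  rest without a central limit theorem.

  The obstacle is that this event may be as rare as \<open>10^-k\<close>, so combinations of large
  norm must be rarer still, and Markov's inequality is useless. L1 has no inner product; the weight
  \<open>1 / F\<close> supplies one, in which the squared norm of a random combination has mean
  exactly \<open>m\<close> and the Gram matrix has squared Hilbert-Schmidt norm at most
  \<open>\<sigma> * m\<close>. Chebyshev then bounds the bad proportion by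
  \<open>\<sigma> / m\<close>. Pushing this below \<open>10^-k\<close> forces a new system
  \<open>h\<close> for every \<open>k\<close>, whereas the set where \<open>F\<close> is comparable
  to \<open>m\<close> must keep its size for all \<open>n\<close> and \<open>k\<close>: this comes
  from a bound on the measure of \<open>{|x| >= L1_norm x / 4}\<close> valid on all of
  \<open>V\<close>.\<close>

definition sg :: "'i set \<Rightarrow> 'i \<Rightarrow> real" where
  "sg S i = (if i \<in> S then 1 else -1)"

text \<open>A sign vector on \<open>J\<close> is encoded as the subset of \<open>J\<close> carrying
  the sign +1. Expectations become sums over \<open>Pow J\<close> divided by
  \<open>2 ^ card J\<close>, and probabilities become cardinalities, so inductions on
  \<open>J\<close> replace independence arguments.\<close>

definition signed_sum :: "('i \<Rightarrow> real) \<Rightarrow> 'i set \<Rightarrow> 'i set \<Rightarrow> real" where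
  "signed_sum a J S = (\<Sum>i\<in>J. sg S i * a i)"

lemma sg_square [simp]: "sg S i * sg S i = 1" "(sg S i)\<^sup>2 = 1" "\<bar>sg S i\<bar> = 1"
  by (auto simp: sg_def)

text \<open>Conditioning on the sign of \<open>i\<close>; this is the induction step of every moment
  computation below.\<close>

lemma sum_Pow_insert:
  assumes "i \<notin> J"
  shows "(\<Sum>S\<in>Pow (insert i J). f S) = (\<Sum>S\<in>Pow J. f S + f (insert i S))"
proof (cases "finite J")
  case True
  have inj: "inj_on (insert i) (Pow J)"
    using assms by (auto simp: inj_on_def)
  have "(\<Sum>S\<in>Pow (insert i J). f S) = (\<Sum>S\<in>Pow J. f S) + (\<Sum>S\<in>insert i ` Pow J. f S)"
    unfolding Pow_insert using assms True by (intro sum.union_disjoint) auto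
  also have "(\<Sum>S\<in>insert i ` Pow J. f S) = (\<Sum>S\<in>Pow J. f (insert i S))"
    using sum.reindex[OF inj] by simp
  finally show ?thesis by (simp add: sum.distrib)
next
  case False
  then show ?thesis by (simp add: finite_Pow_iff)
qed

lemma signed_sum_insert:
  assumes "finite J" "i \<notin> J" "S \<subseteq> J"
  shows "signed_sum a (insert i J) S = signed_sum a J S - a i"
    and "signed_sum a (insert i J) (insert i S) = signed_sum a J S + a i"
proof -
  have "i \<notin> S" using assms by auto
  then show "signed_sum a (insert i J) S = signed_sum a J S - a i"
    using assms by (simp add: signed_sum_def sg_def)
  have "(\<Sum>j\<in>J. sg (insert i S) j * a j) = (\<Sum>j\<in>J. sg S j * a j)"
    using assms by (intro sum.cong) (auto simp: sg_def)
  then show "signed_sum a (insert i J) (insert i S) = signed_sum a J S + a i"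
    using assms by (simp add: signed_sum_def) (simp add: sg_def)
qed

section \<open>Moments of signed sums\<close>

lemma signed_sum_second_moment:
  assumes "finite J"
  shows "(\<Sum>S\<in>Pow J. (signed_sum a J S)\<^sup>2) = 2 ^ card J * (\<Sum>i\<in>J. (a i)\<^sup>2)"
  using assms
proof (induction J)
  case empty
  then show ?case by (simp add: signed_sum_def)
next
  case (insert i J)
  have "(\<Sum>S\<in>Pow (insert i J). (signed_sum a (insert i J) S)\<^sup>2)
      = (\<Sum>S\<in>Pow J. 2 * (signed_sum a J S)\<^sup>2 + 2 * (a i)\<^sup>2)"
    unfolding sum_Pow_insert[OF insert(2)]
    by (intro sum.cong refl) (simp add: signed_sum_insert[OF insert(1,2)] power2_eq_square algebra_simps)
  also have "\<dots> = 2 * (2 ^ card J * (\<Sum>i\<in>J. (a i)\<^sup>2)) + 2 ^ card J * (2 * (a i)\<^sup>2)"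
    using insert by (simp add: sum.distrib sum_distrib_left[symmetric] card_Pow)
  finally show ?case using insert by (simp add: algebra_simps)
qed

lemma signed_sum_fourth_moment:
  assumes "finite J"
  shows "(\<Sum>S\<in>Pow J. (signed_sum a J S) ^ 4) \<le> 2 ^ card J * (3 * (\<Sum>i\<in>J. (a i)\<^sup>2)\<^sup>2)"
  using assms
proof (induction J)
  case empty
  then show ?case by (simp add: signed_sum_def)
next
  case (insert i J)
  let ?X = "signed_sum a J" and ?s = "\<Sum>i\<in>J. (a i)\<^sup>2"
  have "(\<Sum>S\<in>Pow (insert i J). (signed_sum a (insert i J) S) ^ 4)
      = (\<Sum>S\<in>Pow J. 2 * (?X S) ^ 4 + 12 * (a i)\<^sup>2 * (?X S)\<^sup>2 + 2 * (a i) ^ 4)"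
    unfolding sum_Pow_insert[OF insert(2)]
    by (intro sum.cong refl)
      (simp add: signed_sum_insert[OF insert(1,2)] power2_eq_square power4_eq_xxxx algebra_simps)
  also have "\<dots> = 2 * (\<Sum>S\<in>Pow J. (?X S) ^ 4) + 12 * (a i)\<^sup>2 * (2 ^ card J * ?s)
      + 2 ^ card J * (2 * (a i) ^ 4)"
    using insert signed_sum_second_moment[of J a]
    by (simp add: sum.distrib sum_distrib_left[symmetric] card_Pow)
  \<comment> \<open>Enlarging the coefficient 2 of \<open>(a i) ^ 4\<close> to 6 completes the
    square: \<open>6 s^2 + 12 a^2 s + 6 a^4 = 6 (s + a^2)^2\<close>.\<close>
  also have "\<dots> \<le> 2 * (2 ^ card J * (3 * ?s\<^sup>2)) + 12 * (a i)\<^sup>2 * (2 ^ card J * ?s)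
      + 2 ^ card J * (6 * (a i) ^ 4)"
    using insert(3) by (intro add_mono mult_left_mono) auto
  also have "\<dots> = 2 ^ card (insert i J) * (3 * (\<Sum>i\<in>insert i J. (a i)\<^sup>2)\<^sup>2)"
    using insert by (simp add: power2_eq_square power4_eq_xxxx algebra_simps)
  finally show ?case .
qed

text \<open>Khintchine's inequality, from \<open>2 \<bar>u\<bar> \<ge> 3 u\<^sup>2 - u\<^sup>4\<close> at \<open>u = X / (\<surd>3 s)\<close>.\<close>

lemma signed_sum_abs_moment:
  assumes "finite J"
  shows "2 ^ card J * (sqrt (\<Sum>i\<in>J. (a i)\<^sup>2) / 2) \<le> (\<Sum>S\<in>Pow J. \<bar>signed_sum a J S\<bar>)"
proof (cases "(\<Sum>i\<in>J. (a i)\<^sup>2) = 0")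
  case True
  then show ?thesis by (simp add: sum_nonneg)
next
  case False
  define v where "v = (\<Sum>i\<in>J. (a i)\<^sup>2)"
  have v: "v > 0" using False unfolding v_def by (simp add: order_less_le sum_nonneg)
  define w where "w = sqrt (3 * v)"
  have w: "w > 0" "w\<^sup>2 = 3 * v" using v by (auto simp: w_def)
  have pt: "(3 * x\<^sup>2 / w - x ^ 4 / w ^ 3) / 2 \<le> \<bar>x\<bar>" for x :: real
  proof -
    define u where "u = \<bar>x\<bar> / w"
    have u: "u \<ge> 0" "\<bar>x\<bar> = u * w" using w by (auto simp: u_def)
    have "0 \<le> u * (u - 1)\<^sup>2 * (u + 2)" using u by simp
    also have "\<dots> = 2 * u - 3 * u\<^sup>2 + u ^ 4"
      by (simp add: power2_eq_square power4_eq_xxxx algebra_simps)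
    finally have "w * ((3 * u\<^sup>2 - u ^ 4) / 2) \<le> w * u" using w by (intro mult_left_mono) auto
    moreover have "x\<^sup>2 = (u * w)\<^sup>2" "x ^ 4 = (u * w) ^ 4"
      using u(2) by (metis power2_abs, metis power_even_abs even_numeral)
    then have "(3 * x\<^sup>2 / w - x ^ 4 / w ^ 3) / 2 = w * ((3 * u\<^sup>2 - u ^ 4) / 2)"
      using w(1) by (simp add: field_simps power2_eq_square power4_eq_xxxx power3_eq_cube)
    ultimately show ?thesis using u by (simp add: mult.commute)
  qed
  have "(\<Sum>S\<in>Pow J. (3 * (signed_sum a J S)\<^sup>2 / w - (signed_sum a J S) ^ 4 / w ^ 3) / 2)
     = (3 * (\<Sum>S\<in>Pow J. (signed_sum a J S)\<^sup>2) / w - (\<Sum>S\<in>Pow J. (signed_sum a J S) ^ 4) / w ^ 3) / 2"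
    by (simp add: sum_divide_distrib sum_subtractf sum_distrib_left diff_divide_distrib)
  also have "\<dots> \<ge> (3 * (2 ^ card J * v) / w - (2 ^ card J * (3 * v\<^sup>2)) / w ^ 3) / 2"
    using signed_sum_second_moment[OF assms, of a] signed_sum_fourth_moment[OF assms, of a] w(1)
    unfolding v_def by (intro divide_right_mono diff_mono) auto
  finally have A: "(3 * (2 ^ card J * v) / w - (2 ^ card J * (3 * v\<^sup>2)) / w ^ 3) / 2
    \<le> (\<Sum>S\<in>Pow J. \<bar>signed_sum a J S\<bar>)"
    using sum_mono[of "Pow J", OF pt] by (meson order_trans)
  have "w ^ 3 = w * (3 * v)" using w(2) by (simp add: power3_eq_cube power2_eq_square)
  then have B: "(3 * (2 ^ card J * v) / w - (2 ^ card J * (3 * v\<^sup>2)) / w ^ 3) / 2 = 2 ^ card J * (v / w)"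
    using w(1) v by (simp add: field_simps power2_eq_square)
  have "w \<le> 2 * sqrt v"
    unfolding w_def using v by (auto simp: real_sqrt_mult intro!: mult_right_mono real_le_lsqrt)
  then have "w * sqrt v \<le> 2 * v" using v by (metis abs_of_pos mult.assoc mult_right_mono real_sqrt_ge_zero real_sqrt_mult_self less_imp_le)
  then have "sqrt v / 2 \<le> v / w" using w(1) by (simp add: field_simps)
  then show ?thesis using A B v_def by (smt (verit) mult_left_mono zero_le_power)
qed

section \<open>Large values of signed sums\<close>

lemma signed_sum_complement:
  assumes "S \<subseteq> J"
  shows "signed_sum a J (J - S) = - signed_sum a J S"
  unfolding signed_sum_def sum_negf[symmetric] using assms
  by (intro sum.cong) (auto simp: sg_def)

text \<open>Paley--Zygmund for the square, through \<open>1 - (u - 3)\<^sup>2 / (11/4)\<^sup>2 \<le> 1\<^bsub>u \<ge> 1/4\<^esub>\<close>;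
  the factor \<open>1/2\<close> lost afterwards is the symmetry of the signed sum.\<close>

lemma signed_sum_tail:
  assumes "finite J"
  shows "2 ^ card J * (1 / 10) \<le> real (card {S \<in> Pow J. sqrt (\<Sum>i\<in>J. (a i)\<^sup>2) / 2 \<le> signed_sum a J S})"
proof (cases "(\<Sum>i\<in>J. (a i)\<^sup>2) = 0")
  case True
  then have "signed_sum a J S = 0" for S
    using assms by (auto simp: sum_nonneg_eq_0_iff signed_sum_def)
  then have "{S \<in> Pow J. sqrt (\<Sum>i\<in>J. (a i)\<^sup>2) / 2 \<le> signed_sum a J S} = Pow J"
    using True by auto
  then show ?thesis using assms by (simp add: card_Pow)
next
  case False
  define v where "v = (\<Sum>i\<in>J. (a i)\<^sup>2)"
  have v: "v > 0" using False unfolding v_def by (simp add: order_less_le sum_nonneg)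
  let ?X = "signed_sum a J"
  define P where "P = {S \<in> Pow J. sqrt v / 2 \<le> ?X S}"
  define R where "R = {S \<in> Pow J. sqrt v / 2 \<le> - ?X S}"
  have fin: "finite P" "finite R" using assms by (auto simp: P_def R_def)
  have "bij_betw (\<lambda>S. J - S) P R"
    by (rule bij_betw_byWitness[where f' = "\<lambda>S. J - S"])
      (auto simp: P_def R_def signed_sum_complement double_diff)
  then have card: "card P = card R" by (rule bij_betw_same_card)
  have pt: "1 - 16 / 121 * ((?X S)\<^sup>2 / v - 3)\<^sup>2 \<le> of_bool (S \<in> P \<union> R)" if "S \<in> Pow J" for S
  proof (cases "S \<in> P \<union> R")
    case True
    then show ?thesis by simp
  next
    case False
    then have "\<bar>?X S\<bar> < sqrt v / 2" using that by (auto simp: P_def R_def)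
    then have "(?X S)\<^sup>2 \<le> (sqrt v / 2)\<^sup>2"
      by (metis abs_ge_zero less_imp_le power2_abs power_mono)
    then have "(?X S)\<^sup>2 / v \<le> 1 / 4" using v by (simp add: field_simps power2_eq_square)
    then have "(11/4)\<^sup>2 \<le> (3 - (?X S)\<^sup>2 / v)\<^sup>2" by (intro power_mono) auto
    then have "(11/4)\<^sup>2 \<le> ((?X S)\<^sup>2 / v - 3)\<^sup>2" by (simp add: power2_commute)
    then have "121 / 16 \<le> ((?X S)\<^sup>2 / v - 3)\<^sup>2" by (simp add: power2_eq_square)
    then show ?thesis using False by simp
  qed
  \<comment> \<open>With normalised second moment 1 and fourth moment at most 3 the average is at
    least \<open>(-23 + 96 - 48) / 121 = 25 / 121\<close>; half of it still exceeds 1/10.\<close>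
  have "(\<Sum>S\<in>Pow J. 1 - 16 / 121 * ((?X S)\<^sup>2 / v - 3)\<^sup>2)
    = (\<Sum>S\<in>Pow J. - 23 / 121 + 96 / (121 * v) * (?X S)\<^sup>2 - 16 / (121 * v\<^sup>2) * (?X S) ^ 4)"
    using v by (intro sum.cong refl) (simp add: field_simps power2_eq_square power4_eq_xxxx)
  also have "\<dots> = - 23 / 121 * 2 ^ card J + 96 / (121 * v) * (\<Sum>S\<in>Pow J. (?X S)\<^sup>2)
     - 16 / (121 * v\<^sup>2) * (\<Sum>S\<in>Pow J. (?X S) ^ 4)"
    using assms by (simp add: sum.distrib sum_subtractf sum_distrib_left card_Pow)
  also have "\<dots> \<ge> - 23 / 121 * 2 ^ card J + 96 / (121 * v) * (2 ^ card J * v)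
     - 16 / (121 * v\<^sup>2) * (2 ^ card J * (3 * v\<^sup>2))"
    using signed_sum_second_moment[OF assms, of a] v
      mult_left_mono[OF signed_sum_fourth_moment[OF assms, of a], of "16 / (121 * v\<^sup>2)"]
    unfolding v_def by simp
  also have "- 23 / 121 * 2 ^ card J + 96 / (121 * v) * (2 ^ card J * v)
     - 16 / (121 * v\<^sup>2) * (2 ^ card J * (3 * v\<^sup>2)) = 25 / 121 * 2 ^ card J"
    using v by (simp add: field_simps)
  also have "(\<Sum>S\<in>Pow J. 1 - 16 / 121 * ((?X S)\<^sup>2 / v - 3)\<^sup>2) \<le> (\<Sum>S\<in>Pow J. of_bool (S \<in> P \<union> R))"
    by (intro sum_mono pt)
  finally have "25 / 121 * 2 ^ card J \<le> (\<Sum>S\<in>Pow J. of_bool (S \<in> P \<union> R) :: real)" .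
  also have "\<dots> = real (card (P \<union> R))"
  proof -
    have "Pow J \<inter> {S. S \<in> P \<union> R} = P \<union> R" by (auto simp: P_def R_def)
    then show ?thesis using assms by (simp add: sum_of_bool_eq del: Un_iff of_bool_or_iff)
  qed
  also have "\<dots> \<le> 2 * real (card P)"
    using card_Un_le[of P R] card by linarith
  finally show ?thesis unfolding P_def v_def by simp
qed

text \<open>Independence in counting form: signs on the disjoint sets \<open>A\<close> and
  \<open>B\<close> are chosen separately, and \<open>(S, T) \<mapsto> S \<union> T\<close> injects
  pairs of favourable choices into favourable choices.\<close>

lemma signed_sum_tail_Un:
  assumes "finite A" "finite B" "A \<inter> B = {}"
  shows "card {S \<in> Pow A. s \<le> signed_sum a A S} * card {S \<in> Pow B. t \<le> signed_sum a B S}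
    \<le> card {S \<in> Pow (A \<union> B). s + t \<le> signed_sum a (A \<union> B) S}"
proof -
  let ?P = "{S \<in> Pow A. s \<le> signed_sum a A S}" and ?R = "{S \<in> Pow B. t \<le> signed_sum a B S}"
  have inj: "inj_on (\<lambda>(S, T). S \<union> T) (?P \<times> ?R)"
    using assms(3) by (auto simp: inj_on_def) blast+
  have "signed_sum a (A \<union> B) (S \<union> T) = signed_sum a A S + signed_sum a B T"
    if "S \<subseteq> A" "T \<subseteq> B" for S T
  proof -
    have "(\<Sum>i\<in>A. sg (S \<union> T) i * a i) = (\<Sum>i\<in>A. sg S i * a i)"
      "(\<Sum>i\<in>B. sg (S \<union> T) i * a i) = (\<Sum>i\<in>B. sg T i * a i)"
      using that assms(3) by (auto intro!: sum.cong simp: sg_def)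
    then show ?thesis using assms by (simp add: signed_sum_def sum.union_disjoint)
  qed
  then have "(\<lambda>(S, T). S \<union> T) ` (?P \<times> ?R) \<subseteq> {S \<in> Pow (A \<union> B). s + t \<le> signed_sum a (A \<union> B) S}"
    by fastforce
  then have "card ((\<lambda>(S, T). S \<union> T) ` (?P \<times> ?R)) \<le> card {S \<in> Pow (A \<union> B). s + t \<le> signed_sum a (A \<union> B) S}"
    using assms by (intro card_mono) auto
  then show ?thesis unfolding card_image[OF inj] card_cartesian_product .
qed

text \<open>Taking \<open>k\<close> copies of every coefficient makes \<open>k\<close> independent blocks, which are
  simultaneously large with probability at least \<open>10\<^sup>-\<^sup>k\<close>.\<close>

lemma signed_sum_copies_tail:
  assumes "finite I"
  shows "2 ^ (k * card I) * (1 / 10) ^ k \<le> real (card {S \<in> Pow ({..<k} \<times> I).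
    real k * (sqrt (\<Sum>i\<in>I. (a i)\<^sup>2) / 2) \<le> signed_sum (\<lambda>(j, i). a i) ({..<k} \<times> I) S})"
proof (induction k)
  case 0
  have "{S \<in> Pow ({..<0::nat} \<times> I). real 0 * (sqrt (\<Sum>i\<in>I. (a i)\<^sup>2) / 2) \<le> signed_sum (\<lambda>(j, i). a i) ({..<0} \<times> I) S} = {{}}"
    by (auto simp: signed_sum_def)
  then show ?case by simp
next
  case (Suc k)
  let ?b = "\<lambda>(j::nat, i). a i" and ?w = "sqrt (\<Sum>i\<in>I. (a i)\<^sup>2) / 2"
  have eq: "{..<Suc k} \<times> I = ({..<k} \<times> I) \<union> ({k} \<times> I)" by auto
  have "(\<Sum>x\<in>{k} \<times> I. (?b x)\<^sup>2) = (\<Sum>i\<in>I. (a i)\<^sup>2)"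
    using sum.cartesian_product[of "\<lambda>_ i. (a i)\<^sup>2" I "{k}"] by (simp add: case_prod_beta)
  then have one: "2 ^ card I * (1 / 10) \<le> real (card {S \<in> Pow ({k} \<times> I). ?w \<le> signed_sum ?b ({k} \<times> I) S})"
    using signed_sum_tail[of "{k} \<times> I" ?b] assms by (simp add: card_cartesian_product)
  have "2 ^ (Suc k * card I) * (1 / 10) ^ Suc k
     = (2 ^ (k * card I) * (1 / 10) ^ k) * (2 ^ card I * (1 / 10 :: real))"
    by (simp add: power_add)
  also have "\<dots> \<le> real (card {S \<in> Pow ({..<k} \<times> I). real k * ?w \<le> signed_sum ?b ({..<k} \<times> I) S})
     * real (card {S \<in> Pow ({k} \<times> I). ?w \<le> signed_sum ?b ({k} \<times> I) S})"
    using Suc one by (intro mult_mono) auto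
  also have "\<dots> \<le> real (card {S \<in> Pow ({..<Suc k} \<times> I). real k * ?w + ?w \<le> signed_sum ?b ({..<Suc k} \<times> I) S})"
    unfolding eq of_nat_mult[symmetric] of_nat_le_iff
    using assms by (intro signed_sum_tail_Un) auto
  also have "real k * ?w + ?w = real (Suc k) * ?w" by (simp add: algebra_simps add_divide_distrib)
  finally show ?case .
qed

text \<open>Squares of signs are 1, so subtracting the trace leaves only the off-diagonal part. A
  new index \<open>i\<close> changes this part by plus or minus \<open>2 * X S\<close>, where
  \<open>X\<close> is the signed sum with coefficients \<open>A i j\<close>; over the two signs of
  \<open>i\<close> the cross terms cancel and \<open>8 * (X S)\<^sup>2\<close> remains, whose mean
  is the second moment of a signed sum.\<close>

lemma signed_quadratic_form_variance:
  fixes A :: "'i \<Rightarrow> 'i \<Rightarrow> real"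
  assumes "finite J" and sym: "\<And>i j. A i j = A j i"
  shows "(\<Sum>S\<in>Pow J. ((\<Sum>i\<in>J. \<Sum>j\<in>J. sg S i * sg S j * A i j) - (\<Sum>i\<in>J. A i i))\<^sup>2)
    \<le> 2 ^ card J * (2 * (\<Sum>i\<in>J. \<Sum>j\<in>J. (A i j)\<^sup>2))"
  using assms(1)
proof (induction J)
  case empty
  then show ?case by simp
next
  case (insert i J)
  define D where "D = (\<lambda>J S. (\<Sum>i\<in>J. \<Sum>j\<in>J. sg S i * sg S j * A i j) - (\<Sum>i\<in>J. A i i))"
  define X where "X = (\<lambda>S. signed_sum (A i) J S)"
  have i: "D (insert i J) S = D J S + sg S i * 2 * X S" if "finite J" "i \<notin> J" for S
  proof -
    have "D (insert i J) S = D J S + (\<Sum>j\<in>J. sg S i * sg S j * A i j) + (\<Sum>j\<in>J. sg S j * sg S i * A j i)"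
      using that by (simp add: D_def sum.distrib algebra_simps)
    also have "(\<Sum>j\<in>J. sg S j * sg S i * A j i) = (\<Sum>j\<in>J. sg S i * sg S j * A i j)"
      by (intro sum.cong refl) (subst sym[of _ i], simp)
    also have "(\<Sum>j\<in>J. sg S i * sg S j * A i j) = sg S i * X S"
      by (simp add: X_def signed_sum_def sum_distrib_left mult.assoc)
    finally show ?thesis by simp
  qed
  have sgi: "sg (insert i S) j = sg S j" if "j \<in> J" for S j
    using that insert(2) by (auto simp: sg_def)
  have DI: "D J (insert i S) = D J S" "X (insert i S) = X S" for S
    by (simp_all add: D_def X_def signed_sum_def sgi cong: sum.cong)
  have "(\<Sum>S\<in>Pow (insert i J). (D (insert i J) S)\<^sup>2) = (\<Sum>S\<in>Pow J. 2 * (D J S)\<^sup>2 + 8 * (X S)\<^sup>2)"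
    unfolding sum_Pow_insert[OF insert(2)]
  proof (intro sum.cong refl)
    fix S assume "S \<in> Pow J"
    then have "sg S i = -1" "sg (insert i S) i = 1" using insert(2) by (auto simp: sg_def)
    then show "(D (insert i J) S)\<^sup>2 + (D (insert i J) (insert i S))\<^sup>2 = 2 * (D J S)\<^sup>2 + 8 * (X S)\<^sup>2"
      unfolding i[OF insert(1,2)] DI by (simp add: power2_eq_square algebra_simps)
  qed
  also have "\<dots> = 2 * (\<Sum>S\<in>Pow J. (D J S)\<^sup>2) + 8 * (2 ^ card J * (\<Sum>j\<in>J. (A i j)\<^sup>2))"
    using signed_sum_second_moment[OF insert(1), of "A i"]
    by (simp add: sum.distrib sum_distrib_left[symmetric] X_def)
  \<comment> \<open>The added diagonal term is slack; it turns the bound into the full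
    Hilbert-Schmidt norm.\<close>
  also have "\<dots> \<le> 2 * (2 ^ card J * (2 * (\<Sum>i\<in>J. \<Sum>j\<in>J. (A i j)\<^sup>2))) + 8 * (2 ^ card J * (\<Sum>j\<in>J. (A i j)\<^sup>2))
      + 2 ^ card J * (4 * (A i i)\<^sup>2)"
  proof -
    have "0 \<le> 2 ^ card J * (4 * (A i i)\<^sup>2)" by simp
    then show ?thesis using insert(3) unfolding D_def by linarith
  qed
  also have "\<dots> = 2 ^ card (insert i J) * (2 * (\<Sum>k\<in>insert i J. \<Sum>j\<in>insert i J. (A k j)\<^sup>2))"
  proof -
    have "(\<Sum>j\<in>J. (A j i)\<^sup>2) = (\<Sum>j\<in>J. (A i j)\<^sup>2)"
      by (intro sum.cong refl) (subst sym, rule refl)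
    moreover have "(\<Sum>j\<in>insert i J. (A k j)\<^sup>2) = (A k i)\<^sup>2 + (\<Sum>j\<in>J. (A k j)\<^sup>2)" for k
      using insert(1,2) by simp
    ultimately show ?thesis using insert(1,2) by (simp add: sum.distrib algebra_simps)
  qed
  finally show ?case unfolding D_def .
qed

section \<open>Square functions in \<open>L\<^sub>1\<close>\<close>

text \<open>\<open>\<sigma>\<close> bounds the norm of the map
  \<open>a \<mapsto> (\<Sum>i\<in>J. a i * h i)\<close> from l2 to L1. It is the weak parameter, to
  be compared with the strong one, the integral \<open>m\<close> of the square function.\<close>

locale square_function =
  fixes M :: "'a measure" and J :: "'i set" and h :: "'i \<Rightarrow> 'a \<Rightarrow> real" and \<sigma> :: real
  assumes J: "finite J" and h: "\<And>i. i \<in> J \<Longrightarrow> integrable M (h i)"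
    and \<sigma>_pos: "0 < \<sigma>"
    and \<sigma>: "\<And>a. (\<integral>t. \<bar>\<Sum>i\<in>J. a i * h i t\<bar> \<partial>M) \<le> \<sigma> * sqrt (\<Sum>i\<in>J. (a i)\<^sup>2)"
begin

definition F :: "'a \<Rightarrow> real" where "F t = sqrt (\<Sum>i\<in>J. (h i t)\<^sup>2)"

definition m :: real where "m = (\<integral>t. F t \<partial>M)"

definition X :: "'i set \<Rightarrow> 'a \<Rightarrow> real" where "X S t = signed_sum (\<lambda>i. h i t) J S"

text \<open>The squared norm of \<open>X S\<close> in L2 with weight \<open>1 / F\<close>;
  \<open>A\<close> is the Gram matrix of the \<open>h i\<close> in the same space. Where
  \<open>F\<close> vanishes all \<open>h i\<close> vanish too, so the convention that division by 0
  gives 0 yields the right value.\<close>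

definition Q :: "'i set \<Rightarrow> real" where "Q S = (\<integral>t. (X S t)\<^sup>2 / F t \<partial>M)"

definition A :: "'i \<Rightarrow> 'i \<Rightarrow> real" where "A i j = (\<integral>t. h i t * h j t / F t \<partial>M)"

lemma F_nonneg: "0 \<le> F t"
  by (simp add: F_def sum_nonneg)

lemma F_square: "(F t)\<^sup>2 = (\<Sum>i\<in>J. (h i t)\<^sup>2)"
  by (simp add: F_def sum_nonneg)

lemma h_le_F: "i \<in> J \<Longrightarrow> \<bar>h i t\<bar> \<le> F t"
  unfolding F_def using J by (intro real_le_rsqrt) (simp add: member_le_sum[of _ _ "\<lambda>i. (h i t)\<^sup>2"])

lemma [measurable]: "i \<in> J \<Longrightarrow> h i \<in> borel_measurable M"
  using h by blast

lemma F_measurable [measurable]: "F \<in> borel_measurable M"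
  unfolding F_def[abs_def] by measurable

lemma F_integrable: "integrable M F"
proof (rule Bochner_Integration.integrable_bound)
  show "integrable M (\<lambda>t. \<Sum>i\<in>J. \<bar>h i t\<bar>)" using h by auto
  show "AE t in M. norm (F t) \<le> norm (\<Sum>i\<in>J. \<bar>h i t\<bar>)"
    unfolding F_def by (auto simp: sum_nonneg L2_set_def[symmetric] L2_set_le_sum_abs intro!: AE_I2)
qed simp

lemma m_nonneg: "0 \<le> m"
  unfolding m_def by (simp add: F_nonneg)

lemma lincomb_le_F: "\<bar>\<Sum>i\<in>J. a i * h i t\<bar> \<le> sqrt (\<Sum>i\<in>J. (a i)\<^sup>2) * F t"
proof -
  have "\<bar>\<Sum>i\<in>J. a i * h i t\<bar> \<le> (\<Sum>i\<in>J. \<bar>a i\<bar> * \<bar>h i t\<bar>)"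
    by (rule order_trans[OF sum_abs]) (simp add: abs_mult)
  also have "\<dots> \<le> L2_set a J * L2_set (\<lambda>i. h i t) J" by (rule L2_set_mult_ineq)
  finally show ?thesis by (simp add: L2_set_def F_def)
qed

lemma product_integrable:
  assumes [measurable]: "f \<in> borel_measurable M" "g \<in> borel_measurable M"
    and f: "\<And>t. \<bar>f t\<bar> \<le> c * F t" and g: "\<And>t. \<bar>g t\<bar> \<le> d * F t"
  shows "integrable M (\<lambda>t. f t * g t / F t)"
proof (rule Bochner_Integration.integrable_bound)
  show "integrable M (\<lambda>t. c * d * F t)" using F_integrable by simp
  show "AE t in M. norm (f t * g t / F t) \<le> norm (c * d * F t)"
  proof (intro AE_I2)
    fix t
    show "norm (f t * g t / F t) \<le> norm (c * d * F t)"
    proof (cases "F t = 0")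
      case False
      then have F: "F t > 0" using F_nonneg[of t] by linarith
      have "\<bar>f t\<bar> * \<bar>g t\<bar> \<le> (c * F t) * (d * F t)"
        using f g by (intro mult_mono) (auto intro: order_trans[OF abs_ge_zero])
      then have "\<bar>f t\<bar> * \<bar>g t\<bar> / F t \<le> (c * F t) * (d * F t) / F t"
        using F by (intro divide_right_mono) auto
      also have "\<dots> \<le> \<bar>c * d * F t\<bar>" using F by simp
      finally show ?thesis using F by (simp add: abs_mult)
    qed simp
  qed
qed simp

lemma A_integrable: "i \<in> J \<Longrightarrow> j \<in> J \<Longrightarrow> integrable M (\<lambda>t. h i t * h j t / F t)"
  using h_le_F by (intro product_integrable[where c=1 and d=1]) auto

lemma A_sym: "A i j = A j i"
  by (simp add: A_def mult.commute)

lemma X_measurable [measurable]: "X S \<in> borel_measurable M"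
  unfolding X_def[abs_def] signed_sum_def by measurable

lemma X_integrable: "integrable M (X S)"
  unfolding X_def[abs_def] signed_sum_def using h by auto

lemma X_le_F: "\<bar>X S t\<bar> \<le> sqrt (real (card J)) * F t"
  using lincomb_le_F[of "sg S" t] by (simp add: X_def signed_sum_def)

lemma Q_integrable: "integrable M (\<lambda>t. (X S t)\<^sup>2 / F t)"
  unfolding power2_eq_square using X_le_F by (intro product_integrable) auto

lemma Q_nonneg: "0 \<le> Q S"
  unfolding Q_def by (simp add: F_nonneg)

lemma Q_eq: "Q S = (\<Sum>i\<in>J. \<Sum>j\<in>J. sg S i * sg S j * A i j)"
proof -
  have "(X S t)\<^sup>2 / F t = (\<Sum>i\<in>J. \<Sum>j\<in>J. sg S i * sg S j * (h i t * h j t / F t))" for t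
    by (simp add: X_def signed_sum_def power2_eq_square sum_product sum_divide_distrib algebra_simps)
  then have "Q S = (\<integral>t. (\<Sum>i\<in>J. \<Sum>j\<in>J. sg S i * sg S j * (h i t * h j t / F t)) \<partial>M)"
    unfolding Q_def by simp
  also have "\<dots> = (\<Sum>i\<in>J. \<Sum>j\<in>J. sg S i * sg S j * A i j)"
  proof -
    have int: "integrable M (\<lambda>t. sg S i * sg S j * (h i t * h j t / F t))" if "i \<in> J" "j \<in> J" for i j
      using A_integrable[OF that] by (rule integrable_mult_right)
    have "(\<integral>t. (\<Sum>i\<in>J. \<Sum>j\<in>J. sg S i * sg S j * (h i t * h j t / F t)) \<partial>M)
      = (\<Sum>i\<in>J. \<integral>t. (\<Sum>j\<in>J. sg S i * sg S j * (h i t * h j t / F t)) \<partial>M)"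
      using int by (intro Bochner_Integration.integral_sum Bochner_Integration.integrable_sum)
    also have "\<dots> = (\<Sum>i\<in>J. \<Sum>j\<in>J. \<integral>t. sg S i * sg S j * (h i t * h j t / F t) \<partial>M)"
      using int by (intro sum.cong refl Bochner_Integration.integral_sum)
    finally show ?thesis by (simp add: A_def del: times_divide_eq_right)
  qed
  finally show ?thesis .
qed

lemma trace_A: "(\<Sum>i\<in>J. A i i) = m"
proof -
  have "(\<Sum>i\<in>J. A i i) = (\<integral>t. (\<Sum>i\<in>J. h i t * h i t / F t) \<partial>M)"
    unfolding A_def using A_integrable by (subst Bochner_Integration.integral_sum) auto
  also have "(\<lambda>t. \<Sum>i\<in>J. h i t * h i t / F t) = F"
  proof
    fix t
    have "(\<Sum>i\<in>J. h i t * h i t / F t) = (F t)\<^sup>2 / F t"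
      unfolding F_square by (simp add: power2_eq_square sum_divide_distrib)
    then show "(\<Sum>i\<in>J. h i t * h i t / F t) = F t" by (auto simp add: power2_eq_square)
  qed
  finally show ?thesis by (simp add: m_def)
qed

text \<open>\<open>A\<close> is positive semidefinite with operator norm at most \<open>\<sigma>\<close>, hence \<open>A\<^sup>2 \<le> \<sigma> A\<close>.\<close>

lemma A_row:
  assumes i: "i \<in> J"
  shows "(\<Sum>j\<in>J. (A i j)\<^sup>2) \<le> \<sigma> * A i i"
proof -
  define r where "r = (\<Sum>j\<in>J. (A i j)\<^sup>2)"
  define g where "g t = (\<Sum>j\<in>J. A i j * h j t)" for t
  have r: "r \<ge> 0" by (simp add: r_def sum_nonneg)
  have gF: "\<bar>g t\<bar> \<le> sqrt r * F t" for t
    unfolding g_def r_def by (rule lincomb_le_F)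
  have [measurable]: "g \<in> borel_measurable M" unfolding g_def[abs_def] by measurable
  have gi: "integrable M g" unfolding g_def[abs_def] using h by auto
  have int1: "integrable M (\<lambda>t. h i t * g t / F t)"
    using i gF h_le_F[OF i] by (intro product_integrable[where c=1 and d="sqrt r"]) auto
  have int2: "integrable M (\<lambda>t. h i t * h i t / F t)" using A_integrable[OF i i] .
  have "r = (\<Sum>j\<in>J. A i j * (\<integral>t. h i t * h j t / F t \<partial>M))"
    by (simp add: r_def power2_eq_square A_def)
  also have "\<dots> = (\<integral>t. (\<Sum>j\<in>J. A i j * (h i t * h j t / F t)) \<partial>M)"
    by (subst Bochner_Integration.integral_sum)
      (use A_integrable[OF i] integral_mult_right integrable_mult_right in \<open>blast, simp del: times_divide_eq_right\<close>)
  also have "\<dots> = (\<integral>t. h i t * g t / F t \<partial>M)"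
    by (simp add: g_def sum_distrib_left sum_divide_distrib algebra_simps)
  \<comment> \<open>\<open>r\<close> is the entry of the square of \<open>A\<close> at
    \<open>(i, i)\<close>, written as the weighted inner product of \<open>h i\<close> and
    \<open>g\<close>. The arithmetic-geometric mean inequality with weight \<open>\<sigma>\<close>
    splits it; \<open>|g| \<le> sqrt r * F\<close> then replaces \<open>g^2 / F\<close> by
    \<open>sqrt r * |g|\<close>, whose integral \<open>\<sigma>\<close> controls. The result is
    \<open>r \<le> (\<sigma> * A i i + r) / 2\<close>, and \<open>r\<close> is absorbed.\<close>
  also have "\<dots> \<le> (\<integral>t. (\<sigma> * (h i t * h i t / F t) + sqrt r / \<sigma> * \<bar>g t\<bar>) / 2 \<partial>M)"
  proof (intro integral_mono int1)
    show "integrable M (\<lambda>t. (\<sigma> * (h i t * h i t / F t) + sqrt r / \<sigma> * \<bar>g t\<bar>) / 2)"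
      by (intro integrable_divide Bochner_Integration.integrable_add integrable_mult_right integrable_abs int2 gi)
    fix t
    show "h i t * g t / F t \<le> (\<sigma> * (h i t * h i t / F t) + sqrt r / \<sigma> * \<bar>g t\<bar>) / 2"
    proof (cases "F t = 0")
      case False
      then have F: "F t > 0" using F_nonneg[of t] by linarith
      have "0 \<le> (\<sigma> * h i t - g t)\<^sup>2" by simp
      then have "2 * \<sigma> * (h i t * g t) \<le> \<sigma>\<^sup>2 * (h i t * h i t) + (g t)\<^sup>2"
        by (simp add: power2_eq_square algebra_simps)
      also have "(g t)\<^sup>2 \<le> sqrt r * F t * \<bar>g t\<bar>"
        using mult_right_mono[OF gF[of t], of "\<bar>g t\<bar>"] by (simp add: power2_eq_square)
      finally have "h i t * g t / F t \<le> (\<sigma>\<^sup>2 * (h i t * h i t) + sqrt r * F t * \<bar>g t\<bar>) / (2 * \<sigma>) / F t"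
        using F \<sigma>_pos by (intro divide_right_mono) (auto simp: field_simps)
      also have "\<dots> = (\<sigma> * (h i t * h i t / F t) + sqrt r / \<sigma> * \<bar>g t\<bar>) / 2"
        using F \<sigma>_pos by (simp add: field_simps power2_eq_square)
      finally show ?thesis .
    next
      case True
      then show ?thesis using \<sigma>_pos r by simp
    qed
  qed
  also have "\<dots> = (\<sigma> * A i i + sqrt r / \<sigma> * (\<integral>t. \<bar>g t\<bar> \<partial>M)) / 2"
    unfolding A_def using int2 gi by (simp del: times_divide_eq_right times_divide_eq_left)
  also have "(\<integral>t. \<bar>g t\<bar> \<partial>M) \<le> \<sigma> * sqrt r"
    unfolding g_def r_def by (rule \<sigma>)
  finally have "r \<le> (\<sigma> * A i i + sqrt r / \<sigma> * (\<sigma> * sqrt r)) / 2"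
    using \<sigma>_pos r by (smt (verit, best) divide_nonneg_pos divide_right_mono mult_left_mono real_sqrt_ge_zero)
  then have "r \<le> (\<sigma> * A i i + r) / 2" using r \<sigma>_pos by simp
  then show ?thesis by (simp add: r_def)
qed

lemma Q_mean: "(\<Sum>S\<in>Pow J. Q S) = 2 ^ card J * m"
proof -
  have "(\<Sum>S\<in>Pow J. Q S) = (\<integral>t. (\<Sum>S\<in>Pow J. (X S t)\<^sup>2 / F t) \<partial>M)"
    unfolding Q_def using Q_integrable by (subst Bochner_Integration.integral_sum) auto
  also have "(\<lambda>t. \<Sum>S\<in>Pow J. (X S t)\<^sup>2 / F t) = (\<lambda>t. 2 ^ card J * F t)"
  proof
    fix t
    have "(\<Sum>S\<in>Pow J. (X S t)\<^sup>2 / F t) = 2 ^ card J * (F t)\<^sup>2 / F t"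
      using signed_sum_second_moment[OF J, of "\<lambda>i. h i t"]
      by (simp add: X_def F_square sum_divide_distrib[symmetric])
    then show "(\<Sum>S\<in>Pow J. (X S t)\<^sup>2 / F t) = 2 ^ card J * F t"
      by (simp add: power2_eq_square)
  qed
  finally show ?thesis by (simp add: m_def)
qed

lemma Q_variance: "(\<Sum>S\<in>Pow J. (Q S - m)\<^sup>2) \<le> 2 ^ card J * (2 * \<sigma> * m)"
proof -
  have "(\<Sum>S\<in>Pow J. (Q S - m)\<^sup>2) \<le> 2 ^ card J * (2 * (\<Sum>i\<in>J. \<Sum>j\<in>J. (A i j)\<^sup>2))"
    unfolding Q_eq trace_A[symmetric] by (rule signed_quadratic_form_variance[OF J A_sym])
  also have "(\<Sum>i\<in>J. \<Sum>j\<in>J. (A i j)\<^sup>2) \<le> (\<Sum>i\<in>J. \<sigma> * A i i)"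
    by (intro sum_mono A_row)
  also have "\<dots> = \<sigma> * m" by (simp add: sum_distrib_left[symmetric] trace_A)
  finally show ?thesis by simp
qed

text \<open>Cauchy--Schwarz for \<open>\<bar>X\<bar> = (\<bar>X\<bar> / \<surd>F) \<surd>F\<close>.\<close>

lemma X_norm_square: "(\<integral>t. \<bar>X S t\<bar> \<partial>M)\<^sup>2 \<le> m * Q S"
proof -
  define u where "u = (\<integral>t. \<bar>X S t\<bar> \<partial>M)"
  show ?thesis
  proof (cases "u = 0")
    case True
    then show ?thesis using m_nonneg Q_nonneg by (simp add: u_def)
  next
    case False
    then have u: "u > 0" unfolding u_def
      by (simp add: order_less_le)
    \<comment> \<open>The inequality is kept with a free parameter: the final bound takes
      \<open>\<theta> = m / u\<close>, and before that \<open>\<theta> = u / (Q S + 1)\<close> rules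
      out \<open>m = 0\<close>, where the optimal choice would be degenerate.\<close>
    have le: "u \<le> (\<theta> * Q S + m / \<theta>) / 2" if \<theta>: "\<theta> > 0" for \<theta>
    proof -
      have "u \<le> (\<integral>t. (\<theta> * ((X S t)\<^sup>2 / F t) + F t / \<theta>) / 2 \<partial>M)"
        unfolding u_def
      proof (intro integral_mono)
        show "integrable M (\<lambda>t. (\<theta> * ((X S t)\<^sup>2 / F t) + F t / \<theta>) / 2)"
          by (intro integrable_divide Bochner_Integration.integrable_add integrable_mult_right
              Q_integrable F_integrable)
        fix t
        show "\<bar>X S t\<bar> \<le> (\<theta> * ((X S t)\<^sup>2 / F t) + F t / \<theta>) / 2"
        proof (cases "F t = 0")
          case True
          then show ?thesis using X_le_F[of S t] by simp
        next
          case False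
          then have F: "F t > 0" using F_nonneg[of t] by linarith
          have "0 \<le> (\<theta> * \<bar>X S t\<bar> - F t)\<^sup>2" by simp
          then have "2 * \<theta> * F t * \<bar>X S t\<bar> \<le> \<theta>\<^sup>2 * (X S t)\<^sup>2 + (F t)\<^sup>2"
            by (simp add: power2_diff power_mult_distrib algebra_simps)
          then have "\<bar>X S t\<bar> \<le> (\<theta>\<^sup>2 * (X S t)\<^sup>2 + (F t)\<^sup>2) / (2 * \<theta> * F t)"
            using F \<theta> by (simp add: field_simps)
          also have "\<dots> = (\<theta> * ((X S t)\<^sup>2 / F t) + F t / \<theta>) / 2"
            using F \<theta> by (simp add: field_simps power2_eq_square)
          finally show ?thesis .
        qed
      qed (use X_integrable in auto)
      also have "\<dots> = (\<theta> * Q S + m / \<theta>) / 2"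
        unfolding Q_def m_def using Q_integrable F_integrable
        by (simp del: times_divide_eq_right times_divide_eq_left)
      finally show ?thesis .
    qed
    have m: "m > 0"
    proof (rule ccontr)
      assume "\<not> m > 0"
      then have m0: "m = 0" using m_nonneg by simp
      have "u \<le> (u / (Q S + 1) * Q S) / 2"
        using le[of "u / (Q S + 1)"] u Q_nonneg[of S] by (simp add: m0)
      also have "\<dots> \<le> u / 2" using u Q_nonneg[of S] by (simp add: field_simps)
      finally show False using u by simp
    qed
    have "u \<le> (m / u * Q S + u) / 2"
      using le[of "m / u"] u m by simp
    then have "u * u \<le> m * Q S" using u by (simp add: field_simps)
    then show ?thesis by (simp add: u_def power2_eq_square)
  qed
qed

lemma X_norm_mean: "2 ^ card J * (m / 2) \<le> (\<Sum>S\<in>Pow J. (\<integral>t. \<bar>X S t\<bar> \<partial>M))"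
proof -
  have "2 ^ card J * (m / 2) = (\<integral>t. 2 ^ card J * (F t / 2) \<partial>M)" by (simp add: m_def)
  also have "\<dots> \<le> (\<integral>t. (\<Sum>S\<in>Pow J. \<bar>X S t\<bar>) \<partial>M)"
  proof (intro integral_mono)
    show "2 ^ card J * (F t / 2) \<le> (\<Sum>S\<in>Pow J. \<bar>X S t\<bar>)" for t
      unfolding X_def F_def by (rule signed_sum_abs_moment[OF J])
  qed (use F_integrable X_integrable in auto)
  also have "\<dots> = (\<Sum>S\<in>Pow J. (\<integral>t. \<bar>X S t\<bar> \<partial>M))"
    using X_integrable by (subst Bochner_Integration.integral_sum) auto
  finally show ?thesis .
qed

text \<open>Chebyshev for \<open>Q\<close>: an L1 norm above \<open>2 * m\<close> forces
  \<open>Q S \<ge> 4 * m\<close> by \<open>X_norm_square\<close>, that is, a deviation of at least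
  \<open>3 * m\<close> from the mean.\<close>

lemma X_norm_large_card:
  assumes "m > 0"
  shows "real (card {S \<in> Pow J. 2 * m < (\<integral>t. \<bar>X S t\<bar> \<partial>M)}) \<le> 2 ^ card J * (\<sigma> / m)"
proof -
  let ?B = "{S \<in> Pow J. 2 * m < (\<integral>t. \<bar>X S t\<bar> \<partial>M)}"
  have "9 * m\<^sup>2 \<le> (Q S - m)\<^sup>2" if "S \<in> ?B" for S
  proof -
    have "(2 * m)\<^sup>2 \<le> (\<integral>t. \<bar>X S t\<bar> \<partial>M)\<^sup>2" using that assms by (intro power_mono) auto
    also have "\<dots> \<le> m * Q S" by (rule X_norm_square)
    finally have "4 * m \<le> Q S" using assms by (simp add: power2_eq_square)
    then have "(3 * m)\<^sup>2 \<le> (Q S - m)\<^sup>2" using assms by (intro power_mono) auto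
    then show ?thesis by (simp add: power_mult_distrib)
  qed
  then have "real (card ?B) * (9 * m\<^sup>2) \<le> (\<Sum>S\<in>?B. (Q S - m)\<^sup>2)"
    by (rule sum_bounded_below)
  also have "\<dots> \<le> (\<Sum>S\<in>Pow J. (Q S - m)\<^sup>2)" using J by (intro sum_mono2) auto
  \<comment> \<open>The variance bound is weakened from 2 to 9 only to cancel the 9 of the squared
    deviation.\<close>
  also have "\<dots> \<le> 2 ^ card J * (9 * \<sigma> * m)"
    using Q_variance \<sigma>_pos assms by (smt (verit) mult_left_mono mult_right_mono mult_pos_pos zero_less_power)
  also have "\<dots> = (2 ^ card J * (\<sigma> / m)) * (9 * m\<^sup>2)"
    using assms by (simp add: power2_eq_square)
  finally show ?thesis using assms by (simp only: mult_le_cancel_right) simp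
qed

end

section \<open>Size of the square function and existence of large combinations\<close>

context square_function
begin

text \<open>Averaged over signs, \<open>min |X S t| m\<close> is at most \<open>min (F t) m\<close>
  by the second moment, while non-degeneracy of each \<open>X S\<close> bounds the integral of the
  left side from below. Truncating at \<open>m\<close> excludes that the integral of
  \<open>F\<close> sits on a tiny set, so a lower bound for the truncated integral becomes one for a
  measure.\<close>

lemma F_nondegenerate:
  assumes M: "prob_space M" and m: "m > 0" and \<delta>: "\<delta> > 0"
    and nd: "\<And>S. \<delta> \<le> measure M {t \<in> space M. (\<integral>t. \<bar>X S t\<bar> \<partial>M) / 4 \<le> \<bar>X S t\<bar>}"
  shows "\<delta> / 32 \<le> measure M {t \<in> space M. \<delta> / 32 * m \<le> F t}"
proof -
  interpret prob_space M by (rule M)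
  let ?u = "\<lambda>S. \<integral>t. \<bar>X S t\<bar> \<partial>M"
  define G where "G = {t \<in> space M. \<delta> / 32 * m \<le> F t}"
  have "G \<in> sets M" by (simp add: G_def)
  then have G: "G \<in> sets M" "integrable M (indicator G :: _ \<Rightarrow> real)"
    by (auto intro!: integrable_real_indicator simp: less_top[symmetric] emeasure_finite)
  have u0: "0 \<le> ?u S" for S by simp
  have minX: "integrable M (\<lambda>t. min \<bar>X S t\<bar> m)" for S
    using X_integrable[of S] by auto
  \<comment> \<open>The expression \<open>u - u^2 / (4 m)\<close> minorises \<open>min u m\<close>
    and involves only quantities whose averages over signs are known: \<open>u\<close> has mean at
    least \<open>m / 2\<close> by Khintchine, \<open>u^2\<close> at most \<open>m^2\<close>. The
    average is thus at least \<open>m / 4\<close>, which gives \<open>\<delta> * m / 16\<close>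
    below.\<close>
  have low: "\<delta> / 4 * (?u S - (?u S)\<^sup>2 / (4 * m)) \<le> (\<integral>t. min \<bar>X S t\<bar> m \<partial>M)" for S
  proof -
    let ?B = "{t \<in> space M. ?u S / 4 \<le> \<bar>X S t\<bar>}"
    have "0 \<le> (?u S - 2 * m)\<^sup>2" by simp
    then have "4 * m * ?u S \<le> 4 * m * m + (?u S)\<^sup>2" by (simp add: power2_eq_square algebra_simps)
    then have "?u S - (?u S)\<^sup>2 / (4 * m) \<le> m" using m by (simp add: field_simps)
    moreover have "?u S - (?u S)\<^sup>2 / (4 * m) \<le> ?u S" using m by simp
    ultimately have "\<delta> / 4 * (?u S - (?u S)\<^sup>2 / (4 * m)) \<le> \<delta> / 4 * min (?u S) m"
      using \<delta> by (intro mult_left_mono) auto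
    also have "\<dots> \<le> \<delta> * min (?u S / 4) m"
      using \<delta> m by (simp add: min_def)
    also have "\<dots> \<le> measure M ?B * min (?u S / 4) m"
      using nd[of S] m u0[of S] by (intro mult_right_mono) auto
    also have "\<dots> = (\<integral>t. min (?u S / 4) m * indicator ?B t \<partial>M)" by simp
    also have "\<dots> \<le> (\<integral>t. min \<bar>X S t\<bar> m \<partial>M)"
    proof (intro integral_mono minX)
      have "integrable M (indicator ?B :: 'a \<Rightarrow> real)"
        by (intro integrable_real_indicator) (auto simp: less_top[symmetric] emeasure_finite)
      then show "integrable M (\<lambda>t. min (?u S / 4) m * indicator ?B t)" by (rule integrable_mult_right)
      fix t
      show "min (?u S / 4) m * indicator ?B t \<le> min \<bar>X S t\<bar> m"
        using m by (auto simp: indicator_def)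
    qed
    finally show ?thesis .
  qed
  have "(\<Sum>S\<in>Pow J. (?u S)\<^sup>2) \<le> (\<Sum>S\<in>Pow J. m * Q S)"
    by (intro sum_mono X_norm_square)
  also have "\<dots> = 2 ^ card J * m\<^sup>2" by (simp add: sum_distrib_left[symmetric] Q_mean power2_eq_square)
  finally have u2: "(\<Sum>S\<in>Pow J. (?u S)\<^sup>2) \<le> 2 ^ card J * m\<^sup>2" .
  have avg: "(\<Sum>S\<in>Pow J. min \<bar>X S t\<bar> m) \<le> 2 ^ card J * min (F t) m" for t
  proof -
    have "(\<Sum>S\<in>Pow J. 1 * \<bar>X S t\<bar>)\<^sup>2 \<le> (\<Sum>S\<in>Pow J. 1\<^sup>2) * (\<Sum>S\<in>Pow J. \<bar>X S t\<bar>\<^sup>2)"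
      by (rule Cauchy_Schwarz_ineq_sum)
    also have "\<dots> = (2 ^ card J * F t)\<^sup>2"
      using J signed_sum_second_moment[OF J, of "\<lambda>i. h i t"]
      by (simp add: card_Pow X_def power_mult_distrib F_square power2_eq_square[of "2 ^ _"])
    finally have "(\<Sum>S\<in>Pow J. \<bar>X S t\<bar>) \<le> 2 ^ card J * F t"
      using F_nonneg[of t] power2_le_imp_le by force
    moreover have "(\<Sum>S\<in>Pow J. min \<bar>X S t\<bar> m) \<le> (\<Sum>S\<in>Pow J. \<bar>X S t\<bar>)" by (intro sum_mono) simp
    moreover have "(\<Sum>S\<in>Pow J. min \<bar>X S t\<bar> m) \<le> (\<Sum>S\<in>Pow J. m)" by (intro sum_mono) simp
    then have "(\<Sum>S\<in>Pow J. min \<bar>X S t\<bar> m) \<le> 2 ^ card J * m" using J by (simp add: card_Pow)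
    ultimately show ?thesis by (simp add: min_def)
  qed
  have "2 ^ card J * (\<delta> * m / 16)
      = \<delta> / 4 * (2 ^ card J * (m / 2) - 2 ^ card J * m\<^sup>2 / (4 * m))"
    using m by (simp add: field_simps power2_eq_square)
  also have "\<dots> \<le> \<delta> / 4 * ((\<Sum>S\<in>Pow J. ?u S) - (\<Sum>S\<in>Pow J. (?u S)\<^sup>2) / (4 * m))"
    using X_norm_mean u2 m \<delta> by (intro mult_left_mono diff_mono divide_right_mono) auto
  also have "\<dots> = (\<Sum>S\<in>Pow J. \<delta> / 4 * (?u S - (?u S)\<^sup>2 / (4 * m)))"
    by (simp only: sum_distrib_left[symmetric] sum_subtractf sum_divide_distrib)
  also have "\<dots> \<le> (\<Sum>S\<in>Pow J. (\<integral>t. min \<bar>X S t\<bar> m \<partial>M))"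
    by (intro sum_mono low)
  also have "\<dots> = (\<integral>t. (\<Sum>S\<in>Pow J. min \<bar>X S t\<bar> m) \<partial>M)"
    using minX by (subst Bochner_Integration.integral_sum) auto
  also have "\<dots> \<le> (\<integral>t. 2 ^ card J * min (F t) m \<partial>M)"
    using minX F_integrable by (intro integral_mono avg) auto
  also have "\<dots> = 2 ^ card J * (\<integral>t. min (F t) m \<partial>M)" by simp
  finally have "\<delta> * m / 16 \<le> (\<integral>t. min (F t) m \<partial>M)" by simp
  \<comment> \<open>Outside \<open>G\<close> the integrand is below
    \<open>\<delta> / 32 * m\<close>, half of the available \<open>\<delta> * m / 16\<close>; the
    other half must come from \<open>G\<close>.\<close>
  also have "\<dots> \<le> (\<integral>t. \<delta> / 32 * m + m * indicator G t \<partial>M)"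
  proof (intro integral_mono)
    fix t assume "t \<in> space M"
    then show "min (F t) m \<le> \<delta> / 32 * m + m * indicator G t"
      using mult_pos_pos[OF \<delta> m] by (auto simp: indicator_def G_def)
  qed (use F_integrable G in auto)
  also have "\<dots> = \<delta> / 32 * m + m * measure M G"
    using G by (simp add: prob_space)
  finally have "m * (\<delta> / 32) \<le> m * measure M G"
    by (simp add: field_simps)
  then show ?thesis using m by (simp add: G_def)
qed

text \<open>Replacing each \<open>h i\<close> by \<open>k\<close> copies of
  \<open>h i / sqrt k\<close> leaves the square function unchanged, and by Cauchy-Schwarz the same
  \<open>\<sigma>\<close> still works. Norm estimates therefore survive, while a signed sum splits
  into \<open>k\<close> independent blocks.\<close>

lemma copies: 
  assumes k: "0 < k"
  shows "square_function M ({..<k} \<times> J) (\<lambda>(j, i) t. h i t / sqrt (real k)) \<sigma>"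
proof
  show "finite ({..<k} \<times> J)" using J by simp
  show "integrable M ((\<lambda>(j, i) t. h i t / sqrt (real k)) p)" if "p \<in> {..<k} \<times> J" for p
    using that h by auto
  show "\<sigma> > 0" by (rule \<sigma>_pos)
  fix a :: "nat \<times> 'i \<Rightarrow> real"
  define b where "b i = (\<Sum>j<k. a (j, i) / sqrt (real k))" for i
  have "(b i)\<^sup>2 \<le> (\<Sum>j<k. (a (j, i))\<^sup>2)" for i
  proof -
    have "(b i)\<^sup>2 = (\<Sum>j<k. a (j, i) * (1 / sqrt (real k)))\<^sup>2" by (simp add: b_def)
    also have "\<dots> \<le> (\<Sum>j<k. (a (j, i))\<^sup>2) * (\<Sum>j<k. (1 / sqrt (real k))\<^sup>2)"
      by (rule Cauchy_Schwarz_ineq_sum)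
    also have "\<dots> = (\<Sum>j<k. (a (j, i))\<^sup>2)" using k by (simp add: power_divide)
    finally show ?thesis .
  qed
  then have "(\<Sum>i\<in>J. (b i)\<^sup>2) \<le> (\<Sum>i\<in>J. \<Sum>j<k. (a (j, i))\<^sup>2)" by (intro sum_mono)
  also have "\<dots> = (\<Sum>p\<in>{..<k} \<times> J. (a p)\<^sup>2)"
    by (subst sum.swap) (simp add: sum.cartesian_product)
  finally have "sqrt (\<Sum>i\<in>J. (b i)\<^sup>2) \<le> sqrt (\<Sum>p\<in>{..<k} \<times> J. (a p)\<^sup>2)" by simp
  moreover have "(\<Sum>p\<in>{..<k} \<times> J. a p * (\<lambda>(j, i) t. h i t / sqrt (real k)) p t) = (\<Sum>i\<in>J. b i * h i t)" for t
  proof -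
    have "(\<Sum>i\<in>J. b i * h i t) = (\<Sum>i\<in>J. \<Sum>j<k. a (j, i) * (h i t / sqrt (real k)))"
      by (simp add: b_def sum_distrib_right)
    also have "\<dots> = (\<Sum>p\<in>{..<k} \<times> J. a p * (\<lambda>(j, i) t. h i t / sqrt (real k)) p t)"
      by (subst sum.swap) (auto simp: sum.cartesian_product intro!: sum.cong)
    finally show ?thesis by simp
  qed
  moreover have "\<sigma> * sqrt (\<Sum>i\<in>J. (b i)\<^sup>2) \<le> \<sigma> * sqrt (\<Sum>p\<in>{..<k} \<times> J. (a p)\<^sup>2)"
    using calculation(1) \<sigma>_pos by (intro mult_left_mono) auto
  ultimately show "(\<integral>t. \<bar>\<Sum>p\<in>{..<k} \<times> J. a p * (\<lambda>(j, i) t. h i t / sqrt (real k)) p t\<bar> \<partial>M)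
      \<le> \<sigma> * sqrt (\<Sum>p\<in>{..<k} \<times> J. (a p)\<^sup>2)"
    using \<sigma>[of b] by simp
qed

text \<open>Double counting of pairs of a sign choice and a point. The pointwise tail bound makes
  the level sets of \<open>C.X S\<close> have average measure at least
  \<open>\<kappa> / 10^k = 2 * \<theta>\<close>. If every choice of norm at most
  \<open>2 * m\<close> had a level set of measure at most \<open>\<theta>\<close>, the average would
  be at most \<open>\<theta>\<close> plus the proportion of bad choices, hence at most
  \<open>3/2 * \<theta>\<close>; this is what the smallness of \<open>\<sigma> / m\<close> is
  for.\<close>

lemma large_combination:
  assumes M: "prob_space M" and m: "m > 0" and k: "0 < k"
    and \<kappa>: "0 < \<kappa>" "\<kappa> \<le> measure M {t \<in> space M. \<kappa> * m \<le> F t}"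
    and small: "\<sigma> / m \<le> \<kappa> * (1 / 10) ^ k / 4"
  shows "\<exists>c. (\<integral>t. \<bar>\<Sum>i\<in>J. c i * h i t\<bar> \<partial>M) \<le> 2 * m \<and>
     \<kappa> * (1 / 10) ^ k / 2 \<le> measure M {t \<in> space M. sqrt (real k) * \<kappa> * m / 2 \<le> (\<Sum>i\<in>J. c i * h i t)}"
proof (rule ccontr)
  assume contra: "\<not> ?thesis"
  interpret prob_space M by (rule M)
  let ?K = "{..<k} \<times> J"
  interpret C: square_function M ?K "\<lambda>(j, i) t. h i t / sqrt (real k)" \<sigma>
    by (rule copies[OF k])
  have int: "integrable M (indicator Z :: _ \<Rightarrow> real)" if "Z \<in> sets M" for Z
    using that by (intro integrable_real_indicator) (auto simp: less_top[symmetric] emeasure_finite)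
  define \<theta> where "\<theta> = \<kappa> * (1 / 10) ^ k / 2"
  have \<theta>: "\<theta> > 0" using \<kappa> by (simp add: \<theta>_def)
  have F: "C.F = F"
  proof
    fix t
    have "(\<Sum>p\<in>?K. ((\<lambda>(j, i) t. h i t / sqrt (real k)) p t)\<^sup>2) = (\<Sum>j<k. \<Sum>i\<in>J. (h i t / sqrt (real k))\<^sup>2)"
      using sum.cartesian_product[of "\<lambda>_ i. (h i t / sqrt (real k))\<^sup>2" J "{..<k}"]
      by (simp add: case_prod_beta)
    also have "\<dots> = (\<Sum>i\<in>J. (h i t)\<^sup>2)"
      using k by (simp add: power_divide sum_divide_distrib[symmetric])
    finally show "C.F t = F t" unfolding C.F_def F_def by simp
  qed
  have mm: "C.m = m" unfolding C.m_def m_def F ..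
  have X: "C.X S t = signed_sum (\<lambda>(j, i). h i t) ?K S / sqrt (real k)" for S t
    by (simp add: C.X_def signed_sum_def case_prod_beta sum_divide_distrib)
  have "C.X S t = (\<Sum>i\<in>J. (\<Sum>j<k. sg S (j, i) / sqrt (real k)) * h i t)" for S t
  proof -
    have "(\<Sum>i\<in>J. (\<Sum>j<k. sg S (j, i) / sqrt (real k)) * h i t)
      = (\<Sum>i\<in>J. \<Sum>j<k. sg S (j, i) * (h i t / sqrt (real k)))"
      by (simp add: sum_distrib_right)
    also have "\<dots> = (\<Sum>p\<in>?K. sg S p * (\<lambda>(j, i) t. h i t / sqrt (real k)) p t)"
      by (subst sum.swap) (auto simp: sum.cartesian_product intro!: sum.cong)
    finally show ?thesis by (simp add: C.X_def signed_sum_def case_prod_beta)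
  qed
  then have X_lincomb: "C.X S = (\<lambda>t. \<Sum>i\<in>J. (\<Sum>j<k. sg S (j, i) / sqrt (real k)) * h i t)" for S
    by blast
  have good: "measure M {t \<in> space M. sqrt (real k) * \<kappa> * m / 2 \<le> C.X S t} \<le> \<theta>"
    if S: "(\<integral>t. \<bar>C.X S t\<bar> \<partial>M) \<le> 2 * m" for S
  proof (rule ccontr)
    assume "\<not> ?thesis"
    then have "\<theta> \<le> measure M {t \<in> space M. sqrt (real k) * \<kappa> * m / 2 \<le> C.X S t}" by simp
    with S have conj: "(\<integral>t. \<bar>C.X S t\<bar> \<partial>M) \<le> 2 * m \<and>
      \<theta> \<le> measure M {t \<in> space M. sqrt (real k) * \<kappa> * m / 2 \<le> C.X S t}" by (rule conjI)
    from contra show False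
      by (rule notE) (rule exI, rule conj[unfolded X_lincomb \<theta>_def])
  qed
  let ?B = "{S \<in> Pow ?K. 2 * m < (\<integral>t. \<bar>C.X S t\<bar> \<partial>M)}"
  let ?E = "\<lambda>S. {t \<in> space M. sqrt (real k) * \<kappa> * m / 2 \<le> C.X S t}"
  have "(\<Sum>S\<in>Pow ?K. measure M (?E S)) \<le> (\<Sum>S\<in>Pow ?K. \<theta> + of_bool (S \<in> ?B))"
  proof (intro sum_mono)
    fix S assume "S \<in> Pow ?K"
    then show "measure M (?E S) \<le> \<theta> + of_bool (S \<in> ?B)"
      using good[of S] \<theta> measure_le_1[of "?E S"] by (cases "S \<in> ?B") (auto intro: add_increasing)
  qed
  also have "\<dots> = 2 ^ card ?K * \<theta> + real (card ?B)"
  proof -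
    have "(\<Sum>S\<in>Pow ?K. of_bool (S \<in> ?B) :: real) = real (card (Pow ?K \<inter> {S. S \<in> ?B}))"
      using J by (intro sum_of_bool_eq) auto
    also have "Pow ?K \<inter> {S. S \<in> ?B} = ?B" by blast
    finally show ?thesis using J by (simp only: sum.distrib sum_constant card_Pow[OF C.J]) simp
  qed
  also have "\<dots> \<le> 2 ^ card ?K * \<theta> + 2 ^ card ?K * (\<sigma> / m)"
    using C.X_norm_large_card m unfolding mm by simp
  also have "\<dots> \<le> 2 ^ card ?K * \<theta> + 2 ^ card ?K * (\<theta> / 2)"
  proof -
    have "\<sigma> / m \<le> \<theta> / 2" using small by (simp add: \<theta>_def)
    then show ?thesis by (intro add_left_mono mult_left_mono) auto
  qed
  also have "\<dots> < 2 ^ card ?K * (2 * \<theta>)" using \<theta> by simp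
  finally have less: "(\<Sum>S\<in>Pow ?K. measure M (?E S)) < 2 ^ card ?K * (2 * \<theta>)" .
  have "2 ^ card ?K * (2 * \<theta>) \<le> 2 ^ card ?K * (1 / 10) ^ k * measure M {t \<in> space M. \<kappa> * m \<le> F t}"
    using mult_left_mono[OF \<kappa>(2), of "2 ^ card ?K * (1 / 10) ^ k"] by (simp add: \<theta>_def mult_ac)
  also have "\<dots> = (\<integral>t. 2 ^ card ?K * (1 / 10) ^ k * indicator {t \<in> space M. \<kappa> * m \<le> F t} t \<partial>M)"
    by simp
  also have "\<dots> \<le> (\<integral>t. (\<Sum>S\<in>Pow ?K. indicator (?E S) t) \<partial>M)"
  proof (intro integral_mono)
    show "integrable M (\<lambda>t. 2 ^ card ?K * (1 / 10) ^ k * indicator {t \<in> space M. \<kappa> * m \<le> F t} t :: real)"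
      by (intro integrable_mult_right int) measurable
    show "integrable M (\<lambda>t. (\<Sum>S\<in>Pow ?K. indicator (?E S) t) :: real)"
      by (intro Bochner_Integration.integrable_sum int) measurable
    fix t assume t: "t \<in> space M"
    show "2 ^ card ?K * (1 / 10) ^ k * indicator {t \<in> space M. \<kappa> * m \<le> F t} t
       \<le> (\<Sum>S\<in>Pow ?K. indicator (?E S) t :: real)"
    proof (cases "\<kappa> * m \<le> F t")
      case True
      let ?G = "{S \<in> Pow ?K. real k * (sqrt (\<Sum>i\<in>J. (h i t)\<^sup>2) / 2) \<le> signed_sum (\<lambda>(j, i). h i t) ?K S}"
      have G: "S \<in> ?G \<Longrightarrow> t \<in> ?E S" for S
      proof -
        assume S: "S \<in> ?G"
        have "sqrt (real k) * (\<kappa> * m / 2) \<le> sqrt (real k) * (F t / 2)"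
          using True by (intro mult_left_mono) auto
        also have "\<dots> = real k * (F t / 2) / sqrt (real k)"
          using k by (simp add: field_simps)
        also have "\<dots> \<le> C.X S t"
          unfolding X using S by (intro divide_right_mono) (auto simp: F_def)
        finally show "t \<in> ?E S" using t by simp
      qed
      have "2 ^ card ?K * (1 / 10) ^ k \<le> real (card ?G)"
        using signed_sum_copies_tail[OF J, of k "\<lambda>i. h i t"] by (simp add: card_cartesian_product)
      also have "\<dots> = (\<Sum>S\<in>?G. 1)" by simp
      also have "\<dots> \<le> (\<Sum>S\<in>?G. indicator (?E S) t)"
        using G by (intro sum_mono) (auto simp: indicator_def)
      also have "\<dots> \<le> (\<Sum>S\<in>Pow ?K. indicator (?E S) t)"
        using J by (intro sum_mono2) auto
      finally show ?thesis using True t by simp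
    next
      case False
      then show ?thesis by (simp add: sum_nonneg)
    qed
  qed
  also have "\<dots> = (\<Sum>S\<in>Pow ?K. measure M (?E S))"
    by (subst Bochner_Integration.integral_sum) (auto intro!: int)
  finally show False using less by simp
qed

end

section \<open>Decreasing rearrangements and the fundamental function\<close>

interpretation unit_leb: prob_space unit_leb
  by standard (simp add: emeasure_restrict_space)

lemma sets_unit_lebI: "A \<subseteq> {0..1} \<Longrightarrow> A \<in> sets lebesgue \<Longrightarrow> A \<in> sets unit_leb"
  by (simp add: sets_restrict_space_iff)

lemma measure_unit_leb_interval:
  assumes "0 \<le> a" "a \<le> b" "b \<le> 1"
  shows "measure unit_leb {a..b} = b - a" "measure unit_leb {a..<b} = b - a"
proof -
  have sub: "{a..b} \<subseteq> {0..1}" "{a..<b} \<subseteq> {0..1}" using assms by auto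
  show "measure unit_leb {a..b} = b - a" "measure unit_leb {a..<b} = b - a"
    using assms by (subst measure_restrict_space; simp add: sub)+
qed

text \<open>Used to discard the point \<open>0\<close>, where \<open>decr\<close> is
  unreliable.\<close>

lemma AE_unit_leb_pos: "AE u in unit_leb. 0 < u \<and> u \<le> 1"
proof (rule AE_I[of _ _ "{0}"])
  show "emeasure unit_leb {0} = 0" by (simp add: emeasure_restrict_space)
qed (auto intro: sets_unit_lebI)

definition tail :: "rfun \<Rightarrow> real \<Rightarrow> real" where
  "tail x s = measure unit_leb {u \<in> {0..1}. s < \<bar>x u\<bar>}"

lemma level_set:
  fixes x :: rfun
  assumes [measurable]: "x \<in> borel_measurable unit_leb"
  shows "{u \<in> {0..1}. s < \<bar>x u\<bar>} \<in> sets unit_leb"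
proof -
  have "{u \<in> space unit_leb. s < \<bar>x u\<bar>} \<in> sets unit_leb" by measurable
  then show ?thesis by simp
qed

lemma unit_leb_indicator:
  assumes A: "A \<in> sets unit_leb"
  shows "integrable unit_leb (indicator A :: rfun)" "(LINT t|unit_leb. indicator A t :: real) = measure unit_leb A"
proof -
  show "integrable unit_leb (indicator A :: rfun)"
    using A by (intro integrable_real_indicator) (auto simp: less_top[symmetric] unit_leb.emeasure_finite)
  have "A \<inter> {0..1} = A" using sets.sets_into_space[OF A] by auto
  then show "(LINT t|unit_leb. indicator A t :: real) = measure unit_leb A" by simp
qed

lemma tail_mono: "x \<in> borel_measurable unit_leb \<Longrightarrow> s \<le> r \<Longrightarrow> tail x r \<le> tail x s"
  unfolding tail_def by (intro unit_leb.finite_measure_mono level_set) auto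

text \<open>Reduces equality of rearrangements to equality of real distribution functions, the form
  in which rearrangement invariance is applied. At the level infinity both level sets are
  empty.\<close>

lemma rearrangement_cong:
  assumes "\<And>s. 0 \<le> s \<Longrightarrow> tail x s = tail y s"
  shows "rearrangement x t = rearrangement y t"
proof -
  have "emeasure unit_leb {u \<in> space unit_leb. s < ennreal \<bar>x u\<bar>}
      = emeasure unit_leb {u \<in> space unit_leb. s < ennreal \<bar>y u\<bar>}" for s
  proof (cases s)
    case (real r)
    then show ?thesis
      using assms[of r] by (simp add: tail_def ennreal_less_iff unit_leb.emeasure_eq_measure)
  qed simp
  then show ?thesis by (simp add: rearrangement_def)
qed

text \<open>At \<open>0\<close> this is a junk value (\<open>Inf {}\<close>) if \<open>x\<close> is unbounded.\<close>

definition decr :: "rfun \<Rightarrow> rfun" where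
  "decr x u = Inf {s. 0 \<le> s \<and> tail x s \<le> u}"

context
  fixes x :: rfun
  assumes x [measurable]: "x \<in> borel_measurable unit_leb"
begin

lemma tail_small:
  assumes "0 < u"
  shows "\<exists>s\<ge>0. tail x s \<le> u"
proof -
  have "(\<lambda>n. measure unit_leb {v \<in> space unit_leb. real n < \<bar>x v\<bar>}) \<longlonglongrightarrow>
      measure unit_leb (\<Inter>n. {v \<in> space unit_leb. real n < \<bar>x v\<bar>})"
    by (intro unit_leb.finite_Lim_measure_decseq) (auto simp: decseq_def intro: level_set[OF x, simplified])
  also have "(\<Inter>n. {v \<in> space unit_leb. real n < \<bar>x v\<bar>}) = {}"
  proof -
    have False if "\<And>n. real n < \<bar>x v\<bar>" for v
      using that reals_Archimedean2[of "\<bar>x v\<bar>"] by (meson less_asym)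
    then show ?thesis by blast
  qed
  finally have "(\<lambda>n. tail x (real n)) \<longlonglongrightarrow> 0" by (simp add: tail_def)
  then have "eventually (\<lambda>n. tail x (real n) < u) sequentially"
    using assms by (rule order_tendstoD)
  then obtain n where "tail x (real n) < u" by (auto simp: eventually_sequentially)
  then show ?thesis by (intro exI[of _ "real n"]) auto
qed

lemma tail_right_continuous:
  assumes "u < tail x s"
  shows "\<exists>r>s. u < tail x r"
proof -
  have "(\<lambda>n. measure unit_leb {v \<in> space unit_leb. s + 1 / real (Suc n) < \<bar>x v\<bar>}) \<longlonglongrightarrow>
      measure unit_leb (\<Union>n. {v \<in> space unit_leb. s + 1 / real (Suc n) < \<bar>x v\<bar>})"
  proof (intro unit_leb.finite_Lim_measure_incseq incseq_SucI)
    fix n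
    have "1 / real (Suc (Suc n)) \<le> 1 / real (Suc n)" by (intro divide_left_mono) auto
    then show "{v \<in> space unit_leb. s + 1 / real (Suc n) < \<bar>x v\<bar>}
        \<subseteq> {v \<in> space unit_leb. s + 1 / real (Suc (Suc n)) < \<bar>x v\<bar>}" by auto
  qed (auto intro: level_set[OF x, simplified])
  also have "(\<Union>n. {v \<in> space unit_leb. s + 1 / real (Suc n) < \<bar>x v\<bar>}) = {v \<in> space unit_leb. s < \<bar>x v\<bar>}"
  proof safe
    fix n v assume "s + 1 / real (Suc n) < \<bar>x v\<bar>"
    moreover have "0 < 1 / real (Suc n)" by simp
    ultimately show "s < \<bar>x v\<bar>" by linarith
  next
    fix v assume "v \<in> space unit_leb" "s < \<bar>x v\<bar>"
    then obtain n where "1 / real (Suc n) < \<bar>x v\<bar> - s"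
      using reals_Archimedean[of "\<bar>x v\<bar> - s"] by (auto simp: inverse_eq_divide)
    then show "v \<in> (\<Union>n. {v \<in> space unit_leb. s + 1 / real (Suc n) < \<bar>x v\<bar>})"
      using \<open>v \<in> space unit_leb\<close> by (intro UN_I[of n]) auto
  qed
  finally have "(\<lambda>n. tail x (s + 1 / real (Suc n))) \<longlonglongrightarrow> tail x s" by (simp add: tail_def)
  then have "eventually (\<lambda>n. u < tail x (s + 1 / real (Suc n))) sequentially"
    using assms by (rule order_tendstoD)
  then obtain n where "u < tail x (s + 1 / real (Suc n))" by (auto simp: eventually_sequentially)
  then show ?thesis by (intro exI[of _ "s + 1 / real (Suc n)"]) auto
qed

text \<open>Right-continuity of \<open>tail x\<close> makes the equivalence strict on both sides.
  Monotonicity, measurability and equimeasurability of \<open>decr x\<close> are all read off from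
  it.\<close>

lemma less_decr_iff:
  assumes u: "0 < u" and s: "0 \<le> s"
  shows "s < decr x u \<longleftrightarrow> u < tail x s"
proof
  have bdd: "bdd_below {s. 0 \<le> s \<and> tail x s \<le> u}" by (intro bdd_belowI[of _ 0]) auto
  show "u < tail x s" if "s < decr x u"
  proof (rule ccontr)
    assume "\<not> u < tail x s"
    then have "decr x u \<le> s" unfolding decr_def using s by (intro cInf_lower bdd) auto
    then show False using that by simp
  qed
  show "s < decr x u" if "u < tail x s"
  proof -
    from tail_right_continuous[OF that] obtain r where r: "r > s" "u < tail x r" by blast
    have "r \<le> decr x u" unfolding decr_def
    proof (rule cInf_greatest)
      show "{s. 0 \<le> s \<and> tail x s \<le> u} \<noteq> {}" using tail_small[OF u] by auto
      fix v assume "v \<in> {s. 0 \<le> s \<and> tail x s \<le> u}"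
      then show "r \<le> v" using r(2) tail_mono[OF x, of v r] by (cases "r \<le> v") auto
    qed
    then show ?thesis using r by simp
  qed
qed

lemma decr_nonneg: "0 < u \<Longrightarrow> 0 \<le> decr x u"
  unfolding decr_def using tail_small by (intro cInf_greatest) auto

lemma decr_antimono: "0 < u \<Longrightarrow> u \<le> v \<Longrightarrow> decr x v \<le> decr x u"
  using less_decr_iff[of v "decr x u"] less_decr_iff[of u "decr x u"] decr_nonneg[of u] by (smt (verit))

lemma decr_greater_set:
  assumes "0 \<le> s"
  shows "{0<..1} \<inter> {u. s < decr x u} = {0<..<tail x s}"
proof -
  have "tail x s \<le> 1" unfolding tail_def by (rule unit_leb.prob_le_1)
  then show ?thesis using less_decr_iff[OF _ assms] by auto
qed

lemma decr_measurable [measurable]: "decr x \<in> borel_measurable unit_leb"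
  unfolding borel_measurable_iff_greater
proof
  fix s
  have "{0<..1} \<inter> {u. s < decr x u} \<in> sets lebesgue"
  proof (cases "0 \<le> s")
    case True
    then show ?thesis by (simp add: decr_greater_set)
  next
    case False
    then have "{0<..1} \<inter> {u. s < decr x u} = {0<..1}"
      using decr_nonneg by fastforce
    then show ?thesis by simp
  qed
  moreover have "{0} \<inter> {u. s < decr x u} \<in> sets lebesgue" by (cases "s < decr x 0") auto
  moreover have "{u \<in> space unit_leb. s < decr x u}
      = ({0<..1} \<inter> {u. s < decr x u}) \<union> ({0} \<inter> {u. s < decr x u})" by fastforce
  ultimately have "{u \<in> space unit_leb. s < decr x u} \<in> sets lebesgue" by (simp only: sets.Un)
  then show "{u \<in> space unit_leb. s < decr x u} \<in> sets unit_leb" by (intro sets_unit_lebI) auto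
qed

lemma tail_decr:
  assumes s: "0 \<le> s"
  shows "tail (decr x) s = tail x s"
proof -
  have le1: "tail x s \<le> 1" unfolding tail_def by (rule unit_leb.prob_le_1)
  have "tail (decr x) s = measure unit_leb {0<..<tail x s}" unfolding tail_def[of "decr x"]
  proof (rule unit_leb.finite_measure_eq_AE)
    show "AE u in unit_leb. (u \<in> {u \<in> {0..1}. s < \<bar>decr x u\<bar>}) = (u \<in> {0<..<tail x s})"
      using AE_unit_leb_pos
    proof eventually_elim
      case (elim u)
      then show ?case using decr_greater_set[OF s] decr_nonneg[of u] by (auto simp: set_eq_iff)
    qed
    show "{u \<in> {0..1}. s < \<bar>decr x u\<bar>} \<in> sets unit_leb"
      by (rule level_set[OF decr_measurable])
    show "{0<..<tail x s} \<in> sets unit_leb"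
      using le1 by (intro sets_unit_lebI) auto
  qed
  also have "\<dots> = tail x s"
  proof -
    have "0 \<le> tail x s" by (simp add: tail_def)
    moreover have "{0<..<tail x s} \<subseteq> {0..1}" using le1 by auto
    ultimately show ?thesis by (subst measure_restrict_space) auto
  qed
  finally show ?thesis .
qed

text \<open>The image measures of \<open>|x|\<close> and \<open>|decr x|\<close> agree on all
  half-lines, hence everywhere, so every integral of a function of the modulus agrees.\<close>

lemma integral_decr_tail:
  "(LINT u|unit_leb. \<bar>x u\<bar> * indicator {u. s < \<bar>x u\<bar>} u)
   = (LINT u|unit_leb. \<bar>decr x u\<bar> * indicator {u. s < \<bar>decr x u\<bar>} u)"
proof -
  have eq: "distr unit_leb borel (\<lambda>u. \<bar>x u\<bar>) = distr unit_leb borel (\<lambda>u. \<bar>decr x u\<bar>)"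
  proof (rule measure_eqI_lessThan)
    show "emeasure (distr unit_leb borel (\<lambda>u. \<bar>x u\<bar>)) {s<..} < \<infinity>" for s
      by (subst emeasure_distr) (auto simp: less_top[symmetric] unit_leb.emeasure_finite)
    show "emeasure (distr unit_leb borel (\<lambda>u. \<bar>x u\<bar>)) {s<..} = emeasure (distr unit_leb borel (\<lambda>u. \<bar>decr x u\<bar>)) {s<..}" for s
    proof (cases "0 \<le> s")
      case True
      have "(\<lambda>u. \<bar>y u\<bar>) -` {s<..} \<inter> space unit_leb = {u \<in> {0..1}. s < \<bar>y u\<bar>}" for y :: rfun by auto
      then show ?thesis using tail_decr[OF True]
        by (subst (1 2) emeasure_distr) (auto simp: unit_leb.emeasure_eq_measure tail_def)
    next
      case False
      then have "(\<lambda>u. \<bar>y u\<bar>) -` {s<..} \<inter> space unit_leb = space unit_leb" for y :: rfun by auto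
      then show ?thesis by (subst (1 2) emeasure_distr) auto
    qed
  qed auto
  have "(LINT u|unit_leb. \<bar>x u\<bar> * indicator {u. s < \<bar>x u\<bar>} u)
     = (LINT v|distr unit_leb borel (\<lambda>u. \<bar>x u\<bar>). v * indicator {s<..} v)"
    by (subst integral_distr) (auto simp: indicator_def)
  also have "\<dots> = (LINT u|unit_leb. \<bar>decr x u\<bar> * indicator {u. s < \<bar>decr x u\<bar>} u)"
    unfolding eq by (subst integral_distr) (auto simp: indicator_def)
  finally show ?thesis .
qed

end

section \<open>Rearrangement invariant spaces and their fundamental function\<close>

locale ri =
  fixes E :: "rfun set" and N :: "rfun \<Rightarrow> real"
  assumes ri: "ri_space E N"
begin

lemma normed: "normed_fun_space E N"
  using ri by (simp add: ri_space_def banach_fun_space_def)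

lemma measurableD: "x \<in> E \<Longrightarrow> x \<in> borel_measurable unit_leb"
  using normed by (auto simp: normed_fun_space_def fun_subspace_def)

lemma zero: "(\<lambda>_. 0) \<in> E" "N (\<lambda>_. 0) = 0"
  using normed by (auto simp: normed_fun_space_def fun_subspace_def)

lemma add: "x \<in> E \<Longrightarrow> y \<in> E \<Longrightarrow> (\<lambda>t. x t + y t) \<in> E"
  and triangle: "x \<in> E \<Longrightarrow> y \<in> E \<Longrightarrow> N (\<lambda>t. x t + y t) \<le> N x + N y"
  and scale: "x \<in> E \<Longrightarrow> (\<lambda>t. c * x t) \<in> E"
  and norm_scale: "x \<in> E \<Longrightarrow> N (\<lambda>t. c * x t) = \<bar>c\<bar> * N x"
  and norm_nonneg: "x \<in> E \<Longrightarrow> 0 \<le> N x"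
  using normed unfolding normed_fun_space_def fun_subspace_def by blast+

lemma diff: "x \<in> E \<Longrightarrow> y \<in> E \<Longrightarrow> (\<lambda>t. x t - y t) \<in> E"
  using add[of x "\<lambda>t. - 1 * y t"] scale[of y "-1"] by simp

lemma sum_in:
  assumes "finite I" "\<And>i. i \<in> I \<Longrightarrow> f i \<in> E"
  shows "(\<lambda>t. \<Sum>i\<in>I. f i t) \<in> E \<and> N (\<lambda>t. \<Sum>i\<in>I. f i t) \<le> (\<Sum>i\<in>I. N (f i))"
  using assms
proof (induction I)
  case empty
  then show ?case using zero by simp
next
  case (insert i I)
  then show ?case using add[of "f i" "\<lambda>t. \<Sum>i\<in>I. f i t"] triangle[of "f i" "\<lambda>t. \<Sum>i\<in>I. f i t"]
    by auto
qed

lemma lattice: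
  assumes "y \<in> E" "x \<in> borel_measurable unit_leb" "AE t in unit_leb. \<bar>x t\<bar> \<le> \<bar>y t\<bar>"
  shows "x \<in> E" "N x \<le> N y"
  using ri assms unfolding ri_space_def by blast+

lemma equimeasurable:
  assumes "y \<in> E" "x \<in> borel_measurable unit_leb" "\<And>s. 0 \<le> s \<Longrightarrow> tail x s = tail y s"
  shows "x \<in> E" "N x = N y"
proof -
  have "\<forall>t\<in>{0..1}. rearrangement x t = rearrangement y t"
    using rearrangement_cong[OF assms(3)] by blast
  then show "x \<in> E" "N x = N y" using ri assms unfolding ri_space_def by blast+
qed

lemma L1_le: "x \<in> E \<Longrightarrow> L1_norm x \<le> N x" and integrableD: "x \<in> E \<Longrightarrow> integrable unit_leb x"
  using ri unfolding ri_space_def inclusion_norm_one_def L1_def by blast+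

lemma bounded:
  assumes [measurable]: "x \<in> borel_measurable unit_leb" and b: "\<And>u. u \<in> {0..1} \<Longrightarrow> \<bar>x u\<bar> \<le> c" and c: "0 \<le> c"
  shows "x \<in> E" "N x \<le> c"
proof -
  have le: "esssup unit_leb (\<lambda>t. ennreal \<bar>x t\<bar>) \<le> ennreal c"
    using b by (intro esssup_I AE_I2) (auto intro!: ennreal_leI)
  also have "\<dots> < \<infinity>" by simp
  finally have "x \<in> Linf" by (simp add: Linf_def)
  moreover have "Linf_norm x \<le> c"
    unfolding Linf_norm_def using enn2real_mono[OF le] c by simp
  ultimately show "x \<in> E" "N x \<le> c"
    using ri unfolding ri_space_def inclusion_norm_one_def by (blast, meson order_trans)
qed

definition fund :: "real \<Rightarrow> real" where "fund a = N (indicator {0..a})"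

lemma indicator_measurable: "A \<in> sets unit_leb \<Longrightarrow> (indicator A :: rfun) \<in> borel_measurable unit_leb"
  by simp

lemma indicator_in: "A \<in> sets unit_leb \<Longrightarrow> (indicator A :: rfun) \<in> E"
  by (rule bounded(1)[where c=1]) (auto simp: indicator_def)

lemma fund_indicator:
  assumes A: "A \<in> sets unit_leb"
  shows "N (indicator A) = fund (measure unit_leb A)"
proof -
  let ?I = "{0..measure unit_leb A}"
  have I: "?I \<in> sets unit_leb"
    using unit_leb.prob_le_1[of A] by (intro sets_unit_lebI) auto
  have "tail (indicator B) s = (if s < 1 then measure unit_leb B else 0)" if "0 \<le> s" "B \<in> sets unit_leb" for s B
  proof -
    have "{u \<in> {0..1}. s < \<bar>indicator B u :: real\<bar>} = (if s < 1 then B else {})"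
      using that sets.sets_into_space[OF that(2)] by (auto simp: indicator_def)
    then show ?thesis by (simp add: tail_def)
  qed
  moreover have "measure unit_leb ?I = measure unit_leb A"
    using unit_leb.prob_le_1[of A] by (subst measure_unit_leb_interval) auto
  ultimately show ?thesis
    unfolding fund_def using A I by (intro equimeasurable(2) indicator_in) auto
qed

lemma interval_sets: "a \<le> 1 \<Longrightarrow> {0..a} \<in> sets unit_leb"
  by (intro sets_unit_lebI) auto

lemma fund_mono: "a \<le> b \<Longrightarrow> b \<le> 1 \<Longrightarrow> fund a \<le> fund b"
  unfolding fund_def by (intro lattice(2) indicator_in interval_sets indicator_measurable) (auto simp: indicator_def)

lemma fund_le_1: "a \<le> 1 \<Longrightarrow> fund a \<le> 1"
  unfolding fund_def by (intro bounded(2) indicator_measurable interval_sets) (auto simp: indicator_def)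

lemma fund_nonneg: "a \<le> 1 \<Longrightarrow> 0 \<le> fund a"
  unfolding fund_def by (intro norm_nonneg indicator_in interval_sets)

text \<open>Turns a large level set of a member of \<open>E\<close> of known norm into an upper
  bound for the fundamental function.\<close>

lemma norm_ge_level:
  assumes x: "x \<in> E" and B: "B \<in> sets unit_leb" "\<And>u. u \<in> B \<Longrightarrow> l \<le> \<bar>x u\<bar>" and "0 \<le> l"
  shows "l * fund (measure unit_leb B) \<le> N x"
proof -
  have "l * fund (measure unit_leb B) = N (\<lambda>t. l * indicator B t)"
    using norm_scale[OF indicator_in[OF B(1)]] fund_indicator[OF B(1)] assms(4) by simp
  also have "\<dots> \<le> N x"
    using B assms(4) by (intro lattice(2)[OF x]) (auto simp: indicator_def)
  finally show ?thesis .
qed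

lemma decr_in:
  assumes "x \<in> E"
  shows "decr x \<in> E" "N (decr x) = N x"
  using equimeasurable[OF assms decr_measurable tail_decr] measurableD[OF assms] by auto

end

section \<open>Averaging over cyclic shifts\<close>

lemma bij_betw_add_mod: "bij_betw (\<lambda>j. (j + r) mod m) {..<m} {..<m :: nat}"
proof (cases "m = 0")
  case False
  have inj: "inj_on (\<lambda>j. (j + r) mod m) {..<m}"
  proof (rule linorder_inj_onI')
    fix i j assume ij: "i \<in> {..<m}" "j \<in> {..<m}" "i < j"
    show "(i + r) mod m \<noteq> (j + r) mod m"
    proof
      assume "(i + r) mod m = (j + r) mod m"
      then have "m dvd (j + r) - (i + r)" using ij by (subst mod_eq_dvd_iff_nat[symmetric]) auto
      then have "m \<le> j - i" using ij by (intro dvd_imp_le) auto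
      then show False using ij by auto
    qed
  qed
  moreover have "(\<lambda>j. (j + r) mod m) ` {..<m} \<subseteq> {..<m}" using False by auto
  ultimately show ?thesis by (simp add: bij_betw_def endo_inj_surj)
qed (simp add: bij_betw_def)

context ri
begin

text \<open>
  Averaging a step function over the cyclic shifts of its steps gives a constant: hence the norm of
  \<open>x\<close> is at least that of its mean over a set on which \<open>\<bar>x\<bar>\<close> is largest. The factor \<open>2\<close> absorbs
  the error of a lower Riemann sum.
\<close>

lemma averaging:
  assumes x: "x \<in> E" and t: "0 < t" "t \<le> 1" and L: "0 \<le> L" "tail x L \<le> t"
  shows "(LINT u|unit_leb. \<bar>x u\<bar> * indicator {u. L < \<bar>x u\<bar>} u) * fund t \<le> 2 * t * N x"
proof -
  define I where "I = (LINT u|unit_leb. \<bar>x u\<bar> * indicator {u. L < \<bar>x u\<bar>} u)"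
  define z where "z = decr x"
  note xm [measurable] = measurableD[OF x]
  note facts = decr_in[OF x]
  have z: "z \<in> E" "N z = N x" and zm [measurable]: "z \<in> borel_measurable unit_leb"
    and zi: "integrable unit_leb z"
    using facts measurableD[OF facts(1)] integrableD[OF facts(1)] by (auto simp: z_def)
  have z0: "0 \<le> z u" if "0 < u" for u using decr_nonneg[OF xm that] by (simp add: z_def)
  have zanti: "z v \<le> z u" if "0 < u" "u \<le> v" for u v using decr_antimono[OF xm that] by (simp add: z_def)
  have intz: "integrable unit_leb (\<lambda>u. \<bar>z u\<bar> * indicator A u)" if "A \<in> sets unit_leb" for A
    using integrable_mult_indicator[OF that, of "\<lambda>u. \<bar>z u\<bar>"] zi by (simp add: mult.commute)
  have sets_Ioo: "{0<..<a} \<in> sets unit_leb" if "a \<le> 1" for a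
    using that by (intro sets_unit_lebI) auto
  have "I = (LINT u|unit_leb. \<bar>z u\<bar> * indicator {u. L < \<bar>z u\<bar>} u)"
    unfolding I_def z_def by (rule integral_decr_tail[OF xm])
  also have "\<dots> \<le> (LINT u|unit_leb. \<bar>z u\<bar> * indicator {0<..<t} u)"
  proof (rule integral_mono_AE)
    have "{u \<in> space unit_leb. L < \<bar>z u\<bar>} \<in> sets unit_leb" by measurable
    from intz[OF this]
    have "integrable unit_leb (\<lambda>u. \<bar>z u\<bar> * indicator {u \<in> space unit_leb. L < \<bar>z u\<bar>} u)" .
    then show "integrable unit_leb (\<lambda>u. \<bar>z u\<bar> * indicator {u. L < \<bar>z u\<bar>} u)"
      by (rule Bochner_Integration.integrable_cong[THEN iffD1, rotated -1]) (auto simp: indicator_def)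
    show "integrable unit_leb (\<lambda>u. \<bar>z u\<bar> * indicator {0<..<t} u)" by (rule intz[OF sets_Ioo[OF t(2)]])
    show "AE u in unit_leb. \<bar>z u\<bar> * indicator {u. L < \<bar>z u\<bar>} u \<le> \<bar>z u\<bar> * indicator {0<..<t} u"
      using AE_unit_leb_pos
    proof eventually_elim
      case (elim u)
      then show ?case using less_decr_iff[OF xm _ L(1), of u] L(2) z0[of u]
        by (auto simp: indicator_def z_def)
    qed
  qed
  finally have Iz: "I \<le> (LINT u|unit_leb. \<bar>z u\<bar> * indicator {0<..<t} u)" .
  show ?thesis
  proof (cases "I \<le> 0")
    case True
    then have "I * fund t \<le> 0" using fund_nonneg[OF t(2)] by (simp add: mult_nonpos_nonneg)
    also have "0 \<le> 2 * t * N x" using t norm_nonneg[OF x] by simp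
    finally show ?thesis by (simp add: I_def)
  next
    case False
    \<comment> \<open>\<open>z\<close> may be unbounded at 0, so a sum over right endpoint values
      cannot control the first cell. The mesh is taken so fine that this cell carries less than
      \<open>I / 2\<close>.\<close>
    have "(\<lambda>n. LINT u|unit_leb. \<bar>z u\<bar> * indicator {0<..<t / real (Suc n)} u) \<longlonglongrightarrow> (LINT u|unit_leb. 0)"
    proof (rule integral_dominated_convergence[where w="\<lambda>u. \<bar>z u\<bar>"])
      show "AE u in unit_leb. (\<lambda>n. \<bar>z u\<bar> * indicator {0<..<t / real (Suc n)} u) \<longlonglongrightarrow> 0"
        using AE_unit_leb_pos
      proof eventually_elim
        case (elim u)
        then obtain n where "t / u < real n" using reals_Archimedean2 by blast
        then have n: "t < real n * u" using elim by (simp add: field_simps)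
        have "\<bar>z u\<bar> * indicator {0<..<t / real (Suc k)} u = 0" if "n \<le> k" for k
        proof -
          have "real n * u \<le> real (Suc k) * u" using that elim by (intro mult_right_mono) auto
          then have "t / real (Suc k) \<le> u" using n by (simp add: field_simps)
          then show ?thesis by (auto simp: indicator_def)
        qed
        then have "eventually (\<lambda>k. \<bar>z u\<bar> * indicator {0<..<t / real (Suc k)} u = 0) sequentially"
          by (auto simp: eventually_sequentially)
        then show ?case by (rule tendsto_eventually)
      qed
      show "(\<lambda>u. \<bar>z u\<bar> * indicator {0<..<t / real (Suc n)} u) \<in> borel_measurable unit_leb" for n
      proof -
        have "t / real (Suc n) \<le> t / 1" using t by (intro divide_left_mono) auto
        then show ?thesis using intz[OF sets_Ioo] t by auto
      qed
    qed (use zi in \<open>auto simp: indicator_def\<close>)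
    then have "eventually (\<lambda>n. (LINT u|unit_leb. \<bar>z u\<bar> * indicator {0<..<t / real (Suc n)} u) < I / 2) sequentially"
      using False by (intro order_tendstoD) auto
    then obtain n where "(LINT u|unit_leb. \<bar>z u\<bar> * indicator {0<..<t / real (Suc n)} u) < I / 2"
      by (auto simp: eventually_sequentially)
    moreover define m where "m = Suc n"
    ultimately have head: "(LINT u|unit_leb. \<bar>z u\<bar> * indicator {0<..<t / m} u) < I / 2" and m: "m > 0" by auto
    define g where "g j = t * real j / real m" for j
    define J where "J j = {g j..<g (Suc j)}" for j
    \<comment> \<open>The value at the right end of \<open>J j\<close>: since \<open>z\<close>
      decreases, it is a lower bound on \<open>J j\<close> and an upper bound on
      \<open>J (Suc j)\<close>. The first fact gives \<open>y 0 \<le> z\<close>, the second bounds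
      the integral of \<open>z\<close>.\<close>
    define c where "c j = z (g (Suc j))" for j
    have g0: "0 \<le> g j" for j using t by (simp add: g_def)
    have gpos: "0 < g (Suc j)" for j using t m by (simp add: g_def)
    have gmono: "i \<le> j \<Longrightarrow> g i \<le> g j" for i j
      unfolding g_def using t by (intro divide_right_mono mult_left_mono) auto
    have gm: "g m = t" using m by (simp add: g_def)
    have c0: "0 \<le> c j" for j using z0[OF gpos] by (simp add: c_def)
    have gdiff: "g (Suc j) - g j = t / m" for j using m by (simp add: g_def field_simps)
    have Jsub: "J j \<subseteq> {0..<t}" if "j < m" for j
      using g0[of j] gmono[of "Suc j" m] that gm by (auto simp: J_def)
    have Jset: "J j \<in> sets unit_leb" if "j < m" for j
      using Jsub[OF that] t by (intro sets_unit_lebI) (auto simp: J_def)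
    have Jmeas: "measure unit_leb (J j) = t / m" if "j < m" for j
    proof -
      have "g (Suc j) \<le> 1" using gmono[of "Suc j" m] that gm t by simp
      then show ?thesis unfolding J_def using g0 gmono[of j "Suc j"] gdiff by (subst measure_unit_leb_interval) auto
    qed
    have Jdisj: "i = j" if "u \<in> J i" "u \<in> J j" for i j u
    proof (rule ccontr)
      assume "i \<noteq> j"
      then have "Suc i \<le> j \<or> Suc j \<le> i" by auto
      then show False using that gmono[of "Suc i" j] gmono[of "Suc j" i] by (auto simp: J_def)
    qed
    have Jcover: "\<exists>j<m. u \<in> J j" if "u \<in> {0..<t}" for u
    proof -
      define j where "j = nat \<lfloor>u * m / t\<rfloor>"
      have "0 \<le> u * m / t" using that t by simp
      then have j: "real j \<le> u * m / t" "u * m / t < real j + 1"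
        unfolding j_def by linarith+
      have "u * m / t < m" using that t m by (simp add: field_simps)
      then have "j < m" using j by linarith
      moreover have "u \<in> J j" using j t m by (auto simp: J_def g_def field_simps)
      ultimately show ?thesis by blast
    qed
    define y where "y r u = (\<Sum>j<m. c ((j + r) mod m) * indicator (J j) u)" for r u
    have y_val: "y r u = c ((j + r) mod m)" if "j < m" "u \<in> J j" for r j u
    proof -
      have "y r u = (\<Sum>i<m. if i = j then c ((i + r) mod m) else 0)"
        unfolding y_def using that Jdisj by (intro sum.cong refl) (auto simp: indicator_def)
      then show ?thesis using that by simp
    qed
    have y_out: "y r u = 0" if "u \<notin> {0..<t}" for r u
    proof -
      have "u \<notin> J j" if "j < m" for j using Jsub[OF that] \<open>u \<notin> {0..<t}\<close> by blast
      then show ?thesis unfolding y_def by (intro sum.neutral) simp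
    qed
    have ym [measurable]: "y r \<in> borel_measurable unit_leb" for r
      unfolding y_def[abs_def] by (intro borel_measurable_sum borel_measurable_times borel_measurable_indicator Jset) auto
    have y0: "y 0 \<in> E \<and> N (y 0) \<le> N z"
    proof -
      have "AE u in unit_leb. \<bar>y 0 u\<bar> \<le> \<bar>z u\<bar>"
        using AE_unit_leb_pos
      proof eventually_elim
        case (elim u)
        show ?case
        proof (cases "u \<in> {0..<t}")
          case True
          then obtain j where j: "j < m" "u \<in> J j" using Jcover by blast
          then have "y 0 u = c j" using y_val[OF j, of 0] by simp
          moreover have "c j \<le> z u" unfolding c_def using j elim by (intro zanti) (auto simp: J_def)
          ultimately show ?thesis using c0[of j] by simp
        qed (simp add: y_out)
      qed
      then show ?thesis using lattice[OF z(1) ym] by blast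
    qed
    \<comment> \<open>All cells have length \<open>t / m\<close> and a shift only permutes the
      values on them, so each \<open>y r\<close> has the distribution of \<open>y 0\<close>.\<close>
    have tail_y: "tail (y r) s = tail (y 0) s" if s: "0 \<le> s" for r s
    proof -
      have *: "tail (y r) s = real (card {j. j < m \<and> s < c j}) * (t / m)" for r
      proof -
        let ?D = "{j \<in> {..<m}. s < c ((j + r) mod m)}"
        have "{u \<in> {0..1}. s < \<bar>y r u\<bar>} = (\<Union>j\<in>?D. J j)"
        proof safe
          fix u assume u: "u \<in> {0..1}" "s < \<bar>y r u\<bar>"
          then have "u \<in> {0..<t}" using y_out[of u r] s by (cases "u \<in> {0..<t}") auto
          then obtain j where j: "j < m" "u \<in> J j" using Jcover by blast
          then show "u \<in> (\<Union>j\<in>?D. J j)" using y_val[OF j, of r] u c0[of "(j + r) mod m"] by auto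
        next
          fix u j assume j: "j < m" "s < c ((j + r) mod m)" "u \<in> J j"
          show "u \<in> {0..1}" using Jsub[OF j(1)] j(3) t by auto
          show "s < \<bar>y r u\<bar>" using y_val[OF j(1,3), of r] j(2) by simp
        qed
        then have "tail (y r) s = measure unit_leb (\<Union>j\<in>?D. J j)" by (simp add: tail_def)
        also have "\<dots> = (\<Sum>j\<in>?D. measure unit_leb (J j))"
          using Jset Jdisj by (intro unit_leb.finite_measure_finite_Union)
            (auto simp: disjoint_family_on_def)
        also have "\<dots> = real (card ?D) * (t / m)" using Jmeas by simp
        also have "card ?D = card {j. j < m \<and> s < c j}"
        proof (rule bij_betw_same_card[of "\<lambda>j. (j + r) mod m"])
          have b: "inj_on (\<lambda>j. (j + r) mod m) {..<m}" "(\<lambda>j. (j + r) mod m) ` {..<m} = {..<m}"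
            using bij_betw_add_mod[of r m] by (auto simp: bij_betw_def)
          show "bij_betw (\<lambda>j. (j + r) mod m) ?D {j. j < m \<and> s < c j}"
            unfolding bij_betw_def
          proof
            show "inj_on (\<lambda>j. (j + r) mod m) ?D" by (rule inj_on_subset[OF b(1)]) auto
            show "(\<lambda>j. (j + r) mod m) ` ?D = {j. j < m \<and> s < c j}"
            proof -
              have "(\<lambda>j. (j + r) mod m) ` ?D = {k \<in> (\<lambda>j. (j + r) mod m) ` {..<m}. s < c k}" by blast
              then show ?thesis unfolding b(2) by simp
            qed
          qed
        qed
        finally show ?thesis .
      qed
      show ?thesis unfolding *[of r] *[of 0] ..
    qed
    have yE: "y r \<in> E" "N (y r) \<le> N x" for r
    proof -
      note eq = equimeasurable[OF conjunct1[OF y0] ym tail_y]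
      show "y r \<in> E" by (rule eq(1))
      show "N (y r) \<le> N x" using eq(2)[of r] y0 z(2) by simp
    qed
    \<comment> \<open>Over all shifts every cell receives each value exactly once.\<close>
    have sumy: "(\<Sum>r<m. y r u) = (\<Sum>j<m. c j) * indicator {0..<t} u" for u
    proof (cases "u \<in> {0..<t}")
      case True
      then obtain j where j: "j < m" "u \<in> J j" using Jcover by blast
      have "(\<Sum>r<m. y r u) = (\<Sum>r<m. c ((r + j) mod m))"
        using y_val[OF j] by (simp add: add.commute)
      also have "\<dots> = (\<Sum>j<m. c j)"
        using sum.reindex_bij_betw[OF bij_betw_add_mod[of j m], of c] by simp
      finally show ?thesis using True by simp
    qed (simp add: y_out)
    have It: "{0..<t} \<in> sets unit_leb" using t by (intro sets_unit_lebI) auto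
    have "(\<Sum>j<m. c j) * fund t = N (\<lambda>u. (\<Sum>j<m. c j) * indicator {0..<t} u)"
      using norm_scale[OF indicator_in[OF It]] fund_indicator[OF It] t measure_unit_leb_interval(2)[of 0 t]
      by (simp add: sum_nonneg c0)
    also have "\<dots> = N (\<lambda>u. \<Sum>r<m. y r u)" by (simp add: sumy)
    also have "\<dots> \<le> (\<Sum>r<m. N (y r))" using yE by (intro sum_in[THEN conjunct2]) auto
    also have "\<dots> \<le> m * N x" using sum_bounded_above[of "{..<m}" "\<lambda>r. N (y r)" "N x"] yE by simp
    finally have 1: "(\<Sum>j<m. c j) * fund t \<le> m * N x" .
    have JS: "J (Suc j) \<inter> {0..<t} \<in> sets unit_leb"
      "integrable unit_leb (indicator (J (Suc j) \<inter> {0..<t}) :: rfun)" for j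
    proof -
      show s: "J (Suc j) \<inter> {0..<t} \<in> sets unit_leb"
        using t by (intro sets_unit_lebI) (auto simp: J_def)
      show "integrable unit_leb (indicator (J (Suc j) \<inter> {0..<t}) :: rfun)"
        by (rule unit_leb_indicator(1)[OF s])
    qed
    have "I - I / 2 \<le> (LINT u|unit_leb. \<bar>z u\<bar> * indicator {0<..<t} u)
        - (LINT u|unit_leb. \<bar>z u\<bar> * indicator {0<..<t / m} u)"
      using Iz head by simp
    also have "\<dots> = (LINT u|unit_leb. \<bar>z u\<bar> * indicator {0<..<t} u - \<bar>z u\<bar> * indicator {0<..<t / m} u)"
    proof (rule Bochner_Integration.integral_diff[symmetric])
      have "t / m \<le> t / 1" using t m by (intro divide_left_mono) auto
      then show "integrable unit_leb (\<lambda>u. \<bar>z u\<bar> * indicator {0<..<t / m} u)"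
        using t by (intro intz sets_Ioo) auto
    qed (intro intz sets_Ioo t)
    \<comment> \<open>After removal of the first cell, \<open>z \<le> c j\<close> on the cell with
      index \<open>Suc j\<close>. Intersecting with \<open>{0..<t}\<close> empties the cell for the
      last index \<open>j = m - 1\<close>.\<close>
    also have "\<dots> \<le> (LINT u|unit_leb. (\<Sum>j<m. c j * indicator (J (Suc j) \<inter> {0..<t}) u))"
    proof (rule integral_mono_AE)
      have "t / m \<le> t / 1" using t m by (intro divide_left_mono) auto
      then show "integrable unit_leb (\<lambda>u. \<bar>z u\<bar> * indicator {0<..<t} u - \<bar>z u\<bar> * indicator {0<..<t / m} u)"
        using t by (intro Bochner_Integration.integrable_diff intz sets_Ioo) auto
      show "integrable unit_leb (\<lambda>u. \<Sum>j<m. c j * indicator (J (Suc j) \<inter> {0..<t}) u)"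
        by (intro Bochner_Integration.integrable_sum integrable_mult_right JS)
      show "AE u in unit_leb. \<bar>z u\<bar> * indicator {0<..<t} u - \<bar>z u\<bar> * indicator {0<..<t / m} u
          \<le> (\<Sum>j<m. c j * indicator (J (Suc j) \<inter> {0..<t}) u)"
        using AE_unit_leb_pos
      proof eventually_elim
        case (elim u)
        have nn: "0 \<le> (\<Sum>j<m. c j * indicator (J (Suc j) \<inter> {0..<t}) u)"
          by (intro sum_nonneg) (simp add: c0)
        show ?case
        proof (cases "u < t \<and> t / m \<le> u")
          case True
          then obtain j where j: "j < m" "u \<in> J j" using Jcover[of u] elim by auto
          have "g 1 \<le> u" using True by (simp add: g_def)
          then have "j \<noteq> 0" using j(2) unfolding J_def by (cases j) auto
          then obtain i where i: "j = Suc i" by (cases j) auto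
          have "z u \<le> c i" unfolding c_def using j gpos i by (intro zanti) (auto simp: J_def)
          also have "\<dots> = c i * indicator (J (Suc i) \<inter> {0..<t}) u" using j i True elim by simp
          also have "\<dots> \<le> (\<Sum>j<m. c j * indicator (J (Suc j) \<inter> {0..<t}) u)"
            using j i c0 by (intro member_le_sum) auto
          finally show ?thesis using True elim z0[of u] by (simp add: indicator_def)
        next
          case False
          have "\<bar>z u\<bar> * indicator {0<..<t} u - \<bar>z u\<bar> * indicator {0<..<t / m} u \<le> 0"
            using False by (auto simp: indicator_def)
          then show ?thesis using nn by linarith
        qed
      qed
    qed
    also have "\<dots> = (\<Sum>j<m. c j * measure unit_leb (J (Suc j) \<inter> {0..<t}))"
    proof -
      have "J (Suc j) \<inter> {0..<t} \<inter> {0..1} = J (Suc j) \<inter> {0..<t}" for j using t by auto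
      then show ?thesis by (subst Bochner_Integration.integral_sum) (use JS in auto)
    qed
    also have "\<dots> \<le> (\<Sum>j<m. c j * (t / m))"
    proof (intro sum_mono mult_left_mono c0)
      fix j assume "j \<in> {..<m}"
      show "measure unit_leb (J (Suc j) \<inter> {0..<t}) \<le> t / m"
      proof (cases "Suc j < m")
        case True
        then have "J (Suc j) \<inter> {0..<t} = J (Suc j)" using Jsub by auto
        then show ?thesis using Jmeas[OF True] by simp
      next
        case False
        then have "J (Suc j) \<inter> {0..<t} = {}" using gmono[of m "Suc j"] gm by (auto simp: J_def)
        then show ?thesis using t by simp
      qed
    qed
    also have "\<dots> = (\<Sum>j<m. c j) * (t / m)" by (rule sum_distrib_right[symmetric])
    finally have 2: "I / 2 \<le> (\<Sum>j<m. c j) * (t / m)" by simp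
    have "I / 2 * fund t \<le> (\<Sum>j<m. c j) * (t / m) * fund t"
      using 2 fund_nonneg[OF t(2)] by (rule mult_right_mono)
    also have "\<dots> = ((\<Sum>j<m. c j) * fund t) * (t / m)" by simp
    also have "\<dots> \<le> m * N x * (t / m)" using 1 t by (intro mult_right_mono) auto
    also have "\<dots> = t * N x" using m by simp
    finally show ?thesis by (simp add: I_def)
  qed
qed

end

section \<open>Subspaces on which the norm is equivalent to the \<open>L\<^sub>1\<close> norm\<close>

lemma fun_subspace_sum:
  assumes "fun_subspace V" "finite I" "\<And>i. i \<in> I \<Longrightarrow> f i \<in> V"
  shows "(\<lambda>t. \<Sum>i\<in>I. c i * f i t) \<in> V"
  using assms(2,3)
proof (induction I)
  case empty
  then show ?case using assms(1) by (simp add: fun_subspace_def)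
next
  case (insert i I)
  then have "(\<lambda>t. c i * f i t) \<in> V" "(\<lambda>t. \<Sum>i\<in>I. c i * f i t) \<in> V"
    using assms(1) by (auto simp: fun_subspace_def)
  then show ?case using assms(1) insert by (auto simp: fun_subspace_def)
qed

section \<open>Kernels of finitely many functionals\<close>

definition linear_functional_on :: "rfun set \<Rightarrow> (rfun \<Rightarrow> real) \<Rightarrow> bool" where
  "linear_functional_on V f \<longleftrightarrow> (\<forall>x\<in>V. \<forall>y\<in>V. f (\<lambda>t. x t + y t) = f x + f y) \<and>
     (\<forall>c. \<forall>x\<in>V. f (\<lambda>t. c * x t) = c * f x)"

text \<open>If \<open>B\<close> spanned the kernel and \<open>f v \<noteq> 0\<close>, then
  \<open>insert v B\<close> would span \<open>V\<close>, because \<open>x - (f x / f v) * v\<close>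
  lies in the kernel.\<close>

lemma infinite_dim_kernel:
  assumes V: "fun_subspace V" "infinite_dim V" and f: "linear_functional_on V f"
  shows "fun_subspace {x \<in> V. f x = 0}" "infinite_dim {x \<in> V. f x = 0}"
proof -
  have zero: "(\<lambda>_. 0) \<in> V" and add: "\<And>x y. x \<in> V \<Longrightarrow> y \<in> V \<Longrightarrow> (\<lambda>t. x t + y t) \<in> V"
    and scale: "\<And>x c. x \<in> V \<Longrightarrow> (\<lambda>t. c * x t) \<in> V" and Vm: "V \<subseteq> borel_measurable unit_leb"
    using V(1) by (auto simp: fun_subspace_def)
  have f_add: "\<And>x y. x \<in> V \<Longrightarrow> y \<in> V \<Longrightarrow> f (\<lambda>t. x t + y t) = f x + f y"
    and f_scale: "\<And>x c. x \<in> V \<Longrightarrow> f (\<lambda>t. c * x t) = c * f x"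
    using f by (auto simp: linear_functional_on_def)
  have "f (\<lambda>_. 0) = 0" using f_scale[OF zero, of 0] by simp
  then show "fun_subspace {x \<in> V. f x = 0}"
    unfolding fun_subspace_def using zero add scale f_add f_scale Vm by auto
  show "infinite_dim {x \<in> V. f x = 0}"
    unfolding infinite_dim_def
  proof
    assume "\<exists>B. finite B \<and> B \<subseteq> {x \<in> V. f x = 0} \<and>
      (\<forall>x\<in>{x \<in> V. f x = 0}. \<exists>c :: rfun \<Rightarrow> real. AE t in unit_leb. x t = (\<Sum>b\<in>B. c b * b t))"
    then obtain B where B: "finite B" "B \<subseteq> {x \<in> V. f x = 0}"
      and span: "\<And>x. x \<in> V \<Longrightarrow> f x = 0 \<Longrightarrow> \<exists>c :: rfun \<Rightarrow> real. AE t in unit_leb. x t = (\<Sum>b\<in>B. c b * b t)"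
      by auto
    have "\<exists>B'. finite B' \<and> B' \<subseteq> V \<and>
      (\<forall>x\<in>V. \<exists>c :: rfun \<Rightarrow> real. AE t in unit_leb. x t = (\<Sum>b\<in>B'. c b * b t))"
    proof (cases "\<forall>x\<in>V. f x = 0")
      case True
      then show ?thesis using B span by blast
    next
      case False
      then obtain v where v: "v \<in> V" "f v \<noteq> 0" by blast
      have "\<exists>c :: rfun \<Rightarrow> real. AE t in unit_leb. x t = (\<Sum>b\<in>insert v B. c b * b t)" if x: "x \<in> V" for x
      proof -
        define \<alpha> where "\<alpha> = f x / f v"
        have w: "(\<lambda>t. - \<alpha> * v t) \<in> V" by (rule scale[OF v(1)])
        have "(\<lambda>t. x t + - \<alpha> * v t) \<in> V" by (rule add[OF x w])
        moreover have "f (\<lambda>t. x t + - \<alpha> * v t) = 0"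
          using f_add[OF x w] f_scale[OF v(1), of "- \<alpha>"] v(2) by (simp add: \<alpha>_def)
        ultimately obtain c where c: "AE t in unit_leb. x t + - \<alpha> * v t = (\<Sum>b\<in>B. c b * b t)"
          using span[of "\<lambda>t. x t + - \<alpha> * v t"] by (auto simp del: minus_mult_minus)
        \<comment> \<open>Since \<open>f\<close> vanishes on \<open>B\<close>, \<open>v\<close> is
          new, and overwriting its coefficient by \<open>\<alpha>\<close> does not disturb the
          combination over \<open>B\<close>.\<close>
        have "v \<notin> B" using B v by auto
        then have "(\<Sum>b\<in>insert v B. (c(v := \<alpha>)) b * b t) = \<alpha> * v t + (\<Sum>b\<in>B. c b * b t)" for t
          using B(1) by (simp, intro sum.cong) auto
        then have "AE t in unit_leb. x t = (\<Sum>b\<in>insert v B. (c(v := \<alpha>)) b * b t)"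
          using c by auto
        then show ?thesis by blast
      qed
      then show ?thesis using B v by (intro exI[of _ "insert v B"]) auto
    qed
    then show False using V(2) unfolding infinite_dim_def by blast
  qed
qed

lemma infinite_dim_kernels:
  assumes "finite A" "fun_subspace V" "infinite_dim V" "\<And>f. f \<in> A \<Longrightarrow> linear_functional_on V f"
  shows "fun_subspace {x \<in> V. \<forall>f\<in>A. f x = 0} \<and> infinite_dim {x \<in> V. \<forall>f\<in>A. f x = 0}"
  using assms(1,4)
proof (induction A)
  case empty
  then show ?case using assms by simp
next
  case (insert f A)
  let ?W = "{x \<in> V. \<forall>f\<in>A. f x = 0}"
  have "linear_functional_on ?W f"
    using insert(4)[of f] by (auto simp: linear_functional_on_def)
  moreover have "{x \<in> V. \<forall>g\<in>insert f A. g x = 0} = {x \<in> ?W. f x = 0}" by auto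
  ultimately show ?case using infinite_dim_kernel[of ?W f] insert by auto
qed

section \<open>Orthogonality and separation in a strongly embedded subspace\<close>

locale strongly_embedded = ri +
  fixes V :: "rfun set" and C :: real
  assumes V: "V \<subseteq> E" "fun_subspace V" "infinite_dim V"
    and C: "\<And>x. x \<in> V \<Longrightarrow> N x \<le> C * L1_norm x" and C_pos: "0 < C"
begin

lemma V_integrable: "x \<in> V \<Longrightarrow> integrable unit_leb x"
  using V(1) integrableD by blast

lemma V_measurable: "x \<in> V \<Longrightarrow> x \<in> borel_measurable unit_leb"
  using V_integrable by blast

lemma V_scale: "x \<in> V \<Longrightarrow> (\<lambda>t. c * x t) \<in> V"
  using V(2) by (simp add: fun_subspace_def)

lemma V_add: "x \<in> V \<Longrightarrow> y \<in> V \<Longrightarrow> (\<lambda>t. x t + y t) \<in> V"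
  using V(2) by (simp add: fun_subspace_def)

lemma V_diff: "x \<in> V \<Longrightarrow> y \<in> V \<Longrightarrow> (\<lambda>t. x t - y t) \<in> V"
  using V_add[OF _ V_scale[of y "-1"], of x] by simp

lemma L1_norm_scale: "L1_norm (\<lambda>t. c * x t) = \<bar>c\<bar> * L1_norm x"
  by (simp add: L1_norm_def abs_mult)

lemma integrable_times_bounded:
  fixes x \<psi> :: rfun
  assumes "integrable unit_leb x" "\<psi> \<in> borel_measurable unit_leb" "\<And>t. \<bar>\<psi> t\<bar> \<le> b"
  shows "integrable unit_leb (\<lambda>t. x t * \<psi> t)"
proof (rule Bochner_Integration.integrable_bound)
  show "integrable unit_leb (\<lambda>t. b * \<bar>x t\<bar>)" using assms by auto
  show "AE t in unit_leb. norm (x t * \<psi> t) \<le> norm (b * \<bar>x t\<bar>)"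
  proof (intro AE_I2)
    fix t
    have "\<bar>\<psi> t\<bar> * \<bar>x t\<bar> \<le> b * \<bar>x t\<bar>" using assms(3) by (intro mult_right_mono) auto
    moreover have "0 \<le> b" using assms(3)[of t] by linarith
    ultimately show "norm (x t * \<psi> t) \<le> norm (b * \<bar>x t\<bar>)" by (simp add: abs_mult mult.commute)
  qed
qed (use assms in auto)

text \<open>Finitely many bounded functions impose finitely many linear conditions on
  \<open>V\<close>, so their common kernel is infinite-dimensional. It has a member that is not
  null, since otherwise the empty set would span it modulo null functions.\<close>

lemma exists_orthogonal:
  assumes "finite \<Psi>" "\<And>\<psi>. \<psi> \<in> \<Psi> \<Longrightarrow> \<psi> \<in> borel_measurable unit_leb \<and> (\<forall>t. \<bar>\<psi> t\<bar> \<le> b)"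
  shows "\<exists>x\<in>V. L1_norm x = 1 \<and> (\<forall>\<psi>\<in>\<Psi>. (LINT t|unit_leb. x t * \<psi> t) = 0)"
proof -
  let ?p = "\<lambda>\<psi> x. LINT t|unit_leb. x t * \<psi> t"
  let ?W = "{x \<in> V. \<forall>f\<in>?p ` \<Psi>. f x = 0}"
  have "linear_functional_on V (?p \<psi>)" if "\<psi> \<in> \<Psi>" for \<psi>
  proof -
    have "integrable unit_leb (\<lambda>t. x t * \<psi> t)" if "x \<in> V" for x
      using integrable_times_bounded[OF V_integrable[OF that]] assms(2)[OF \<open>\<psi> \<in> \<Psi>\<close>] by blast
    then show ?thesis
      by (auto simp: linear_functional_on_def algebra_simps)
  qed
  then have W: "infinite_dim ?W"
    using infinite_dim_kernels[of "?p ` \<Psi>" V] assms(1) V by auto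
  have "\<exists>x\<in>?W. \<not> (AE t in unit_leb. x t = 0)"
  proof (rule ccontr)
    assume "\<not> ?thesis"
    then have "AE t in unit_leb. x t = 0" if "x \<in> ?W" for x using that by blast
    then have "finite {} \<and> {} \<subseteq> ?W \<and>
      (\<forall>x\<in>?W. \<exists>c :: rfun \<Rightarrow> real. AE t in unit_leb. x t = (\<Sum>b\<in>{}. c b * b t))"
      by (intro conjI ballI exI) (simp_all only: finite.emptyI empty_subsetI sum.empty)
    then show False using W unfolding infinite_dim_def by blast
  qed
  then obtain x where x: "x \<in> V" "\<And>\<psi>. \<psi> \<in> \<Psi> \<Longrightarrow> ?p \<psi> x = 0" "\<not> (AE t in unit_leb. x t = 0)" by auto
  have "L1_norm x \<noteq> 0"
    using x(3) V_integrable[OF x(1)] unfolding L1_norm_def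
    by (subst integral_nonneg_eq_0_iff_AE) auto
  moreover have "L1_norm x \<ge> 0" by (simp add: L1_norm_def)
  ultimately have "L1_norm (\<lambda>t. (1 / L1_norm x) * x t) = 1" by (subst L1_norm_scale) auto
  moreover have "(LINT t|unit_leb. (1 / L1_norm x) * x t * \<psi> t) = 0" if "\<psi> \<in> \<Psi>" for \<psi>
    using x(2)[OF that] by (simp add: mult.assoc)
  ultimately show ?thesis using V_scale[OF x(1), of "1 / L1_norm x"] by blast
qed

text \<open>\<open>sgn (f i)\<close> is a norming functional of \<open>f i\<close>. If all later
  members are annihilated by it, then pairing it with \<open>f i - f j\<close> gives 1, and its
  modulus is at most 1.\<close>

lemma separated_sequence:
  "\<exists>f :: nat \<Rightarrow> rfun. (\<forall>j. f j \<in> V \<and> L1_norm (f j) = 1) \<and> (\<forall>i j. i \<noteq> j \<longrightarrow> 1 \<le> L1_norm (\<lambda>t. f i t - f j t))"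
proof -
  have "\<exists>f :: nat \<Rightarrow> rfun. \<forall>j. f j \<in> V \<and> L1_norm (f j) = 1 \<and> (\<forall>i<j. (LINT t|unit_leb. f j t * sgn (f i t)) = 0)"
  proof (rule dependent_wellorder_choice)
    fix j :: nat and f :: "nat \<Rightarrow> rfun"
    assume *: "f i \<in> V \<and> L1_norm (f i) = 1 \<and> (\<forall>k<i. (LINT t|unit_leb. f i t * sgn (f k t)) = 0)" if "i < j" for i
    let ?\<Psi> = "(\<lambda>i t. sgn (f i t)) ` {..<j}"
    have "\<psi> \<in> borel_measurable unit_leb \<and> (\<forall>t. \<bar>\<psi> t\<bar> \<le> 1)" if "\<psi> \<in> ?\<Psi>" for \<psi>
      using that * V_measurable by (auto simp: abs_sgn_eq)
    from exists_orthogonal[of ?\<Psi>, OF _ this]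
    show "\<exists>x. x \<in> V \<and> L1_norm x = 1 \<and> (\<forall>i<j. (LINT t|unit_leb. x t * sgn (f i t)) = 0)"
      by auto
  qed auto
  then obtain f :: "nat \<Rightarrow> rfun" where f: "\<And>j. f j \<in> V" "\<And>j. L1_norm (f j) = 1"
    "\<And>i j. i < j \<Longrightarrow> (LINT t|unit_leb. f j t * sgn (f i t)) = 0" by blast
  have less: "1 \<le> L1_norm (\<lambda>t. f i t - f j t)" if "i < j" for i j
  proof -
    have int: "integrable unit_leb (\<lambda>t. f k t * sgn (f i t))" for k
      using V_integrable[OF f(1)] V_measurable[OF f(1)]
      by (intro integrable_times_bounded[where b=1]) (auto simp: abs_sgn_eq)
    have "1 = (LINT t|unit_leb. f i t * sgn (f i t)) - (LINT t|unit_leb. f j t * sgn (f i t))"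
      using f(2)[of i] f(3)[OF that] by (simp add: L1_norm_def abs_sgn)
    also have "\<dots> = (LINT t|unit_leb. (f i t - f j t) * sgn (f i t))"
      using int by (simp add: algebra_simps)
    also have "\<dots> \<le> L1_norm (\<lambda>t. f i t - f j t)"
      unfolding L1_norm_def
    proof (intro integral_mono)
      show "integrable unit_leb (\<lambda>t. (f i t - f j t) * sgn (f i t))"
        using int by (simp add: algebra_simps)
      show "(f i t - f j t) * sgn (f i t) \<le> \<bar>f i t - f j t\<bar>" for t
        by (auto simp: sgn_real_def)
    qed (use V_integrable f in auto)
    finally show ?thesis .
  qed
  have "1 \<le> L1_norm (\<lambda>t. f i t - f j t)" if "i \<noteq> j" for i j
  proof (cases "i < j")
    case False
    then have "1 \<le> L1_norm (\<lambda>t. f j t - f i t)" using less that by simp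
    then show ?thesis by (simp add: L1_norm_def abs_minus_commute)
  qed (rule less)
  then show ?thesis using f by blast
qed

section \<open>The dichotomy between linear growth of the fundamental function and uniform
  integrability\<close>

definition uniformly_integrable :: bool where
  "uniformly_integrable \<longleftrightarrow> (\<forall>\<epsilon>>0. \<exists>L>0. \<forall>x\<in>V. L1_norm x \<le> 1 \<longrightarrow>
     (LINT u|unit_leb. \<bar>x u\<bar> * indicator {u. L < \<bar>x u\<bar>} u) \<le> \<epsilon>)"

lemma L1_truncated_integrable:
  "x \<in> V \<Longrightarrow> integrable unit_leb (\<lambda>u. \<bar>x u\<bar> * indicator {u. L < \<bar>x u\<bar>} u)"
proof -
  assume x: "x \<in> V"
  note [measurable] = V_measurable[OF x]
  show ?thesis
    by (rule Bochner_Integration.integrable_bound[OF V_integrable[OF x]]) (measurable, auto simp: indicator_def)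
qed

text \<open>Without uniform integrability some \<open>\<epsilon>\<close> works for all levels. The
  level \<open>1 / t\<close> is matched to \<open>t\<close>: by Markov its level set has measure at
  most \<open>t\<close>, so \<open>averaging\<close> applies to the mass above it, which exceeds
  \<open>\<epsilon>\<close>.\<close>

lemma linear_fund_or_uniformly_integrable:
  "(\<exists>K. \<forall>t\<in>{0<..1}. fund t \<le> K * t) \<or> uniformly_integrable"
proof (rule ccontr)
  assume contra: "\<not> ?thesis"
  then obtain \<epsilon> where \<epsilon>: "\<epsilon> > 0"
    and large: "\<And>L. L > 0 \<Longrightarrow> \<exists>x\<in>V. L1_norm x \<le> 1 \<and> \<epsilon> < (LINT u|unit_leb. \<bar>x u\<bar> * indicator {u. L < \<bar>x u\<bar>} u)"
    unfolding uniformly_integrable_def by (meson not_less)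
  have "fund t \<le> 2 * C / \<epsilon> * t" if t: "t \<in> {0<..1}" for t
  proof -
    from t have t: "0 < t" "t \<le> 1" by auto
    then obtain x where x: "x \<in> V" "L1_norm x \<le> 1"
      and I: "\<epsilon> < (LINT u|unit_leb. \<bar>x u\<bar> * indicator {u. 1 / t < \<bar>x u\<bar>} u)"
      using large[of "1 / t"] by auto
    have xE: "x \<in> E" using x V by auto
    have "1 / t * tail x (1 / t) = (LINT u|unit_leb. 1 / t * indicator {u \<in> {0..1}. 1 / t < \<bar>x u\<bar>} u)"
      by (simp only: integral_mult_right_zero unit_leb_indicator(2)[OF level_set[OF V_measurable[OF x(1)]]] tail_def)
    also have "\<dots> \<le> L1_norm x" unfolding L1_norm_def
    proof (intro integral_mono)
      show "integrable unit_leb (\<lambda>u. 1 / t * indicator {u \<in> {0..1}. 1 / t < \<bar>x u\<bar>} u)"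
        by (intro integrable_mult_right unit_leb_indicator level_set V_measurable x)
    qed (use V_integrable x t in \<open>auto simp: indicator_def\<close>)
    also have "\<dots> \<le> 1" by (rule x(2))
    finally have "tail x (1 / t) \<le> t" using t by (simp add: field_simps)
    then have "(LINT u|unit_leb. \<bar>x u\<bar> * indicator {u. 1 / t < \<bar>x u\<bar>} u) * fund t \<le> 2 * t * N x"
      using t by (intro averaging xE) auto
    moreover have "\<epsilon> * fund t \<le> (LINT u|unit_leb. \<bar>x u\<bar> * indicator {u. 1 / t < \<bar>x u\<bar>} u) * fund t"
      using I fund_nonneg[OF t(2)] by (intro mult_right_mono) auto
    moreover have "N x \<le> C * 1" using C[OF x(1)] x(2) C_pos by (meson mult_left_mono less_imp_le order_trans)
    then have "2 * t * N x \<le> 2 * t * C" using t by simp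
    ultimately have "\<epsilon> * fund t \<le> 2 * t * C" by linarith
    then show ?thesis using \<epsilon> by (simp add: field_simps)
  qed
  then show False using contra by blast
qed

text \<open>The unit mass of a normalised member splits into at most 1/4 where it is below 1/4, at
  most 1/4 above \<open>L\<close>, and at most \<open>L\<close> times the measure of the set in
  question; the last part is therefore at least 1/2.\<close>

lemma nondegenerate:
  assumes uniformly_integrable
  shows "\<exists>\<delta>>0. \<forall>x\<in>V. \<delta> \<le> measure unit_leb {t \<in> space unit_leb. L1_norm x / 4 \<le> \<bar>x t\<bar>}"
proof -
  have "(0::real) < 1 / 4" by simp
  then obtain L where L: "L > 0"
    "\<And>x. x \<in> V \<Longrightarrow> L1_norm x \<le> 1 \<Longrightarrow> (LINT u|unit_leb. \<bar>x u\<bar> * indicator {u. L < \<bar>x u\<bar>} u) \<le> 1 / 4"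
    using assms unfolding uniformly_integrable_def by blast
  \<comment> \<open>The minimum with 1 serves null functions, for which the set is the whole
    interval.\<close>
  define \<delta> where "\<delta> = min 1 (1 / (2 * L))"
  have "\<delta> \<le> measure unit_leb {t \<in> space unit_leb. L1_norm x / 4 \<le> \<bar>x t\<bar>}" if x: "x \<in> V" for x
  proof (cases "L1_norm x = 0")
    case True
    then have "{t \<in> space unit_leb. L1_norm x / 4 \<le> \<bar>x t\<bar>} = space unit_leb" by auto
    then show ?thesis using unit_leb.prob_space by (simp add: \<delta>_def)
  next
    case False
    then have n: "L1_norm x > 0" by (simp add: L1_norm_def order_less_le)
    define y where "y t = (1 / L1_norm x) * x t" for t
    have y: "y \<in> V" "L1_norm y = 1"
      unfolding y_def[abs_def] L1_norm_scale using V_scale[OF x] n by (blast, simp)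
    note [measurable] = V_measurable[OF y(1)] V_measurable[OF x]
    let ?B = "{t \<in> space unit_leb. 1 / 4 \<le> \<bar>y t\<bar>}"
    have "?B \<in> sets unit_leb" by measurable
    note intB = unit_leb_indicator[OF this]
    note intT = L1_truncated_integrable[OF y(1), of L]
    have "1 = (LINT t|unit_leb. \<bar>y t\<bar>)" using y(2) by (simp add: L1_norm_def)
    also have "\<dots> \<le> (LINT t|unit_leb. 1 / 4 + L * indicator ?B t + \<bar>y t\<bar> * indicator {u. L < \<bar>y u\<bar>} t)"
    proof (intro integral_mono)
      show "integrable unit_leb (\<lambda>t. 1 / 4 + L * indicator ?B t + \<bar>y t\<bar> * indicator {u. L < \<bar>y u\<bar>} t)"
        by (intro Bochner_Integration.integrable_add integrable_mult_right intB(1) intT) auto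
      show "t \<in> space unit_leb \<Longrightarrow> \<bar>y t\<bar> \<le> 1 / 4 + L * indicator ?B t + \<bar>y t\<bar> * indicator {u. L < \<bar>y u\<bar>} t" for t
        using L(1) by (auto simp: indicator_def)
    qed (use V_integrable y in auto)
    also have "\<dots> = 1 / 4 + L * measure unit_leb ?B + (LINT t|unit_leb. \<bar>y t\<bar> * indicator {u. L < \<bar>y u\<bar>} t)"
      using intB intT unit_leb.prob_space by (simp del: Bochner_Integration.integral_indicator space_restrict_space2)
    also have "\<dots> \<le> 1 / 4 + L * measure unit_leb ?B + 1 / 4" using L(2)[OF y(1)] y(2) by simp
    finally have "1 / (2 * L) \<le> measure unit_leb ?B" using L(1) by (simp add: field_simps)
    moreover have "?B = {t \<in> space unit_leb. L1_norm x / 4 \<le> \<bar>x t\<bar>}"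
      using n by (auto simp: y_def abs_mult field_simps)
    ultimately show ?thesis by (simp add: \<delta>_def)
  qed
  moreover have "\<delta> > 0" using L by (simp add: \<delta>_def)
  ultimately show ?thesis by blast
qed

end

section \<open>Bounded almost orthogonal systems\<close>

lemma unit_leb_bounded_integrable:
  fixes x :: rfun
  assumes "x \<in> borel_measurable unit_leb" "\<And>t. \<bar>x t\<bar> \<le> b"
  shows "integrable unit_leb x" "\<bar>LINT t|unit_leb. x t\<bar> \<le> b"
proof -
  show x: "integrable unit_leb x"
    using assms by (intro unit_leb.integrable_const_bound[where B=b]) auto
  have "\<bar>LINT t|unit_leb. x t\<bar> \<le> (LINT t|unit_leb. \<bar>x t\<bar>)" by (rule integral_abs_bound)
  also have "\<dots> \<le> (LINT t|unit_leb. b)" using x assms by (intro integral_mono) auto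
  also have "\<dots> = b" using unit_leb.prob_space by simp
  finally show "\<bar>LINT t|unit_leb. x t\<bar> \<le> b" .
qed

text \<open>A finite substitute for weak compactness: the pairings of \<open>b k\<close> with the
  members of \<open>D\<close> form a point of a bounded cube. Cutting it into cells of side
  \<open>\<delta>\<close>, recorded by \<open>code\<close>, puts two of the infinitely many indices
  into the same cell.\<close>

lemma pigeonhole_pairing:
  fixes b :: "nat \<Rightarrow> rfun"
  assumes D: "finite D" "\<And>d. d \<in> D \<Longrightarrow> d \<in> borel_measurable unit_leb \<and> (\<forall>t. \<bar>d t\<bar> \<le> K)"
    and b: "\<And>k. b k \<in> borel_measurable unit_leb" "\<And>k t. \<bar>b k t\<bar> \<le> L" and \<delta>: "\<delta> > 0"
  shows "\<exists>k l. k \<noteq> l \<and> (\<forall>d\<in>D. \<bar>LINT t|unit_leb. d t * (b k t - b l t)\<bar> \<le> \<delta>)"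
proof -
  let ?p = "\<lambda>d k. LINT t|unit_leb. d t * b k t"
  have prod: "\<bar>d t * b k t\<bar> \<le> K * L" if "d \<in> D" for d k t
    using D(2)[OF that] b(2)[of k t] unfolding abs_mult by (intro mult_mono) (auto intro: order_trans[OF abs_ge_zero])
  have int: "integrable unit_leb (\<lambda>t. d t * b k t)" and bd: "\<bar>?p d k\<bar> \<le> K * L" if "d \<in> D" for d k
    using D(2)[OF that] b(1)[of k] prod[OF that, of _ k]
    by (auto intro!: unit_leb_bounded_integrable borel_measurable_times)
  define code where "code k = (\<lambda>d\<in>D. \<lfloor>?p d k / \<delta>\<rfloor>)" for k
  have "range code \<subseteq> PiE D (\<lambda>_. {\<lfloor>- (K * L) / \<delta>\<rfloor>..\<lfloor>K * L / \<delta>\<rfloor>})"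
  proof (rule image_subsetI)
    fix k
    have "\<lfloor>?p d k / \<delta>\<rfloor> \<in> {\<lfloor>- (K * L) / \<delta>\<rfloor>..\<lfloor>K * L / \<delta>\<rfloor>}" if "d \<in> D" for d
    proof -
      have "- (K * L) / \<delta> \<le> ?p d k / \<delta>" "?p d k / \<delta> \<le> K * L / \<delta>"
        using bd[OF that, of k] \<delta> by (intro divide_right_mono; linarith)+
      then show ?thesis by (simp add: floor_mono)
    qed
    then show "code k \<in> PiE D (\<lambda>_. {\<lfloor>- (K * L) / \<delta>\<rfloor>..\<lfloor>K * L / \<delta>\<rfloor>})" by (simp add: code_def)
  qed
  then have "finite (range code)" 
    by (rule finite_subset) (intro finite_PiE D(1), simp)
  then have "\<not> inj code" using finite_imageD by blast
  then obtain k l where kl: "k \<noteq> l" "code k = code l" by (auto simp: inj_on_def)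
  have "\<bar>LINT t|unit_leb. d t * (b k t - b l t)\<bar> \<le> \<delta>" if d: "d \<in> D" for d
  proof -
    have "\<lfloor>?p d k / \<delta>\<rfloor> = \<lfloor>?p d l / \<delta>\<rfloor>"
      using fun_cong[OF kl(2), of d] d by (simp add: code_def)
    then have "\<bar>?p d k / \<delta> - ?p d l / \<delta>\<bar> \<le> 1" by linarith
    then have "\<bar>(?p d k - ?p d l) / \<delta>\<bar> \<le> 1" by (simp add: diff_divide_distrib)
    then have "\<bar>?p d k - ?p d l\<bar> \<le> \<delta>" using \<delta> by (simp add: abs_divide field_simps)
    moreover have "(LINT t|unit_leb. d t * (b k t - b l t)) = ?p d k - ?p d l"
      using int[OF d] by (simp add: right_diff_distrib)
    ultimately show ?thesis by simp
  qed
  then show ?thesis using kl(1) by blast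
qed

text \<open>On a probability space the L1 norm is at most the L2 norm. The Gram matrix has diagonal
  at most \<open>K\<^sup>2\<close>, and its off-diagonal entries contribute at most
  \<open>\<delta> * (\<Sum>i<n. |a i|)\<^sup>2\<close>, which Cauchy-Schwarz bounds by
  \<open>\<delta> * n\<close> times the sum of squares.\<close>

lemma almost_orthogonal_L1:
  fixes d :: "nat \<Rightarrow> rfun"
  assumes d: "\<And>i. i < n \<Longrightarrow> d i \<in> borel_measurable unit_leb" "\<And>i t. i < n \<Longrightarrow> \<bar>d i t\<bar> \<le> K"
    and orth: "\<And>i j. i < j \<Longrightarrow> j < n \<Longrightarrow> \<bar>LINT t|unit_leb. d i t * d j t\<bar> \<le> \<delta>"
    and K: "0 < K" and \<delta>: "0 \<le> \<delta>"
  shows "(LINT t|unit_leb. \<bar>\<Sum>i<n. a i * d i t\<bar>) \<le> sqrt (K\<^sup>2 + \<delta> * real n) * sqrt (\<Sum>i<n. (a i)\<^sup>2)"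
proof (cases "\<forall>i<n. a i = 0")
  case True
  then show ?thesis by simp
next
  case False
  then obtain i0 where i0: "i0 < n" "a i0 \<noteq> 0" by blast
  define A where "A = (\<Sum>i<n. (a i)\<^sup>2)"
  have "(a i0)\<^sup>2 \<le> A" unfolding A_def using i0 by (intro member_le_sum) auto
  then have A: "A > 0" using i0 by (smt (verit) zero_less_power2)
  define G where "G = (K\<^sup>2 + \<delta> * real n) * A"
  have G: "G > 0" unfolding G_def using A K \<delta> by (intro mult_pos_pos add_pos_nonneg) auto
  define s where "s = sqrt G"
  have s: "s > 0" "s * s = G" using G by (auto simp: s_def)
  let ?g = "\<lambda>t. \<Sum>i<n. a i * d i t"
  have int2: "integrable unit_leb (\<lambda>t. d i t * d j t)"
    and bd: "\<bar>LINT t|unit_leb. d i t * d j t\<bar> \<le> K * K" if "i < n" "j < n" for i j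
  proof -
    have "\<bar>d i t * d j t\<bar> \<le> K * K" for t
      using d(2)[OF that(1), of t] d(2)[OF that(2), of t] K unfolding abs_mult by (intro mult_mono) auto
    moreover have "(\<lambda>t. d i t * d j t) \<in> borel_measurable unit_leb"
      using d(1)[OF that(1)] d(1)[OF that(2)] by (rule borel_measurable_times)
    ultimately show "integrable unit_leb (\<lambda>t. d i t * d j t)"
      "\<bar>LINT t|unit_leb. d i t * d j t\<bar> \<le> K * K"
      by (auto intro: unit_leb_bounded_integrable)
  qed
  have int1: "integrable unit_leb (d i)" if "i < n" for i
    using unit_leb_bounded_integrable(1)[OF d(1)[OF that] d(2)[OF that]] .
  have g2: "(?g t)\<^sup>2 = (\<Sum>i<n. \<Sum>j<n. a i * a j * (d i t * d j t))" for t
    by (simp add: power2_eq_square sum_product algebra_simps)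
  have intg2: "integrable unit_leb (\<lambda>t. (?g t)\<^sup>2)"
    unfolding g2 by (intro Bochner_Integration.integrable_sum integrable_mult_right int2) auto
  have intg: "integrable unit_leb ?g"
    by (intro Bochner_Integration.integrable_sum integrable_mult_right int1) auto
  have pair: "a i * a j * (LINT t|unit_leb. d i t * d j t)
      \<le> (if i = j then K\<^sup>2 * (a i)\<^sup>2 else 0) + \<delta> * (\<bar>a i\<bar> * \<bar>a j\<bar>)" if ij: "i < n" "j < n" for i j
  proof (cases "i = j")
    case True
    have "(LINT t|unit_leb. d i t * d j t) \<le> K\<^sup>2" using bd[OF ij] by (simp add: power2_eq_square)
    then have "(a i)\<^sup>2 * (LINT t|unit_leb. d i t * d j t) \<le> (a i)\<^sup>2 * K\<^sup>2" by (intro mult_left_mono) auto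
    moreover have "0 \<le> \<delta> * (\<bar>a i\<bar> * \<bar>a j\<bar>)" using \<delta> by simp
    ultimately show ?thesis using True by (simp add: power2_eq_square mult_ac)
  next
    case False
    then have "\<bar>LINT t|unit_leb. d i t * d j t\<bar> \<le> \<delta>"
      using orth[of i j] orth[of j i] ij by (cases "i < j") (auto simp: mult.commute)
    then have "\<bar>a i * a j\<bar> * \<bar>LINT t|unit_leb. d i t * d j t\<bar> \<le> \<bar>a i * a j\<bar> * \<delta>"
      by (intro mult_left_mono) auto
    then show ?thesis using False
      by (simp add: abs_mult[symmetric] mult_ac)
  qed
  have "(LINT t|unit_leb. (?g t)\<^sup>2) = (\<Sum>i<n. \<Sum>j<n. a i * a j * (LINT t|unit_leb. d i t * d j t))"
  proof -
    have "(LINT t|unit_leb. (?g t)\<^sup>2) = (\<Sum>i<n. LINT t|unit_leb. (\<Sum>j<n. a i * a j * (d i t * d j t)))"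
      unfolding g2 by (intro Bochner_Integration.integral_sum Bochner_Integration.integrable_sum integrable_mult_right int2) auto
    also have "\<dots> = (\<Sum>i<n. \<Sum>j<n. LINT t|unit_leb. a i * a j * (d i t * d j t))"
      by (intro sum.cong refl Bochner_Integration.integral_sum integrable_mult_right int2) auto
    finally show ?thesis by simp
  qed
  also have "\<dots> \<le> (\<Sum>i<n. \<Sum>j<n. (if i = j then K\<^sup>2 * (a i)\<^sup>2 else 0) + \<delta> * (\<bar>a i\<bar> * \<bar>a j\<bar>))"
    by (intro sum_mono pair) auto
  also have "\<dots> = K\<^sup>2 * A + \<delta> * (\<Sum>i<n. \<bar>a i\<bar>)\<^sup>2"
  proof -
    have "(\<Sum>i<n. \<bar>a i\<bar>)\<^sup>2 = (\<Sum>i<n. \<Sum>j<n. \<bar>a i\<bar> * \<bar>a j\<bar>)" by (simp only: power2_eq_square sum_product)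
    then show ?thesis by (simp add: sum.distrib sum_distrib_left A_def)
  qed
  also have "\<dots> \<le> K\<^sup>2 * A + \<delta> * (n * A)"
  proof -
    have "(\<Sum>i<n. 1 * \<bar>a i\<bar>)\<^sup>2 \<le> (\<Sum>i<n. 1\<^sup>2) * (\<Sum>i<n. \<bar>a i\<bar>\<^sup>2)" by (rule Cauchy_Schwarz_ineq_sum)
    then show ?thesis using \<delta> by (intro add_left_mono mult_left_mono) (auto simp: A_def)
  qed
  also have "\<dots> = G" by (simp add: G_def algebra_simps)
  finally have le: "(LINT t|unit_leb. (?g t)\<^sup>2) \<le> G" .
  \<comment> \<open>Cauchy-Schwarz through \<open>2 |g| \<le> g^2 / s + s\<close>, with
    \<open>s\<close> the square root of the bound \<open>G\<close> for the integral of
    \<open>g^2\<close>.\<close>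
  have "(LINT t|unit_leb. \<bar>?g t\<bar>) \<le> (LINT t|unit_leb. ((?g t)\<^sup>2 / s + s) / 2)"
  proof (intro integral_mono)
    show "integrable unit_leb (\<lambda>t. ((?g t)\<^sup>2 / s + s) / 2)"
      by (intro integrable_divide Bochner_Integration.integrable_add intg2) auto
    show "integrable unit_leb (\<lambda>t. \<bar>?g t\<bar>)" by (intro integrable_abs intg)
    fix t
    have "0 \<le> (\<bar>?g t\<bar> - s)\<^sup>2" by simp
    then have "2 * \<bar>?g t\<bar> * s \<le> (?g t)\<^sup>2 + s\<^sup>2" by (simp add: power2_diff)
    then show "\<bar>?g t\<bar> \<le> ((?g t)\<^sup>2 / s + s) / 2" using s by (simp add: field_simps power2_eq_square)
  qed
  also have "\<dots> = ((LINT t|unit_leb. (?g t)\<^sup>2) / s + s) / 2"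
    using intg2 unit_leb.prob_space by simp
  also have "\<dots> \<le> (G / s + s) / 2"
    using le s by (intro divide_right_mono add_right_mono) auto
  also have "\<dots> = s" using s by (simp add: field_simps)
  also have "s = sqrt (K\<^sup>2 + \<delta> * real n) * sqrt A" by (simp add: s_def G_def real_sqrt_mult)
  finally show ?thesis by (simp add: A_def)
qed

context strongly_embedded
begin

text \<open>
  Differences \<open>h\<^sub>i\<close> of members of a separated sequence are, up to a small error in \<open>L\<^sub>1\<close>, bounded and
  almost orthogonal. So the weak parameter \<open>\<sigma>\<close> is small relative to \<open>\<surd>n\<close>, which is a lower bound
  for the integral of the square function.
\<close>

lemma square_function_small:
  assumes ui: uniformly_integrable and \<eta>: "\<eta> > 0"
  shows "\<exists>(n::nat) h \<sigma>. (\<forall>i<n. h i \<in> V) \<and> square_function unit_leb {..<n} h \<sigma> \<and>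
    0 < square_function.m unit_leb {..<n} h \<and> \<sigma> / square_function.m unit_leb {..<n} h \<le> \<eta>"
proof -
  from separated_sequence obtain f :: "nat \<Rightarrow> rfun" where f: "\<And>j. f j \<in> V" "\<And>j. L1_norm (f j) = 1"
    and sep: "\<And>i j. i \<noteq> j \<Longrightarrow> 1 \<le> L1_norm (\<lambda>t. f i t - f j t)" by blast
  have "\<eta> / 4 > 0" using \<eta> by simp
  then obtain L where L: "L > 0" and
    tails: "\<And>x. x \<in> V \<Longrightarrow> L1_norm x \<le> 1 \<Longrightarrow> (LINT u|unit_leb. \<bar>x u\<bar> * indicator {u. L < \<bar>x u\<bar>} u) \<le> \<eta> / 4"
    using ui unfolding uniformly_integrable_def by blast
  \<comment> \<open>With \<open>(2 L)^2 \<le> \<delta> n\<close> the bounded part contributes at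
    most \<open>sqrt (2 \<delta> n) = \<eta> / 2 * sqrt n\<close> to \<open>\<sigma>\<close>. The
    two truncations, costing \<open>\<eta> / 4\<close> each per function, contribute the other
    \<open>\<eta> / 2 * sqrt n\<close>.\<close>
  define \<delta> where "\<delta> = \<eta>\<^sup>2 / 8"
  have \<delta>: "\<delta> > 0" using \<eta> by (simp add: \<delta>_def)
  obtain n :: nat where "(2 * L)\<^sup>2 / \<delta> < real n" using reals_Archimedean2 by blast
  then have n: "(2 * L)\<^sup>2 \<le> \<delta> * real n" using \<delta> by (simp add: field_simps)
  have n0: "n > 0" using n L by (cases n) auto
  note fm [measurable] = V_measurable[OF f(1)]
  define b where "b k t = (if \<bar>f k t\<bar> \<le> L then f k t else 0)" for k t
  have bm [measurable]: "b k \<in> borel_measurable unit_leb" for k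
    unfolding b_def[abs_def] by measurable
  have bL: "\<bar>b k t\<bar> \<le> L" for k t using L by (auto simp: b_def)
  have dL: "\<bar>b k t - b l t\<bar> \<le> 2 * L" for k l t using bL[of k t] bL[of l t] by linarith
  have fb: "\<bar>f k t - b k t\<bar> = \<bar>f k t\<bar> * indicator {u. L < \<bar>f k u\<bar>} t" for k t
    by (auto simp: b_def)
  \<comment> \<open>Pairs of indices are chosen recursively: distinctness keeps the norm of the
    difference at least 1, and the pigeonhole argument against all earlier truncated differences
    gives almost orthogonality.\<close>
  have "\<exists>p :: nat \<Rightarrow> nat \<times> nat. \<forall>j. fst (p j) \<noteq> snd (p j) \<and>
    (\<forall>i<j. \<bar>LINT t|unit_leb. (b (fst (p i)) t - b (snd (p i)) t) * (b (fst (p j)) t - b (snd (p j)) t)\<bar> \<le> \<delta>)"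
  proof (rule dependent_wellorder_choice)
    fix j and p :: "nat \<Rightarrow> nat \<times> nat"
    let ?D = "(\<lambda>i t. b (fst (p i)) t - b (snd (p i)) t) ` {..<j}"
    have "\<exists>k l. k \<noteq> l \<and> (\<forall>d\<in>?D. \<bar>LINT t|unit_leb. d t * (b k t - b l t)\<bar> \<le> \<delta>)"
      using dL bL \<delta> by (intro pigeonhole_pairing[where K="2 * L" and L=L]) auto
    then obtain k l where "k \<noteq> l" "\<forall>d\<in>?D. \<bar>LINT t|unit_leb. d t * (b k t - b l t)\<bar> \<le> \<delta>" by blast
    then show "\<exists>q. fst q \<noteq> snd q \<and>
      (\<forall>i<j. \<bar>LINT t|unit_leb. (b (fst (p i)) t - b (snd (p i)) t) * (b (fst q) t - b (snd q) t)\<bar> \<le> \<delta>)"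
      by (intro exI[of _ "(k, l)"]) auto
  qed auto
  then obtain p :: "nat \<Rightarrow> nat \<times> nat" where p: "\<And>j. fst (p j) \<noteq> snd (p j)"
    and orth: "\<And>i j. i < j \<Longrightarrow>
      \<bar>LINT t|unit_leb. (b (fst (p i)) t - b (snd (p i)) t) * (b (fst (p j)) t - b (snd (p j)) t)\<bar> \<le> \<delta>"
    by blast
  define h where "h i t = f (fst (p i)) t - f (snd (p i)) t" for i t
  define d where "d i t = b (fst (p i)) t - b (snd (p i)) t" for i t
  have hV: "h i \<in> V" for i unfolding h_def[abs_def] by (intro V_diff f)
  have h1: "1 \<le> L1_norm (h i)" for i unfolding h_def[abs_def] by (intro sep p)
  note hi = V_integrable[OF hV]
  have dm [measurable]: "d i \<in> borel_measurable unit_leb" for i unfolding d_def[abs_def] by measurable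
  have di: "integrable unit_leb (d i)" for i
    using dL by (intro unit_leb_bounded_integrable(1)[where b="2 * L"] dm) (simp add: d_def)
  have hd: "(LINT t|unit_leb. \<bar>h i t - d i t\<bar>) \<le> \<eta> / 2" for i
  proof -
    let ?T = "\<lambda>k t. \<bar>f k t\<bar> * indicator {u. L < \<bar>f k u\<bar>} t"
    have "(LINT t|unit_leb. \<bar>h i t - d i t\<bar>) \<le> (LINT t|unit_leb. ?T (fst (p i)) t + ?T (snd (p i)) t)"
    proof (intro integral_mono)
      show "\<bar>h i t - d i t\<bar> \<le> ?T (fst (p i)) t + ?T (snd (p i)) t" for t
        unfolding fb[symmetric] h_def d_def by linarith
    qed (intro integrable_abs Bochner_Integration.integrable_add Bochner_Integration.integrable_diff
        L1_truncated_integrable f hi di)+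
    also have "\<dots> = (LINT t|unit_leb. ?T (fst (p i)) t) + (LINT t|unit_leb. ?T (snd (p i)) t)"
      by (intro Bochner_Integration.integral_add L1_truncated_integrable f)
    also have "\<dots> \<le> \<eta> / 4 + \<eta> / 4"
      using f by (intro add_mono tails) auto
    finally show ?thesis by simp
  qed
  define \<sigma> where "\<sigma> = sqrt ((2 * L)\<^sup>2 + \<delta> * real n) + \<eta> / 2 * sqrt n"
  have \<sigma>: "\<sigma> > 0" unfolding \<sigma>_def using L \<eta> \<delta> by (intro add_pos_nonneg) (auto intro: add_pos_nonneg)
  have sq: "square_function unit_leb {..<n} h \<sigma>"
  proof
    fix a :: "nat \<Rightarrow> real"
    have "(LINT t|unit_leb. \<bar>\<Sum>i<n. a i * h i t\<bar>)
      \<le> (LINT t|unit_leb. \<bar>\<Sum>i<n. a i * d i t\<bar> + (\<Sum>i<n. \<bar>a i\<bar> * \<bar>h i t - d i t\<bar>))"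
    proof (intro integral_mono)
      show "\<bar>\<Sum>i<n. a i * h i t\<bar> \<le> \<bar>\<Sum>i<n. a i * d i t\<bar> + (\<Sum>i<n. \<bar>a i\<bar> * \<bar>h i t - d i t\<bar>)" for t
      proof -
        have "(\<Sum>i<n. a i * h i t) = (\<Sum>i<n. a i * d i t) + (\<Sum>i<n. a i * (h i t - d i t))"
          by (simp add: sum.distrib[symmetric] algebra_simps)
        moreover have "\<bar>\<Sum>i<n. a i * (h i t - d i t)\<bar> \<le> (\<Sum>i<n. \<bar>a i\<bar> * \<bar>h i t - d i t\<bar>)"
          by (rule order_trans[OF sum_abs]) (simp add: abs_mult)
        ultimately show ?thesis by linarith
      qed
    qed (intro integrable_abs Bochner_Integration.integrable_add Bochner_Integration.integrable_sum
        integrable_mult_right Bochner_Integration.integrable_diff hi di)+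
    also have "\<dots> = (LINT t|unit_leb. \<bar>\<Sum>i<n. a i * d i t\<bar>) + (\<Sum>i<n. \<bar>a i\<bar> * (LINT t|unit_leb. \<bar>h i t - d i t\<bar>))"
      using hi di by simp
    also have "\<dots> \<le> sqrt ((2 * L)\<^sup>2 + \<delta> * real n) * sqrt (\<Sum>i<n. (a i)\<^sup>2) + (\<Sum>i<n. \<bar>a i\<bar> * (\<eta> / 2))"
    proof (intro add_mono sum_mono mult_left_mono hd)
      show "(LINT t|unit_leb. \<bar>\<Sum>i<n. a i * d i t\<bar>) \<le> sqrt ((2 * L)\<^sup>2 + \<delta> * real n) * sqrt (\<Sum>i<n. (a i)\<^sup>2)"
        using orth dL L \<delta> by (intro almost_orthogonal_L1) (auto simp: d_def)
    qed auto
    also have "(\<Sum>i<n. \<bar>a i\<bar> * (\<eta> / 2)) \<le> \<eta> / 2 * (sqrt n * sqrt (\<Sum>i<n. (a i)\<^sup>2))"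
    proof -
      have "(\<Sum>i<n. 1 * \<bar>a i\<bar>)\<^sup>2 \<le> (\<Sum>i<n. 1\<^sup>2) * (\<Sum>i<n. \<bar>a i\<bar>\<^sup>2)" by (rule Cauchy_Schwarz_ineq_sum)
      then have "(\<Sum>i<n. \<bar>a i\<bar>) \<le> sqrt (n * (\<Sum>i<n. (a i)\<^sup>2))" by (intro real_le_rsqrt) simp
      then have "\<eta> / 2 * (\<Sum>i<n. \<bar>a i\<bar>) \<le> \<eta> / 2 * (sqrt n * sqrt (\<Sum>i<n. (a i)\<^sup>2))"
        using \<eta> by (intro mult_left_mono) (auto simp: real_sqrt_mult)
      then show ?thesis by (simp add: sum_distrib_left mult.commute)
    qed
    finally show "(LINT t|unit_leb. \<bar>\<Sum>i<n. a i * h i t\<bar>) \<le> \<sigma> * sqrt (\<Sum>i<n. (a i)\<^sup>2)"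
      by (simp add: \<sigma>_def algebra_simps)
  qed (use \<sigma> hi in auto)
  interpret square_function unit_leb "{..<n}" h \<sigma> by (rule sq)
  have "real n = (\<Sum>i<n. 1)" by simp
  also have "\<dots> \<le> (\<Sum>i<n. L1_norm (h i))" by (intro sum_mono h1)
  also have "\<dots> = (LINT t|unit_leb. (\<Sum>i<n. \<bar>h i t\<bar>))"
    unfolding L1_norm_def using hi by (subst Bochner_Integration.integral_sum) auto
  also have "\<dots> \<le> (LINT t|unit_leb. sqrt n * F t)"
  proof (intro integral_mono)
    show "(\<Sum>i<n. \<bar>h i t\<bar>) \<le> sqrt n * F t" for t
    proof -
      have "(\<Sum>i<n. 1 * \<bar>h i t\<bar>)\<^sup>2 \<le> (\<Sum>i<n. 1\<^sup>2) * (\<Sum>i<n. \<bar>h i t\<bar>\<^sup>2)" by (rule Cauchy_Schwarz_ineq_sum)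
      then have "(\<Sum>i<n. \<bar>h i t\<bar>) \<le> sqrt (n * (\<Sum>i<n. (h i t)\<^sup>2))" by (intro real_le_rsqrt) simp
      then show ?thesis by (simp add: F_def real_sqrt_mult)
    qed
  qed (use hi F_integrable in auto)
  also have "\<dots> = sqrt n * m" by (simp add: m_def)
  finally have "sqrt n * sqrt n \<le> sqrt n * m" by simp
  then have m: "sqrt n \<le> m" using n0 by (subst (asm) mult_le_cancel_left_pos) auto
  have m0: "0 < m" using m n0 by (smt (verit) of_nat_0_less_iff real_sqrt_gt_zero)
  have "sqrt ((2 * L)\<^sup>2 + \<delta> * real n) \<le> sqrt ((\<eta> / 2)\<^sup>2 * real n)"
    using n by (simp add: \<delta>_def power2_eq_square)
  also have "\<dots> = \<eta> / 2 * sqrt n" using \<eta> by (simp add: real_sqrt_mult)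
  finally have "\<sigma> \<le> \<eta> * sqrt n" by (simp add: \<sigma>_def)
  also have "\<dots> \<le> \<eta> * m" using m \<eta> by simp
  finally have "\<sigma> / m \<le> \<eta>" using m0 by (simp add: field_simps)
  then show ?thesis using hV sq m0 by blast
qed

text \<open>\<open>\<kappa>\<close> comes from \<open>nondegenerate\<close> and is fixed before
  \<open>k\<close>, while \<open>n\<close>, \<open>h\<close> and \<open>\<sigma>\<close> vary with
  \<open>k\<close>. The level \<open>sqrt k * \<kappa> * m / 2\<close> times \<open>fund\<close> is
  at most the norm, which is at most \<open>2 * C * m\<close>; \<open>m\<close> cancels, so it does
  not matter that it depends on \<open>k\<close>.\<close>

lemma fund_geometric:
  assumes ui: uniformly_integrable
  shows "\<exists>\<kappa>>0. \<kappa> \<le> 1 \<and> (\<forall>k>0. fund (\<kappa> * (1 / 10) ^ k / 2) \<le> 4 * C / (\<kappa> * sqrt (real k)))"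
proof -
  from nondegenerate[OF ui] obtain \<delta> where \<delta>: "\<delta> > 0"
    "\<And>x. x \<in> V \<Longrightarrow> \<delta> \<le> measure unit_leb {t \<in> space unit_leb. L1_norm x / 4 \<le> \<bar>x t\<bar>}" by blast
  define \<kappa> where "\<kappa> = \<delta> / 32"
  have \<kappa>: "\<kappa> > 0" using \<delta> by (simp add: \<kappa>_def)
  have "(\<lambda>_. 0) \<in> V" using V(2) by (simp add: fun_subspace_def)
  from \<delta>(2)[OF this] have "\<delta> \<le> 1" using unit_leb.prob_le_1 by (rule order_trans)
  then have \<kappa>1: "\<kappa> \<le> 1" by (simp add: \<kappa>_def)
  have "fund (\<kappa> * (1 / 10) ^ k / 2) \<le> 4 * C / (\<kappa> * sqrt (real k))" if k: "k > 0" for k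
  proof -
    have "\<kappa> * (1 / 10) ^ k / 4 > 0" using \<kappa> by simp
    from square_function_small[OF ui this] obtain n :: nat and h \<sigma> where
      hV: "\<forall>i<n. h i \<in> V" and sq: "square_function unit_leb {..<n} h \<sigma>"
      and m: "0 < square_function.m unit_leb {..<n} h"
        "\<sigma> / square_function.m unit_leb {..<n} h \<le> \<kappa> * (1 / 10) ^ k / 4"
      by (elim exE conjE) (rule that)
    interpret square_function unit_leb "{..<n}" h \<sigma> by (rule sq)
    have lin: "(\<lambda>t. \<Sum>i<n. c i * h i t) \<in> V" for c
      using hV by (intro fun_subspace_sum[OF V(2)]) auto
    have "X S \<in> V" for S
      unfolding X_def[abs_def] signed_sum_def using lin .
    then have "\<delta> \<le> measure unit_leb {t \<in> space unit_leb. (LINT t|unit_leb. \<bar>X S t\<bar>) / 4 \<le> \<bar>X S t\<bar>}" for S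
      using \<delta>(2)[of "X S"] by (simp add: L1_norm_def)
    then have "\<kappa> \<le> measure unit_leb {t \<in> space unit_leb. \<kappa> * m \<le> F t}"
      using F_nondegenerate[OF unit_leb.prob_space_axioms m(1) \<delta>(1)] unfolding \<kappa>_def by blast
    from large_combination[OF unit_leb.prob_space_axioms m(1) k \<kappa> this m(2)]
    obtain c where c: "(LINT t|unit_leb. \<bar>\<Sum>i<n. c i * h i t\<bar>) \<le> 2 * m"
      "\<kappa> * (1 / 10) ^ k / 2 \<le> measure unit_leb {t \<in> space unit_leb. sqrt (real k) * \<kappa> * m / 2 \<le> (\<Sum>i<n. c i * h i t)}"
      by blast
    define x where "x t = (\<Sum>i<n. c i * h i t)" for t
    have xV: "x \<in> V" unfolding x_def[abs_def] by (rule lin)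
    then have xE: "x \<in> E" using V by auto
    let ?B = "{t \<in> space unit_leb. sqrt (real k) * \<kappa> * m / 2 \<le> x t}"
    note [measurable] = V_measurable[OF xV]
    have B: "?B \<in> sets unit_leb" by measurable
    have l: "0 \<le> sqrt (real k) * \<kappa> * m / 2" using \<kappa> m(1) by simp
    have "sqrt (real k) * \<kappa> * m / 2 * fund (\<kappa> * (1 / 10) ^ k / 2)
        \<le> sqrt (real k) * \<kappa> * m / 2 * fund (measure unit_leb ?B)"
      using c(2) l unit_leb.prob_le_1 unfolding x_def by (intro mult_left_mono fund_mono)
    also have "\<dots> \<le> N x" using l by (intro norm_ge_level[OF xE B]) auto
    also have "\<dots> \<le> C * L1_norm x" by (rule C[OF xV])
    also have "\<dots> \<le> C * (2 * m)" using c(1) C_pos unfolding L1_norm_def x_def by (intro mult_left_mono) auto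
    finally show ?thesis using \<kappa> m(1) k by (simp add: field_simps)
  qed
  then show ?thesis using \<kappa> \<kappa>1 by blast
qed

end

section \<open>The Lorentz space \<open>G\<^sub>1\<close>\<close>

lemma \<phi>1_eq: "0 < t \<Longrightarrow> \<phi>1 t = 2 / sqrt (4 - ln t)"
  by (simp add: \<phi>1_def ln_div)

lemma \<phi>1_0: "\<phi>1 0 = 0"
  by (simp add: \<phi>1_def)

lemma \<phi>1_root_pos: "0 < t \<Longrightarrow> t \<le> 1 \<Longrightarrow> 0 < 4 - ln (t :: real)"
  by (smt (verit) ln_le_zero_iff)

lemma \<phi>1_nonneg: "0 \<le> t \<Longrightarrow> t \<le> 1 \<Longrightarrow> 0 \<le> \<phi>1 t"
  using \<phi>1_root_pos[of t] by (cases "t = 0") (auto simp: \<phi>1_0 \<phi>1_eq)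

lemma \<phi>1_mono:
  assumes "0 \<le> s" "s \<le> t" "t \<le> 1"
  shows "\<phi>1 s \<le> \<phi>1 t"
proof (cases "s = 0")
  case True
  then show ?thesis using \<phi>1_nonneg assms by (simp add: \<phi>1_0)
next
  case False
  then have "ln s \<le> ln t" using assms by simp
  then show ?thesis using False assms \<phi>1_root_pos[of s] \<phi>1_root_pos[of t]
    by (auto simp: \<phi>1_eq intro!: divide_left_mono mult_pos_pos)
qed

text \<open>Doubling condition, paying for the passage from \<open>tail\<close> to half of it in the
  Lorentz norm estimate.\<close>

lemma \<phi>1_half:
  assumes "0 \<le> t" "t \<le> 1"
  shows "\<phi>1 t \<le> 2 * \<phi>1 (t / 2)"
proof (cases "t = 0")
  case False
  then have t: "0 < t" using assms by simp
  have "ln (2::real) \<le> 1" using ln_le_minus_one[of 2] by simp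
  moreover have ln: "ln (t / 2) = ln t - ln 2" using t by (simp add: ln_div)
  moreover have "ln t \<le> 0" using t assms by simp
  moreover have "4 - (l - l2) \<le> 4 * (4 - l)" if "l2 \<le> 1" "l \<le> 0" for l l2 :: real
    using that by (simp add: algebra_simps)
  ultimately have "4 - ln (t / 2) \<le> 4 * (4 - ln t)" by metis
  then have "sqrt (4 - ln (t / 2)) \<le> sqrt (4 * (4 - ln t))" by (rule real_sqrt_le_mono)
  also have "\<dots> = 2 * sqrt (4 - ln t)" by (subst real_sqrt_mult) simp
  finally have "sqrt (4 - ln (t / 2)) \<le> 2 * sqrt (4 - ln t)" .
  moreover have "0 < sqrt (4 - ln t)" "0 < sqrt (4 - ln (t / 2))"
    using \<phi>1_root_pos[of t] \<phi>1_root_pos[of "t / 2"] t assms by auto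
  ultimately show ?thesis using t by (simp add: \<phi>1_eq field_simps)
qed (simp add: \<phi>1_0)

text \<open>Makes \<open>\<phi>1\<close> majorise linear growth: this settles the case without
  uniform integrability and the range of \<open>t\<close> bounded away from 0.\<close>

lemma \<phi>1_ge_id:
  assumes "0 \<le> t" "t \<le> 1"
  shows "t \<le> \<phi>1 t"
proof (cases "t = 0")
  case False
  then have t: "0 < t" using assms by simp
  have u: "1 \<le> 1 / t" using t assms by simp
  then have "1 / t \<le> (1 / t)\<^sup>2" using mult_left_mono[OF u, of "1 / t"] t by (simp add: power2_eq_square)
  moreover have "ln (1 / t) \<le> 1 / t - 1" using t by (intro ln_le_minus_one) auto
  then have "- ln t \<le> 1 / t - 1" using t by (simp add: ln_div)
  ultimately have "4 - ln t \<le> 4 * (1 / t)\<^sup>2" using u by linarith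
  then have "4 - ln t \<le> (2 / t)\<^sup>2" by (simp add: power_divide)
  then have "sqrt (4 - ln t) \<le> 2 / t" using t by (intro real_le_lsqrt) auto
  moreover have "0 < sqrt (4 - ln t)" using \<phi>1_root_pos t assms by simp
  ultimately show ?thesis using t by (simp add: \<phi>1_eq field_simps)
qed (simp add: \<phi>1_0)

lemma \<phi>1_continuous: "continuous_on {0..1} \<phi>1"
  unfolding continuous_on_eq_continuous_within
proof
  fix t :: real assume t: "t \<in> {0..1}"
  show "continuous (at t within {0..1}) \<phi>1"
  proof (cases "t = 0")
    case True
    have "((\<lambda>t. 2 / sqrt (4 - ln t)) \<longlongrightarrow> (0::real)) (at_right 0)" by real_asymp
    then have "(\<phi>1 \<longlongrightarrow> 0) (at_right 0)"
      by (rule Lim_transform_eventually)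
        (auto simp: \<phi>1_eq eventually_at_filter intro!: always_eventually)
    then show ?thesis unfolding True continuous_within by (simp add: at_within_Icc_at_right \<phi>1_0)
  next
    case False
    then have t: "0 < t" "t \<le> 1" using t by auto
    have "isCont (\<lambda>t. 2 / sqrt (4 - ln t)) t"
      using t \<phi>1_root_pos[OF t] by (intro continuous_intros) auto
    moreover have "\<forall>\<^sub>F s in nhds t. 2 / sqrt (4 - ln s) = \<phi>1 s"
      using eventually_nhds_in_open[of "{0<..}" t] t by (auto simp: \<phi>1_eq elim!: eventually_mono)
    ultimately have "isCont \<phi>1 t" by (simp only: isCont_cong)
    then show ?thesis by (rule continuous_at_imp_continuous_within)
  qed
qed

text \<open>Continuity of \<open>\<phi>1\<close>, including at 0, makes the right limits equal to
  the values; in particular the Stieltjes measure has no atom at 0.\<close>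

lemma stieltjes_\<phi>1_distribution:
  "(\<lambda>t. if t < 0 then 0 else if t < 1 then (INF s\<in>{t<..1}. \<phi>1 s) else \<phi>1 1)
   = (\<lambda>t. \<phi>1 (max 0 (min t 1)))"
proof
  fix t :: real
  have "(INF s\<in>{t<..1}. \<phi>1 s) = \<phi>1 t" if t: "0 \<le> t" "t < 1"
  proof (rule antisym)
    have bdd: "bdd_below (\<phi>1 ` {t<..1})" using t \<phi>1_nonneg by (intro bdd_belowI2[of _ 0]) auto
    have "continuous (at t within {0..1}) \<phi>1"
      using \<phi>1_continuous t by (simp add: continuous_on_eq_continuous_within)
    then have "continuous (at t within {t..1}) \<phi>1" using t by (elim continuous_within_subset) auto
    then have "(\<phi>1 \<longlongrightarrow> \<phi>1 t) (at_right t)" using t by (simp add: continuous_within at_within_Icc_at_right)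
    moreover have "eventually (\<lambda>s. (INF s\<in>{t<..1}. \<phi>1 s) \<le> \<phi>1 s) (at_right t)"
      using t(2) by (auto simp: eventually_at_right[OF t(2)] intro!: exI[of _ 1] cINF_lower bdd)
    ultimately show "(INF s\<in>{t<..1}. \<phi>1 s) \<le> \<phi>1 t" by (intro tendsto_lowerbound) auto
    show "\<phi>1 t \<le> (INF s\<in>{t<..1}. \<phi>1 s)"
      using t by (intro cINF_greatest) (auto intro!: \<phi>1_mono)
  qed
  then show "(if t < 0 then 0 else if t < 1 then (INF s\<in>{t<..1}. \<phi>1 s) else \<phi>1 1) = \<phi>1 (max 0 (min t 1))"
    by (auto simp: \<phi>1_0 min_def max_def)
qed

lemma emeasure_stieltjes_\<phi>1:
  assumes "0 \<le> a" "a \<le> 1"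
  shows "emeasure (stieltjes_measure \<phi>1) {0..a} = ennreal (\<phi>1 a)"
proof -
  have "continuous_on UNIV (\<lambda>t. \<phi>1 (max 0 (min t 1)))"
    by (rule continuous_on_compose2[OF \<phi>1_continuous]) (auto intro!: continuous_intros)
  then show ?thesis
    unfolding stieltjes_measure_def stieltjes_\<phi>1_distribution using assms
    by (subst emeasure_interval_measure_Icc) (auto intro!: \<phi>1_mono simp: \<phi>1_0)
qed

section \<open>Dyadic level sets and the Lorentz norm\<close>

lemma rearrangement_ge:
  assumes "x \<in> borel_measurable unit_leb" "0 \<le> s" "0 \<le> t" "t < tail x s"
  shows "ennreal s \<le> rearrangement x t"
  unfolding rearrangement_def
proof (rule Inf_greatest)
  fix r assume "r \<in> {r. emeasure unit_leb {u \<in> space unit_leb. r < ennreal \<bar>x u\<bar>} \<le> ennreal t}"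
  then have r: "emeasure unit_leb {u \<in> space unit_leb. r < ennreal \<bar>x u\<bar>} \<le> ennreal t" by simp
  show "ennreal s \<le> r"
  proof (rule ccontr)
    assume "\<not> ennreal s \<le> r"
    then have rs: "r < ennreal s" by simp
    note [measurable] = assms(1)
    have "r < ennreal \<bar>x u\<bar>" if "s < \<bar>x u\<bar>" for u
      using rs that by (meson ennreal_leI less_imp_le less_le_trans)
    moreover have "{u \<in> space unit_leb. r < ennreal \<bar>x u\<bar>} \<in> sets unit_leb" by measurable
    ultimately have "emeasure unit_leb {u \<in> {0..1}. s < \<bar>x u\<bar>} \<le> emeasure unit_leb {u \<in> space unit_leb. r < ennreal \<bar>x u\<bar>}"
      by (intro emeasure_mono) auto
    from this r have "emeasure unit_leb {u \<in> {0..1}. s < \<bar>x u\<bar>} \<le> ennreal t" by (rule order_trans)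
    then have "ennreal (tail x s) \<le> ennreal t" by (simp add: tail_def unit_leb.emeasure_eq_measure)
    moreover have "ennreal t < ennreal (tail x s)"
      using assms(3,4) by (simp add: ennreal_less_iff)
    ultimately show False by simp
  qed
qed

text \<open>
  At \<open>t < tail x s\<close> the rearrangement is at least \<open>s\<close>. The closed intervals up to half of \<open>tail x s\<close>
  satisfy this strict inequality, at the cost of a factor \<open>2\<close>.
\<close>

lemma dyadic_levels_le_G1_norm:
  assumes x: "x \<in> G1" and \<eta>: "0 < \<eta>"
  shows "(\<Sum>k<n. \<eta> * 2 ^ k * \<phi>1 (tail x (\<eta> * 2 ^ k))) \<le> 4 * G1_norm x"
proof -
  have xm: "x \<in> borel_measurable unit_leb" and fin: "lorentz_ennnorm \<phi>1 x < \<infinity>"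
    using x by (auto simp: G1_def lorentz_space_def)
  let ?\<mu> = "stieltjes_measure \<phi>1"
  define a where "a k = tail x (\<eta> * 2 ^ k)" for k
  have a: "0 \<le> a k" "a k \<le> 1" for k unfolding a_def tail_def by (auto intro: unit_leb.prob_le_1)
  have sets: "sets ?\<mu> = sets borel" by (simp add: stieltjes_measure_def)
  \<comment> \<open>For \<open>a k = 0\<close> the interval would be \<open>{0}\<close>, where the
    strict inequality \<open>t < a k\<close> fails; hence the empty set.\<close>
  let ?I = "\<lambda>k. if a k = 0 then {} else {0..a k / 2}"
  have pt: "(\<Sum>k<n. ennreal (\<eta> * 2 ^ k / 2) * indicator (?I k) t) \<le> rearrangement x t * indicator {0..1} t" for t
  proof -
    define S where "S = {k \<in> {..<n}. t \<in> ?I k}"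
    have finS: "finite S" by (simp add: S_def)
    have "(\<Sum>k<n. ennreal (\<eta> * 2 ^ k / 2) * indicator (?I k) t) = (\<Sum>k<n. if t \<in> ?I k then ennreal (\<eta> * 2 ^ k / 2) else 0)"
      by (intro sum.cong refl) (auto simp: indicator_def)
    also have "\<dots> = (\<Sum>k\<in>S. ennreal (\<eta> * 2 ^ k / 2))"
      unfolding S_def by (rule sum.inter_filter[symmetric]) simp
    finally have eq: "(\<Sum>k<n. ennreal (\<eta> * 2 ^ k / 2) * indicator (?I k) t) = (\<Sum>k\<in>S. ennreal (\<eta> * 2 ^ k / 2))" .
    show ?thesis
    proof (cases "S = {}")
      case True
      then show ?thesis unfolding eq by simp
    next
      case False
      \<comment> \<open>The levels form a geometric progression, so all active terms at
        \<open>t\<close> together are at most the highest active level, which the rearrangement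
        dominates.\<close>
      define K where "K = Max S"
      have K: "K \<in> S" using False finS by (simp add: K_def)
      then have t: "0 \<le> t" "t \<le> a K / 2" "a K \<noteq> 0" by (auto simp: S_def split: if_splits)
      have geo: "(\<Sum>k\<le>K. 2 ^ k :: real) \<le> 2 * 2 ^ K" by (induction K) auto
      have "(\<Sum>k\<in>S. ennreal (\<eta> * 2 ^ k / 2)) \<le> (\<Sum>k\<le>K. ennreal (\<eta> * 2 ^ k / 2))"
        using finS by (intro sum_mono2) (auto simp: K_def)
      also have "\<dots> = ennreal (\<Sum>k\<le>K. \<eta> * 2 ^ k / 2)" using \<eta> by (intro sum_ennreal) auto
      also have "(\<Sum>k\<le>K. \<eta> * 2 ^ k / 2) = \<eta> / 2 * (\<Sum>k\<le>K. 2 ^ k)" by (simp add: sum_distrib_left)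
      also have "ennreal \<dots> \<le> ennreal (\<eta> * 2 ^ K)"
        using mult_left_mono[OF geo, of "\<eta> / 2"] \<eta> by (intro ennreal_leI) auto
      also have "\<dots> \<le> rearrangement x t"
        using t a[of K] \<eta> by (intro rearrangement_ge[OF xm]) (auto simp: a_def[symmetric])
      finally show ?thesis unfolding eq using t a[of K] by simp
    qed
  qed
  \<comment> \<open>The total factor 4 is 2 from the weight \<open>\<eta> * 2 ^ k / 2\<close> times
    2 from \<open>\<phi>1_half\<close>.\<close>
  have half: "\<eta> * 2 ^ k * \<phi>1 (a k) / 4 \<le> \<eta> * 2 ^ k / 2 * measure ?\<mu> (?I k)" for k
  proof (cases "a k = 0")
    case True
    then show ?thesis by (simp add: \<phi>1_0)
  next
    case False
    have "measure ?\<mu> {0..a k / 2} = \<phi>1 (a k / 2)"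
      using emeasure_stieltjes_\<phi>1[of "a k / 2"] a[of k] \<phi>1_nonneg[of "a k / 2"] by (simp add: measure_def)
    then show ?thesis using False \<phi>1_half[OF a] \<eta> by (simp add: field_simps)
  qed
  have em: "emeasure ?\<mu> (?I k) = ennreal (measure ?\<mu> (?I k))" for k
    using emeasure_stieltjes_\<phi>1[of "a k / 2"] a[of k] \<phi>1_nonneg[of "a k / 2"] by (simp add: measure_def)
  have "ennreal (\<Sum>k<n. \<eta> * 2 ^ k / 2 * measure ?\<mu> (?I k)) = (\<Sum>k<n. ennreal (\<eta> * 2 ^ k / 2) * emeasure ?\<mu> (?I k))"
  proof -
    have "ennreal (\<eta> * 2 ^ k / 2 * measure ?\<mu> (?I k)) = ennreal (\<eta> * 2 ^ k / 2) * emeasure ?\<mu> (?I k)" for k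
      unfolding em by (rule ennreal_mult) (use \<eta> in auto)
    moreover have "ennreal (\<Sum>k<n. \<eta> * 2 ^ k / 2 * measure ?\<mu> (?I k)) = (\<Sum>k<n. ennreal (\<eta> * 2 ^ k / 2 * measure ?\<mu> (?I k)))"
      by (rule sum_ennreal[symmetric]) (use \<eta> in auto)
    ultimately show ?thesis by (simp only:)
  qed
  also have "\<dots> = (\<integral>\<^sup>+t. (\<Sum>k<n. ennreal (\<eta> * 2 ^ k / 2) * indicator (?I k) t) \<partial>?\<mu>)"
    by (subst nn_integral_sum) (auto simp: sets measurable_cong_sets[OF sets refl] nn_integral_cmult_indicator)
  also have "\<dots> \<le> lorentz_ennnorm \<phi>1 x"
    unfolding lorentz_ennnorm_def by (intro nn_integral_mono pt)
  finally have "enn2real (ennreal (\<Sum>k<n. \<eta> * 2 ^ k / 2 * measure ?\<mu> (?I k))) \<le> G1_norm x"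
    unfolding G1_norm_def lorentz_norm_def by (rule enn2real_mono) (use fin in simp)
  moreover have "0 \<le> (\<Sum>k<n. \<eta> * 2 ^ k / 2 * measure ?\<mu> (?I k))"
    by (intro sum_nonneg mult_nonneg_nonneg) (use \<eta> in auto)
  ultimately have "(\<Sum>k<n. \<eta> * 2 ^ k / 2 * measure ?\<mu> (?I k)) \<le> G1_norm x"
    by (simp only: enn2real_ennreal)
  moreover have "(\<Sum>k<n. \<eta> * 2 ^ k * \<phi>1 (a k) / 4) \<le> (\<Sum>k<n. \<eta> * 2 ^ k / 2 * measure ?\<mu> (?I k))"
    by (intro sum_mono half)
  ultimately show ?thesis by (simp add: a_def sum_divide_distrib[symmetric])
qed

section \<open>Embedding of the Lorentz space\<close>

context ri
begin

lemma complete: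
  assumes "range X \<subseteq> E" "\<And>e. e > 0 \<Longrightarrow> \<exists>K. \<forall>m\<ge>K. \<forall>n\<ge>K. N (\<lambda>t. X m t - X n t) < e"
  shows "\<exists>x\<in>E. (\<lambda>n. N (\<lambda>t. X n t - x t)) \<longlonglongrightarrow> 0"
  using ri assms unfolding ri_space_def banach_fun_space_def by blast

lemma norm_diff_commute: "x \<in> E \<Longrightarrow> y \<in> E \<Longrightarrow> N (\<lambda>t. x t - y t) = N (\<lambda>t. y t - x t)"
  using norm_scale[OF diff[of x y], of "-1"] by simp

text \<open>For \<open>m \<ge> n\<close> the positive part of \<open>X n - z\<close> is at most
  \<open>|X m - z|\<close>, whose L1 norm is at most its norm in \<open>E\<close> and tends to 0. No
  subsequence converging almost everywhere is extracted.\<close>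

lemma increasing_limit_dominates:
  assumes X: "\<And>n. X n \<in> E" and inc: "\<And>m n t. m \<le> n \<Longrightarrow> X m t \<le> X n t" and z: "z \<in> E"
    and lim: "(\<lambda>n. N (\<lambda>t. X n t - z t)) \<longlonglongrightarrow> 0"
  shows "AE t in unit_leb. X n t \<le> z t"
proof -
  let ?p = "\<lambda>t. max 0 (X n t - z t)"
  have int: "integrable unit_leb ?p" using integrableD[OF X] integrableD[OF z] by auto
  have "(LINT t|unit_leb. ?p t) \<le> N (\<lambda>t. X m t - z t)" if "n \<le> m" for m
  proof -
    have "(LINT t|unit_leb. ?p t) \<le> L1_norm (\<lambda>t. X m t - z t)"
      unfolding L1_norm_def
    proof (intro integral_mono int)
      show "?p t \<le> \<bar>X m t - z t\<bar>" for t using inc[OF that, of t] by simp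
    qed (use integrableD[OF X] integrableD[OF z] in auto)
    also have "\<dots> \<le> N (\<lambda>t. X m t - z t)" by (intro L1_le diff X z)
    finally show ?thesis .
  qed
  then have "(LINT t|unit_leb. ?p t) \<le> 0"
    using lim by (intro LIMSEQ_le_const[OF lim]) blast
  moreover have "0 \<le> (LINT t|unit_leb. ?p t)" by simp
  ultimately have "(LINT t|unit_leb. ?p t) = 0" by simp
  then have "AE t in unit_leb. ?p t = 0"
    using int by (subst (asm) integral_nonneg_eq_0_iff_AE) auto
  then show ?thesis by eventually_elim (simp add: max_def split: if_splits)
qed

lemma fund_0: "fund 0 = 0"
proof -
  have "AE t in unit_leb. (indicator {0..0} t :: real) = 0"
    using AE_unit_leb_pos by eventually_elim simp
  then show ?thesis
    using normed indicator_in[OF interval_sets[of 0]] unfolding normed_fun_space_def fund_def by auto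
qed

text \<open>\<open>|x|\<close> is dominated by \<open>\<eta>\<close> plus the sum of
  \<open>\<eta> * 2 ^ Suc k\<close> times the indicator of \<open>{|x| > \<eta> * 2 ^ k}\<close>.
  The norms of these terms are summable by the dyadic estimate, so completeness gives a sum
  \<open>z\<close> in \<open>E\<close>; finally \<open>\<eta>\<close> tends to 0. The constant 8 is
  4 from that estimate times 2 from the next higher level \<open>Suc k\<close>.\<close>

lemma G1_embeds:
  assumes K: "\<And>t. t \<in> {0<..1} \<Longrightarrow> fund t \<le> K * \<phi>1 t" and K0: "0 \<le> K"
  shows "inclusion_bounded G1 G1_norm E N"
proof -
  have main: "x \<in> E \<and> N x \<le> \<eta> + 8 * K * G1_norm x" if x: "x \<in> G1" and \<eta>: "0 < \<eta>" for x \<eta>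
  proof -
    have xm: "x \<in> borel_measurable unit_leb" using x by (simp add: G1_def lorentz_space_def)
    define A where "A k = {u \<in> {0..1}. \<eta> * 2 ^ k < \<bar>x u\<bar>}" for k :: nat
    have A: "A k \<in> sets unit_leb" for k unfolding A_def by (rule level_set[OF xm])
    define c where "c k = \<eta> * 2 ^ Suc k * fund (tail x (\<eta> * 2 ^ k))" for k
    have t01: "0 \<le> tail x s" "tail x s \<le> 1" for s
      unfolding tail_def by (auto intro: unit_leb.prob_le_1)
    have c0: "0 \<le> c k" for k using \<eta> fund_nonneg[OF t01(2)] by (simp add: c_def)
    have NA: "N (\<lambda>t. \<eta> * 2 ^ Suc k * indicator (A k) t) = c k" for k
      using norm_scale[OF indicator_in[OF A]] fund_indicator[OF A] \<eta> by (simp add: c_def tail_def A_def abs_mult)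
    have fK: "fund (tail x s) \<le> K * \<phi>1 (tail x s)" for s
      using K[of "tail x s"] t01[of s] by (cases "tail x s = 0") (auto simp: fund_0 \<phi>1_0)
    have sum_c: "(\<Sum>k<n. c k) \<le> 8 * K * G1_norm x" for n
    proof -
      have "(\<Sum>k<n. c k) \<le> (\<Sum>k<n. 2 * K * (\<eta> * 2 ^ k * \<phi>1 (tail x (\<eta> * 2 ^ k))))"
      proof (intro sum_mono)
        fix k
        have "c k \<le> \<eta> * 2 ^ Suc k * (K * \<phi>1 (tail x (\<eta> * 2 ^ k)))"
          unfolding c_def using \<eta> by (intro mult_left_mono fK) auto
        then show "c k \<le> 2 * K * (\<eta> * 2 ^ k * \<phi>1 (tail x (\<eta> * 2 ^ k)))" by (simp add: mult_ac)
      qed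
      also have "\<dots> \<le> 2 * K * (4 * G1_norm x)"
        unfolding sum_distrib_left[symmetric] using dyadic_levels_le_G1_norm[OF x \<eta>] K0
        by (intro mult_left_mono) auto
      finally show ?thesis by simp
    qed
    define Y where "Y n t = (\<Sum>k<n. \<eta> * 2 ^ Suc k * indicator (A k) t)" for n t
    have termE: "(\<lambda>t. \<eta> * 2 ^ Suc k * indicator (A k) t) \<in> E" for k
      by (intro scale indicator_in A)
    have YE: "Y n \<in> E" and NY: "N (Y n) \<le> (\<Sum>k<n. c k)" for n
      unfolding Y_def[abs_def] using sum_in[of "{..<n}" "\<lambda>k t. \<eta> * 2 ^ Suc k * indicator (A k) t", OF _ termE]
      by (simp_all only: NA finite_lessThan simp_thms)
    have Ymono: "Y m t \<le> Y n t" if "m \<le> n" for m n t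
      unfolding Y_def using that \<eta> by (intro sum_mono2) auto
    have summ: "summable c"
      using c0 sum_c by (intro summableI_nonneg_bounded) auto
    have Ydiff: "N (\<lambda>t. Y n t - Y m t) \<le> (\<Sum>k\<in>{m..<n}. c k)" if "m \<le> n" for m n
    proof -
      have "(\<lambda>t. Y n t - Y m t) = (\<lambda>t. \<Sum>k\<in>{m..<n}. \<eta> * 2 ^ Suc k * indicator (A k) t)"
      proof
        fix t
        show "Y n t - Y m t = (\<Sum>k\<in>{m..<n}. \<eta> * 2 ^ Suc k * indicator (A k) t)"
          unfolding Y_def lessThan_atLeast0 by (rule sum_diff_nat_ivl) (use that in auto)
      qed
      then show ?thesis 
        using sum_in[of "{m..<n}" "\<lambda>k t. \<eta> * 2 ^ Suc k * indicator (A k) t", OF _ termE]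
        by (simp_all only: NA finite_atLeastLessThan simp_thms)
    qed
    have "\<exists>M. \<forall>m\<ge>M. \<forall>n\<ge>M. N (\<lambda>t. Y m t - Y n t) < e" if e: "e > 0" for e
    proof -
      from summ e obtain M where M: "\<And>m n. m \<ge> M \<Longrightarrow> norm (sum c {m..<n}) < e"
        unfolding summable_Cauchy by blast
      have "N (\<lambda>t. Y m t - Y n t) < e" if "m \<ge> M" "n \<ge> M" for m n
      proof (cases "n \<le> m")
        case True
        then show ?thesis using Ydiff[OF True] M[OF that(2), of m] by simp
      next
        case False
        then have "N (\<lambda>t. Y m t - Y n t) \<le> (\<Sum>k\<in>{m..<n}. c k)"
          using Ydiff[of m n] norm_diff_commute[OF YE YE, of m n] by simp
        then show ?thesis using M[OF that(1), of n] by simp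
      qed
      then show ?thesis by blast
    qed
    then obtain z where z: "z \<in> E" and lim: "(\<lambda>n. N (\<lambda>t. Y n t - z t)) \<longlonglongrightarrow> 0"
      using complete[of Y] YE by blast
    have "AE t in unit_leb. \<forall>n. Y n t \<le> z t"
      unfolding AE_all_countable using increasing_limit_dominates[OF YE Ymono z lim] by blast
    then have dom: "AE t in unit_leb. \<bar>x t\<bar> \<le> \<bar>\<eta> + \<bar>z t\<bar>\<bar>"
      using AE_unit_leb_pos
    proof eventually_elim
      case (elim t)
      show ?case
      proof (cases "\<bar>x t\<bar> \<le> \<eta>")
        case True
        then show ?thesis by simp
      next
        case False
        have ex: "\<exists>k. \<bar>x t\<bar> \<le> \<eta> * 2 ^ k"
        proof -
          obtain k where "\<bar>x t\<bar> / \<eta> < 2 ^ k" using real_arch_pow[of 2 "\<bar>x t\<bar> / \<eta>"] by auto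
          then show ?thesis using \<eta> by (intro exI[of _ k]) (simp add: field_simps)
        qed
        \<comment> \<open>With \<open>k = Suc j\<close> this brackets \<open>|x t|\<close> between
          \<open>\<eta> * 2 ^ j\<close> and \<open>\<eta> * 2 ^ Suc j\<close>, so the single term
          with index \<open>j\<close> already dominates it.\<close>
        define k where "k = (LEAST k. \<bar>x t\<bar> \<le> \<eta> * 2 ^ k)"
        have k: "\<bar>x t\<bar> \<le> \<eta> * 2 ^ k" unfolding k_def by (rule LeastI_ex[OF ex])
        have "k \<noteq> 0" using k False by (intro notI) simp
        then obtain j where j: "k = Suc j" by (cases k) auto
        have "\<not> \<bar>x t\<bar> \<le> \<eta> * 2 ^ j" using not_less_Least[of j "\<lambda>k. \<bar>x t\<bar> \<le> \<eta> * 2 ^ k"] j k_def by simp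
        then have "t \<in> A j" using elim by (simp add: A_def)
        then have "\<bar>x t\<bar> \<le> \<eta> * 2 ^ Suc j * indicator (A j) t" using k j by simp
        also have "\<dots> \<le> Y (Suc j) t"
          unfolding Y_def using \<eta> by (intro member_le_sum) auto
        also have "\<dots> \<le> z t" using elim by blast
        finally show ?thesis using \<eta> by simp
      qed
    qed
    have zabs: "(\<lambda>t. \<bar>z t\<bar>) \<in> E" "N (\<lambda>t. \<bar>z t\<bar>) \<le> N z"
      using measurableD[OF z] by (auto intro!: lattice[OF z])
    have const: "(\<lambda>t. \<eta>) \<in> E" "N (\<lambda>t. \<eta>) \<le> \<eta>"
      using \<eta> by (auto intro!: bounded)
    have "N z \<le> 8 * K * G1_norm x"
    proof (rule LIMSEQ_le_const)
      show "(\<lambda>n. 8 * K * G1_norm x + N (\<lambda>t. Y n t - z t)) \<longlonglongrightarrow> 8 * K * G1_norm x"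
        using tendsto_add[OF tendsto_const lim] by simp
      have "N z \<le> 8 * K * G1_norm x + N (\<lambda>t. Y n t - z t)" for n
      proof -
        have "N z = N (\<lambda>t. Y n t + (z t - Y n t))" by simp
        also have "\<dots> \<le> N (Y n) + N (\<lambda>t. z t - Y n t)" by (intro triangle YE diff z)
        finally show ?thesis using NY[of n] sum_c[of n] norm_diff_commute[OF YE z, of n] by simp
      qed
      then show "\<exists>M. \<forall>n\<ge>M. N z \<le> 8 * K * G1_norm x + N (\<lambda>t. Y n t - z t)" by blast
    qed
    moreover have "N (\<lambda>t. \<eta> + \<bar>z t\<bar>) \<le> N (\<lambda>t. \<eta>) + N (\<lambda>t. \<bar>z t\<bar>)"
      by (intro triangle const zabs)
    moreover have "x \<in> E" "N x \<le> N (\<lambda>t. \<eta> + \<bar>z t\<bar>)"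
      using lattice[OF add[OF const(1) zabs(1)] xm dom] by auto
    ultimately show ?thesis using const zabs by linarith
  qed
  have "G1 \<subseteq> E" using main[OF _ zero_less_one] by blast
  moreover have "N x \<le> 8 * K * G1_norm x" if "x \<in> G1" for x
  proof (rule field_le_epsilon)
    fix e :: real assume "0 < e"
    from main[OF that this] show "N x \<le> 8 * K * G1_norm x + e" by simp
  qed
  ultimately show ?thesis unfolding inclusion_bounded_def by blast
qed

text \<open>Monotonicity interpolates between the points \<open>a / 10^k\<close>: for
  \<open>t \<le> a / 10\<close> the index \<open>k\<close> is the integer part of \<open>y\<close>,
  defined by \<open>t = a / 10^y\<close>, and \<open>4 - ln t\<close> is comparable to
  \<open>k\<close>. For larger \<open>t\<close> the bound \<open>fund t \<le> 1\<close> is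
  enough.\<close>

lemma fund_le_\<phi>1_of_geometric:
  assumes a: "0 < a" "a \<le> 1" and B: "0 \<le> B"
    and geo: "\<And>k. k > 0 \<Longrightarrow> fund (a * (1 / 10) ^ k) \<le> B / sqrt (real k)"
  shows "\<exists>K\<ge>0. \<forall>t\<in>{0<..1}. fund t \<le> K * \<phi>1 t"
proof -
  \<comment> \<open>From \<open>4 - ln t = 4 + y * ln 10 - ln a\<close> with
    \<open>y \<le> 2 * k\<close> and \<open>1 \<le> k\<close> one gets
    \<open>4 - ln t \<le> D * k\<close>.\<close>
  define D where "D = 4 + 2 * ln 10 - ln a"
  have "ln a \<le> 0" using a by simp
  moreover have "0 < ln (10::real)" by simp
  ultimately have D: "D > 0" unfolding D_def by linarith
  define K where "K = max (10 / a) (B * sqrt D / 2)"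
  have K0: "0 \<le> K" using a by (simp add: K_def le_max_iff_disj)
  have "fund t \<le> K * \<phi>1 t" if t: "t \<in> {0<..1}" for t
  proof (cases "t \<le> a / 10")
    case False
    have "fund t \<le> 1" using t by (intro fund_le_1) simp
    also have "1 \<le> 10 / a * t" using False a by (simp add: field_simps)
    also have "\<dots> \<le> 10 / a * \<phi>1 t" using \<phi>1_ge_id[of t] t a by (intro mult_left_mono) auto
    also have "\<dots> \<le> K * \<phi>1 t" using \<phi>1_nonneg[of t] t by (intro mult_right_mono) (auto simp: K_def)
    finally show ?thesis .
  next
    case True
    from t have t: "0 < t" "t \<le> 1" by auto
    define y where "y = ln (a / t) / ln 10"
    have "ln 10 \<le> ln (a / t)" using True t a by (intro ln_mono) (auto simp: field_simps)
    then have y1: "1 \<le> y" by (simp add: y_def)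
    define k where "k = nat \<lfloor>y\<rfloor>"
    have k: "real k \<le> y" "y < real k + 1" "k > 0" unfolding k_def using y1 by linarith+
    then have k2: "y \<le> 2 * real k" by linarith
    have "real k * ln 10 \<le> ln (a / t)" using k(1) by (simp add: y_def field_simps)
    then have "ln (10 ^ k) \<le> ln (a / t)" by (simp add: ln_realpow)
    then have "10 ^ k \<le> a / t" using t a by (subst (asm) ln_le_cancel_iff) auto
    then have "t \<le> a * (1 / 10) ^ k" using t by (simp add: field_simps power_divide)
    moreover have "a * (1 / 10) ^ k \<le> 1 * 1" using a by (intro mult_mono power_le_one) auto
    ultimately have "fund t \<le> fund (a * (1 / 10) ^ k)" by (intro fund_mono) auto
    also have "\<dots> \<le> B / sqrt (real k)" by (rule geo[OF k(3)])
    finally have 1: "fund t \<le> B / sqrt (real k)" .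
    have "4 - ln t = 4 + y * ln 10 - ln a" using t a by (simp add: y_def ln_div)
    also have "\<dots> \<le> 4 * real k + 2 * real k * ln 10 + (- ln a) * real k"
    proof -
      have "y * ln 10 \<le> 2 * real k * ln 10" using k2 by (intro mult_right_mono) auto
      moreover have "(- ln a) * 1 \<le> (- ln a) * real k" using k(3) \<open>ln a \<le> 0\<close> by (intro mult_left_mono) auto
      moreover have "1 \<le> real k" using k(3) by simp
      ultimately show ?thesis by linarith
    qed
    also have "\<dots> = D * real k" by (simp add: D_def algebra_simps)
    finally have "sqrt (4 - ln t) \<le> sqrt D * sqrt (real k)" using D by (simp flip: real_sqrt_mult)
    then have "2 / (sqrt D * sqrt (real k)) \<le> \<phi>1 t"
      unfolding \<phi>1_eq[OF t(1)] using \<phi>1_root_pos[OF t] k(3) D by (intro divide_left_mono) auto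
    then have "B * sqrt D / 2 * (2 / (sqrt D * sqrt (real k))) \<le> B * sqrt D / 2 * \<phi>1 t"
      using B D by (intro mult_left_mono) auto
    then have "B / sqrt (real k) \<le> B * sqrt D / 2 * \<phi>1 t" using D by simp
    also have "\<dots> \<le> K * \<phi>1 t" using \<phi>1_nonneg[of t] t by (intro mult_right_mono) (auto simp: K_def)
    finally show ?thesis using 1 by simp
  qed
  then show ?thesis using K0 by blast
qed

end

theorem theorem5:
  fixes E :: "(real \<Rightarrow> real) set" and N :: "(real \<Rightarrow> real) \<Rightarrow> real"
  assumes "ri_space E N"
    and "\<not> strictly_singular E N L1_norm (\<lambda>x. x)"
  shows "inclusion_bounded G1 G1_norm E N"
proof -
  interpret ri E N by standard (rule assms(1))
  from assms(2) obtain V c where V: "V \<subseteq> E" "fun_subspace V" "infinite_dim V"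
    and c: "c > 0" "\<And>x. x \<in> V \<Longrightarrow> c * N x \<le> L1_norm x"
    unfolding strictly_singular_def isomorphism_onto_image_def by blast
  interpret strongly_embedded E N V "1 / c"
    using V c by unfold_locales (auto simp: field_simps)
  \<comment> \<open>Both alternatives of the dichotomy end in this bound: linear growth through
    \<open>t \<le> \<phi>1 t\<close>, uniform integrability through the geometric sequence starting
    at \<open>a = \<kappa> / 2\<close>.\<close>
  have "\<exists>K\<ge>0. \<forall>t\<in>{0<..1}. fund t \<le> K * \<phi>1 t"
    using linear_fund_or_uniformly_integrable
  proof
    assume "\<exists>K. \<forall>t\<in>{0<..1}. fund t \<le> K * t"
    then obtain K where K: "\<And>t. t \<in> {0<..1} \<Longrightarrow> fund t \<le> K * t" by blast
    have "fund t \<le> \<bar>K\<bar> * \<phi>1 t" if t: "t \<in> {0<..1}" for t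
    proof -
      have "fund t \<le> K * t" by (rule K[OF t])
      also have "\<dots> \<le> \<bar>K\<bar> * \<phi>1 t" using t \<phi>1_ge_id[of t] by (intro mult_mono) auto
      finally show ?thesis .
    qed
    then show ?thesis by (intro exI[of _ "\<bar>K\<bar>"]) auto
  next
    assume uniformly_integrable
    from fund_geometric[OF this] obtain \<kappa> where \<kappa>: "\<kappa> > 0" "\<kappa> \<le> 1"
      "\<And>k. k > 0 \<Longrightarrow> fund (\<kappa> * (1 / 10) ^ k / 2) \<le> 4 * (1 / c) / (\<kappa> * sqrt (real k))" by blast
    show ?thesis
      using \<kappa> c(1) by (intro fund_le_\<phi>1_of_geometric[of "\<kappa> / 2" "4 * (1 / c) / \<kappa>"]) (auto simp: mult.assoc)
  qed
  then show ?thesis using G1_embeds by blast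
qed

end
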